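(* Let $G$ be a finite group, let $\mathbb{F}$ be a field of characteristic $p>0$, let $H$ be a subgroup of $G$ of index $s:=|G:H|\ge 2$, and let $V$ be an $\mathbb{F}[H]$-module of dimension $a$. Let $S$ be the permutation group induced by $G$ on the set of right cosets of $H$ in $G$. Define $E':=E_{sol}$ if $S$ contains a soluble transitive subgroup, and $E':=E$ otherwise. Let $M$ be a submodule of the induced module $V\uparrow^G_H$. Then $d_G(M)\le a\,E'(s,p)$.
   Context: $d_G(M)$ is the minimal number of elements required to generate $M$ as an $\mathbb{F}[G]$-module. For a positive integer $s$ with prime factorisation $s=p_1^{r_1}\cdots p_t^{r_t}$, put $K(s):=\sum_i r_i(p_i-1)$ and $\widetilde{\omega}(s):=\frac{s}{2^{K(s)}}\binom{K(s)}{\lfloor K(s)/2\rfloor}$. For a prime $p$, $s_p$ denotes the $p$-part of $s$ (the largest power of $p$ dividing $s$), and $\mathrm{lpp}(s):=\max\{s_q : q \text{ prime}\}$. With $b:=\sqrt{2/\pi}$, define $$E(s,p):=\min\left\{\left\lfloor \frac{bs}{\sqrt{(p-1)\log_p s_p}}\right\rfloor,\ \frac{s}{\mathrm{lpp}(s/s_p)}\right\},\qquad E_{sol}(s,p):=\min\{\widetilde{\omega}(s),s_p\},$$ where $\left\lfloor bs/\sqrt{(p-1)\log_p s_p}\right\rfloor$ is taken to be $\infty$ if $s_p=1$. *)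

theory Defs
  imports
    Complex_Main
    "HOL-Library.Function_Algebras"
    "HOL-Computational_Algebra.Primes"
    "HOL-Algebra.Group_Action"
    "HOL-Algebra.Solvable_Groups"
begin

section \<open>Modules over group algebras\<close>

text \<open>
  A (right) \<open>F[G]\<close>-module is given by an \<open>F\<close>-subspace \<open>W\<close> of an ambient \<open>F\<close>-vector space together
  with a right action of \<open>G\<close> on \<open>W\<close> by linear maps. Nothing is assumed about \<open>act w g\<close> when
  \<open>w \<notin> W\<close> or \<open>g \<notin> carrier G\<close>.
\<close>

locale group_module = group G + vector_space scale
  for G :: "('g, 'm) monoid_scheme" (structure)
    and scale :: "'f::field \<Rightarrow> 'v::ab_group_add \<Rightarrow> 'v" +
  fixes act :: "'v \<Rightarrow> 'g \<Rightarrow> 'v" and W :: "'v set"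
  assumes subspace_W: "subspace W"
    and act_closed: "\<lbrakk>w \<in> W; g \<in> carrier G\<rbrakk> \<Longrightarrow> act w g \<in> W"
    and act_add: "\<lbrakk>v \<in> W; w \<in> W; g \<in> carrier G\<rbrakk> \<Longrightarrow> act (v + w) g = act v g + act w g"
    and act_scale: "\<lbrakk>w \<in> W; g \<in> carrier G\<rbrakk> \<Longrightarrow> act (scale c w) g = scale c (act w g)"
    and act_one: "w \<in> W \<Longrightarrow> act w \<one> = w"
    and act_mult: "\<lbrakk>w \<in> W; g \<in> carrier G; h \<in> carrier G\<rbrakk> \<Longrightarrow> act w (g \<otimes> h) = act (act w g) h"

definition group_submodule ::
  "('g, 'm) monoid_scheme \<Rightarrow> ('f::field \<Rightarrow> 'v::ab_group_add \<Rightarrow> 'v) \<Rightarrow> ('v \<Rightarrow> 'g \<Rightarrow> 'v) \<Rightarrow>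
    'v set \<Rightarrow> 'v set \<Rightarrow> bool" where
  "group_submodule G scale act N M \<longleftrightarrow>
     N \<subseteq> M \<and> module.subspace scale N \<and> (\<forall>w\<in>N. \<forall>g\<in>carrier G. act w g \<in> N)"

definition generated_submodule ::
  "('g, 'm) monoid_scheme \<Rightarrow> ('f::field \<Rightarrow> 'v::ab_group_add \<Rightarrow> 'v) \<Rightarrow> ('v \<Rightarrow> 'g \<Rightarrow> 'v) \<Rightarrow>
    'v set \<Rightarrow> 'v set \<Rightarrow> 'v set" where
  "generated_submodule G scale act M X = \<Inter>{N. group_submodule G scale act N M \<and> X \<subseteq> N}"

text \<open>The minimal number of generators; only meaningful if \<open>M\<close> is finitely generated.\<close>

definition min_generators ::
  "('g, 'm) monoid_scheme \<Rightarrow> ('f::field \<Rightarrow> 'v::ab_group_add \<Rightarrow> 'v) \<Rightarrow> ('v \<Rightarrow> 'g \<Rightarrow> 'v) \<Rightarrow>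
    'v set \<Rightarrow> nat" where
  "min_generators G scale act M =
     (LEAST n. \<exists>X. finite X \<and> X \<subseteq> M \<and> card X = n \<and> generated_submodule G scale act M X = M)"

lemma (in group_module) group_module_submodule:
  assumes "group_submodule G scale act N W"
  shows "group_module G scale act N"
proof -
  have "N \<subseteq> W" "subspace N" "\<forall>w\<in>N. \<forall>g\<in>carrier G. act w g \<in> N"
    using assms unfolding group_submodule_def by auto
  then show ?thesis
    by unfold_locales (auto simp: act_add act_scale act_one act_mult subset_iff)
qed

section \<open>Induced modules\<close>

text \<open>
  For a finite group \<open>G\<close>, the module \<open>V \<otimes>\<^bsub>F[H]\<^esub> F[G]\<close> is realised on the functions
  \<open>f : G \<rightarrow> V\<close> with \<open>f (h x) = f x \<cdot> h\<inverse>\<close> for \<open>h \<in> H\<close>. Such an \<open>f\<close> stands for the sum of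
  \<open>f r \<otimes> r\<close> over a right transversal of \<open>H\<close>; the condition says exactly that \<open>f r \<otimes> r\<close> depends only
  on the coset of \<open>r\<close>, because \<open>v h \<otimes> x = v \<otimes> h x\<close>. Right multiplication by \<open>g\<close> becomes
  \<open>(f \<cdot> g) x = f (x g\<inverse>)\<close>. Functions are set to \<open>0\<close> outside of \<open>carrier G\<close>.
\<close>

definition induced_module ::
  "('g, 'm) monoid_scheme \<Rightarrow> 'g set \<Rightarrow> ('v::ab_group_add \<Rightarrow> 'g \<Rightarrow> 'v) \<Rightarrow> 'v set \<Rightarrow> ('g \<Rightarrow> 'v) set" where
  "induced_module G H act V =
     {f. (\<forall>x. x \<notin> carrier G \<longrightarrow> f x = 0) \<and> (\<forall>x\<in>carrier G. f x \<in> V) \<and>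
         (\<forall>h\<in>H. \<forall>x\<in>carrier G. f (h \<otimes>\<^bsub>G\<^esub> x) = act (f x) (inv\<^bsub>G\<^esub> h))}"

definition induced_act ::
  "('g, 'm) monoid_scheme \<Rightarrow> ('g \<Rightarrow> 'v::ab_group_add) \<Rightarrow> 'g \<Rightarrow> ('g \<Rightarrow> 'v)" where
  "induced_act G f g = (\<lambda>x. if x \<in> carrier G then f (x \<otimes>\<^bsub>G\<^esub> inv\<^bsub>G\<^esub> g) else 0)"

definition induced_scale ::
  "('f \<Rightarrow> 'v \<Rightarrow> 'v) \<Rightarrow> 'f \<Rightarrow> ('g \<Rightarrow> 'v) \<Rightarrow> ('g \<Rightarrow> 'v)" where
  "induced_scale scale c f = (\<lambda>x. scale c (f x))"

text \<open>The map \<open>v \<mapsto> v \<otimes> 1\<close>.\<close>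

definition induced_embed ::
  "('g, 'm) monoid_scheme \<Rightarrow> 'g set \<Rightarrow> ('v::ab_group_add \<Rightarrow> 'g \<Rightarrow> 'v) \<Rightarrow> 'v \<Rightarrow> ('g \<Rightarrow> 'v)" where
  "induced_embed G H act v = (\<lambda>x. if x \<in> H then act v (inv\<^bsub>G\<^esub> x) else 0)"

lemma vector_space_induced_scale:
  assumes "vector_space scale"
  shows "vector_space (induced_scale scale :: 'f::field \<Rightarrow> ('g \<Rightarrow> 'v::ab_group_add) \<Rightarrow> _)"
proof -
  interpret vector_space scale by fact
  show ?thesis
    by unfold_locales
      (auto simp: induced_scale_def fun_eq_iff scale_right_distrib scale_left_distrib)
qed

context
  fixes G :: "('g, 'm) monoid_scheme" (structure) and H
    and scale :: "'f::field \<Rightarrow> 'v::ab_group_add \<Rightarrow> 'v" and act V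
  assumes G: "group G" and H: "subgroup H G"
    and V: "group_module (G\<lparr>carrier := H\<rparr>) scale act V"
begin

interpretation G: group G by (rule G)
interpretation H: subgroup H G by (rule H)
interpretation V: group_module "G\<lparr>carrier := H\<rparr>" scale act V by (rule V)

lemma group_module_induced:
  "group_module G (induced_scale scale) (induced_act G) (induced_module G H act V)"
proof -
  interpret F: vector_space "induced_scale scale :: 'f \<Rightarrow> ('g \<Rightarrow> 'v) \<Rightarrow> _"
    by (rule vector_space_induced_scale) unfold_locales
  have act_zero: "act 0 h = 0" if "h \<in> H" for h
    using V.act_add[of 0 0 h] that V.subspace_0[OF V.subspace_W] by simp
  have sub: "F.subspace (induced_module G H act V)"
    unfolding F.subspace_def
    using V.subspace_W
    by (auto simp: induced_module_def induced_scale_def act_zero V.act_add V.act_scale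
        V.subspace_0 V.subspace_add V.subspace_scale)
  show ?thesis
  proof (unfold_locales, rule sub)
    fix f g assume f: "f \<in> induced_module G H act V" and g: "g \<in> carrier G"
    have "f (h \<otimes> x \<otimes> inv g) = act (f (x \<otimes> inv g)) (inv h)"
      if "h \<in> H" "x \<in> carrier G" for h x
      using f g that by (simp add: induced_module_def G.m_assoc)
    then show "induced_act G f g \<in> induced_module G H act V"
      using f g by (auto simp: induced_module_def induced_act_def)
    show "induced_act G (induced_scale scale c f) g = induced_scale scale c (induced_act G f g)"
      for c by (auto simp: induced_act_def induced_scale_def)
    show "induced_act G (f + f') g = induced_act G f g + induced_act G f' g" for f'
      by (auto simp: induced_act_def)
    show "induced_act G (f) (g \<otimes> k) = induced_act G (induced_act G f g) k"
      if "k \<in> carrier G" for k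
      using g that by (auto simp: induced_act_def G.inv_mult_group G.m_assoc)
  next
    fix f assume "f \<in> induced_module G H act V"
    then show "induced_act G f \<one> = f"
      by (auto simp: induced_act_def induced_module_def)
  qed
qed

text \<open>
  Up to isomorphism the induced module is characterised by containing a copy of \<open>V\<close> as an
  \<open>H\<close>-submodule and being the direct sum of its translates along a right transversal.
\<close>

lemma induced_embed_mem:
  assumes "v \<in> V"
  shows "induced_embed G H act v \<in> induced_module G H act V"
proof -
  have "h \<otimes> x \<in> H \<longleftrightarrow> x \<in> H" if "h \<in> H" "x \<in> carrier G" for h x
  proof
    assume "h \<otimes> x \<in> H"
    then have "inv h \<otimes> (h \<otimes> x) \<in> H"
      using that by blast
    then show "x \<in> H"
      using that by (simp add: G.m_assoc[symmetric])
  qed (use that in blast)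
  moreover have "act 0 h = 0" if "h \<in> H" for h
    using V.act_add[of 0 0 h] that V.subspace_0[OF V.subspace_W] by simp
  moreover have "act v (inv (h \<otimes> x)) = act (act v (inv x)) (inv h)" if "h \<in> H" "x \<in> H" for h x
    using that assms V.act_mult[of v "inv x" "inv h"] by (simp add: G.inv_mult_group)
  ultimately show ?thesis
    using assms V.act_closed[of v] V.subspace_0[OF V.subspace_W]
    by (auto simp: induced_module_def induced_embed_def)
qed

lemma induced_embed_linear:
  assumes "v \<in> V" "w \<in> V"
  shows "induced_embed G H act (v + w) = induced_embed G H act v + induced_embed G H act w"
    and "induced_embed G H act (scale c v) = induced_scale scale c (induced_embed G H act v)"
  using assms
  by (auto simp: induced_embed_def induced_scale_def fun_eq_iff V.act_add V.act_scale)

lemma induced_embed_act: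
  assumes "v \<in> V" "h \<in> H"
  shows "induced_embed G H act (act v h) = induced_act G (induced_embed G H act v) h"
proof
  fix x
  have "x \<otimes> inv h \<in> H \<longleftrightarrow> x \<in> H" if "x \<in> carrier G"
  proof
    assume "x \<otimes> inv h \<in> H"
    then have "x \<otimes> inv h \<otimes> h \<in> H"
      using assms by blast
    then show "x \<in> H"
      using that assms by (simp add: G.m_assoc)
  qed (use assms in blast)
  moreover have "act v (inv (x \<otimes> inv h)) = act (act v h) (inv x)" if "x \<in> H"
    using that assms V.act_mult[of v h "inv x"] by (simp add: G.inv_mult_group)
  ultimately show "induced_embed G H act (act v h) x =
      induced_act G (induced_embed G H act v) h x"
    by (auto simp: induced_embed_def induced_act_def)
qed

lemma inj_on_induced_embed: "inj_on (induced_embed G H act) V"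
proof (rule inj_onI)
  fix v w assume "v \<in> V" "w \<in> V" "induced_embed G H act v = induced_embed G H act w"
  then show "v = w"
    using V.act_one by (auto simp: induced_embed_def dest!: fun_cong[of _ _ \<one>])
qed

lemma induced_translate_apply:
  assumes "\<And>C. C \<in> rcosets H \<Longrightarrow> r C \<in> C" and "v \<in> V" and "C \<in> rcosets H" and "D \<in> rcosets H"
  shows "induced_act G (induced_embed G H act v) (r C) (r D) = (if C = D then v else 0)"
proof -
  have carr: "r C \<in> carrier G" "r D \<in> carrier G"
    using assms H.rcosets_carrier[OF G] by blast+
  have "C = H #> r C" "D = H #> r D"
    using assms G.repr_independence[OF _ _ H] unfolding RCOSETS_def by blast+
  then have "r D \<otimes> inv (r C) \<in> H \<longleftrightarrow> C = D"
    using carr assms(1)[OF assms(4)] G.repr_independence[OF _ carr(1) H] H.rcos_module[OF G carr]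
    by blast
  then show ?thesis
    using carr assms(2) V.act_one[of v] by (auto simp: induced_embed_def induced_act_def)
qed

lemma induced_decomposition:
  assumes "finite (carrier G)" and "\<And>C. C \<in> rcosets H \<Longrightarrow> r C \<in> C"
    and f: "f \<in> induced_module G H act V"
  shows "\<exists>!c. c \<in> extensional (rcosets H) \<inter> (rcosets H \<rightarrow> V) \<and>
    f = (\<Sum>C\<in>rcosets H. induced_act G (induced_embed G H act (c C)) (r C))"
proof -
  interpret I: group_module G "induced_scale scale" "induced_act G" "induced_module G H act V"
    by (rule group_module_induced)
  define T where "T c = (\<Sum>C\<in>rcosets H. induced_act G (induced_embed G H act (c C)) (r C))" for c
  have fin: "finite (rcosets H)"
    using assms(1) by (simp add: RCOSETS_def)
  have rcarr: "r C \<in> carrier G" if "C \<in> rcosets H" for C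
    using assms(2)[OF that] H.rcosets_carrier[OF G that] by blast
  have sum_apply: "(\<Sum>C\<in>A. k C) x = (\<Sum>C\<in>A. k C x)"
    for A :: "'g set set" and k :: "'g set \<Rightarrow> 'g \<Rightarrow> 'v" and x
    by (induction A rule: infinite_finite_induct) auto
  have T_apply: "T c (r D) = c D" if "c \<in> rcosets H \<rightarrow> V" "D \<in> rcosets H" for c D
  proof -
    have "T c (r D) = (\<Sum>C\<in>rcosets H. if C = D then c C else 0)"
      unfolding T_def sum_apply
      by (rule sum.cong[OF refl], rule induced_translate_apply) (use that assms(2) in auto)
    also have "\<dots> = c D"
      using fin that(2) by simp
    finally show ?thesis .
  qed
  have T_mem: "T c \<in> induced_module G H act V" if "c \<in> rcosets H \<rightarrow> V" for c
    unfolding T_def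
    by (rule I.subspace_sum[OF I.subspace_W], rule I.act_closed)
      (use that rcarr induced_embed_mem in auto)
  have eqI: "k = k'"
    if k: "k \<in> induced_module G H act V" and k': "k' \<in> induced_module G H act V"
      and eq: "\<And>D. D \<in> rcosets H \<Longrightarrow> k (r D) = k' (r D)" for k k'
  proof
    fix x
    show "k x = k' x"
    proof (cases "x \<in> carrier G")
      case True
      define D where "D = H #> x"
      have D: "D \<in> rcosets H"
        unfolding D_def using True G.rcosetsI H.subset by blast
      have "D = H #> r D"
        using assms(2)[OF D] True G.repr_independence[OF _ _ H] unfolding D_def by blast
      moreover have "x \<in> D"
        unfolding D_def using True G.rcos_self[OF _ H] by blast
      ultimately obtain h where h: "h \<in> H" "x = h \<otimes> r D"
        unfolding r_coset_def by blast
      then show ?thesis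
        using k k' eq[OF D] rcarr[OF D] by (simp add: induced_module_def)
    qed (use k k' in \<open>simp add: induced_module_def\<close>)
  qed
  let ?c = "\<lambda>C\<in>rcosets H. f (r C)"
  have c: "?c \<in> rcosets H \<rightarrow> V"
    using f rcarr by (auto simp: induced_module_def)
  show ?thesis
    unfolding T_def[symmetric]
  proof (rule ex1I[of _ ?c])
    show "?c \<in> extensional (rcosets H) \<inter> (rcosets H \<rightarrow> V) \<and> f = T ?c"
      using c eqI[OF f T_mem[OF c]] T_apply[OF c] by auto
  next
    fix c assume "c \<in> extensional (rcosets H) \<inter> (rcosets H \<rightarrow> V) \<and> f = T c"
    then show "c = ?c"
      using T_apply[of c] by (auto simp: extensional_def fun_eq_iff)
  qed
qed

end

section \<open>The permutation group on the right cosets\<close>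

definition coset_permutation_group :: "('g, 'm) monoid_scheme \<Rightarrow> 'g set \<Rightarrow> ('g set \<Rightarrow> 'g set) set" where
  "coset_permutation_group G H =
     (\<lambda>g. \<lambda>C\<in>rcosets\<^bsub>G\<^esub> H. C #>\<^bsub>G\<^esub> g) ` carrier G"

definition has_soluble_transitive_subgroup :: "'a set \<Rightarrow> ('a \<Rightarrow> 'a) set \<Rightarrow> bool" where
  "has_soluble_transitive_subgroup \<Omega> S \<longleftrightarrow>
     (\<exists>T. T \<subseteq> S \<and> subgroup T (BijGroup \<Omega>) \<and> solvable (BijGroup \<Omega>\<lparr>carrier := T\<rparr>) \<and>
          transitive_action (BijGroup \<Omega>\<lparr>carrier := T\<rparr>) \<Omega> (\<lambda>t. t))"

lemma subgroup_coset_permutation_group: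
  assumes "group G" and "subgroup H G"
  shows "subgroup (coset_permutation_group G H) (BijGroup (rcosets\<^bsub>G\<^esub> H))"
proof -
  interpret group G by fact
  let ?\<Omega> = "rcosets\<^bsub>G\<^esub> H" and ?\<phi> = "\<lambda>g. \<lambda>C\<in>rcosets\<^bsub>G\<^esub> H. C #>\<^bsub>G\<^esub> g"
  interpret B: group "BijGroup ?\<Omega>" by (rule group_BijGroup)
  have sub: "C \<subseteq> carrier G" if "C \<in> ?\<Omega>" for C
    using that subgroup.rcosets_carrier[OF assms(2,1)] by blast
  have closed: "C #>\<^bsub>G\<^esub> g \<in> ?\<Omega>" if "C \<in> ?\<Omega>" "g \<in> carrier G" for C g
    using that subgroup.subset[OF assms(2)] unfolding RCOSETS_def
    by (auto simp: coset_mult_assoc)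
  have comp: "C #>\<^bsub>G\<^esub> g #>\<^bsub>G\<^esub> h = C #>\<^bsub>G\<^esub> (g \<otimes>\<^bsub>G\<^esub> h)"
    if "C \<in> ?\<Omega>" "g \<in> carrier G" "h \<in> carrier G" for C g h
    using coset_mult_assoc[OF sub] that by blast
  have bij: "?\<phi> g \<in> Bij ?\<Omega>" if g: "g \<in> carrier G" for g
    unfolding Bij_def
  proof (intro IntI CollectI)
    show "bij_betw (?\<phi> g) ?\<Omega> ?\<Omega>"
      by (rule bij_betw_byWitness[of _ "?\<phi> (inv\<^bsub>G\<^esub> g)"])
        (use g in \<open>auto simp: closed comp coset_mult_one[OF sub]\<close>)
  qed simp
  have mult: "?\<phi> h \<otimes>\<^bsub>BijGroup ?\<Omega>\<^esub> ?\<phi> g = ?\<phi> (g \<otimes>\<^bsub>G\<^esub> h)"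
    if "g \<in> carrier G" "h \<in> carrier G" for g h
    using that bij[OF that(1)] bij[OF that(2)]
    by (auto simp: BijGroup_def compose_def closed comp fun_eq_iff)
  have one: "?\<phi> \<one>\<^bsub>G\<^esub> = \<one>\<^bsub>BijGroup ?\<Omega>\<^esub>"
    by (auto simp: BijGroup_def fun_eq_iff coset_mult_one[OF sub])
  show ?thesis
    unfolding coset_permutation_group_def
  proof (rule B.subgroupI)
    show "?\<phi> ` carrier G \<subseteq> carrier (BijGroup ?\<Omega>)"
      using bij by (auto simp: BijGroup_def)
    show "?\<phi> ` carrier G \<noteq> {}"
      by blast
    show "inv\<^bsub>BijGroup ?\<Omega>\<^esub> a \<in> ?\<phi> ` carrier G" if a: "a \<in> ?\<phi> ` carrier G" for a
    proof -
      obtain g where g: "a = ?\<phi> g" "g \<in> carrier G"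
        using a by (rule imageE)
      have carr: "?\<phi> k \<in> carrier (BijGroup ?\<Omega>)" if "k \<in> carrier G" for k
        using bij[OF that] by (simp add: BijGroup_def)
      have "?\<phi> (inv\<^bsub>G\<^esub> g) \<otimes>\<^bsub>BijGroup ?\<Omega>\<^esub> ?\<phi> g = \<one>\<^bsub>BijGroup ?\<Omega>\<^esub>"
        unfolding mult[OF g(2) inv_closed[OF g(2)]] r_inv[OF g(2)] by (rule one)
      then have "inv\<^bsub>BijGroup ?\<Omega>\<^esub> a = ?\<phi> (inv\<^bsub>G\<^esub> g)"
        unfolding g(1) by (rule B.inv_equality[OF _ carr[OF g(2)] carr[OF inv_closed[OF g(2)]]])
      then show ?thesis
        using imageI[OF inv_closed[OF g(2)], of ?\<phi>] by (simp only:)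
    qed
    show "a \<otimes>\<^bsub>BijGroup ?\<Omega>\<^esub> b \<in> ?\<phi> ` carrier G"
      if a: "a \<in> ?\<phi> ` carrier G" and b: "b \<in> ?\<phi> ` carrier G" for a b
    proof -
      obtain g where g: "a = ?\<phi> g" "g \<in> carrier G"
        using a by (rule imageE)
      obtain h where h: "b = ?\<phi> h" "h \<in> carrier G"
        using b by (rule imageE)
      show ?thesis
        unfolding g(1) h(1) mult[OF h(2) g(2)] by (rule imageI[OF m_closed[OF h(2) g(2)]])
    qed
  qed
qed

section \<open>The numerical functions\<close>

definition p_part :: "nat \<Rightarrow> nat \<Rightarrow> nat" where
  "p_part s p = p ^ multiplicity p s"

definition lpp :: "nat \<Rightarrow> nat" where
  "lpp s = Max {p_part s q | q. prime q}"

text \<open>The maximum in \<open>lpp\<close> is taken over a finite set.\<close>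

lemma finite_p_parts:
  assumes "s > 0"
  shows "finite {p_part s q | q. prime q}"
proof (rule finite_subset)
  show "{p_part s q | q. prime q} \<subseteq> {..s}"
    using assms by (auto simp: p_part_def intro!: dvd_imp_le multiplicity_dvd)
qed simp

definition K_fun :: "nat \<Rightarrow> nat" where
  "K_fun s = (\<Sum>q\<in>prime_factors s. multiplicity q s * (q - 1))"

definition omega_tilde :: "nat \<Rightarrow> real" where
  "omega_tilde s = real s / 2 ^ K_fun s * real (K_fun s choose (K_fun s div 2))"

definition b_const :: real where
  "b_const = sqrt (2 / pi)"

text \<open>For \<open>p_part s p = 1\<close> the first entry of the minimum is \<open>\<infinity>\<close>.\<close>

definition E_fun :: "nat \<Rightarrow> nat \<Rightarrow> real" where
  "E_fun s p =
     (let t = real s / real (lpp (s div p_part s p)) in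
      if p_part s p = 1 then t
      else min (real_of_int
                 \<lfloor>b_const * real s / sqrt ((real p - 1) * log (real p) (real (p_part s p)))\<rfloor>) t)"

definition E_sol :: "nat \<Rightarrow> nat \<Rightarrow> real" where
  "E_sol s p = min (omega_tilde s) (real (p_part s p))"

end

theory Submission
  imports
    Defs
    "HOL-Algebra.Multiplicative_Group"
    "HOL-Algebra.Sylow"
    "HOL-Analysis.Gamma_Function"
    "HOL-Real_Asymp.Real_Asymp"
begin

text \<open>
  All bounds come from restricting \<open>M\<close> to a subgroup \<open>Y\<close> of \<open>G\<close> and splitting the induced module
  along the double cosets \<open>H g Y\<close>. There are two estimates for a submodule supported on one double coset.

  If \<open>Y\<close> is a \<open>p'\<close>-group, then by Maschke's theorem the submodule is a quotient of the functions on
  \<open>H g Y\<close>, which need only \<open>a\<close> generators. Sylow \<open>q\<close>-subgroups with \<open>q \<noteq> p\<close> give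
  \<open>s / lpp (s / s\<^sub>p)\<close>. If the coset action has a soluble transitive subgroup, a Hall \<open>p'\<close>-subgroup of
  it, lifted to a \<open>p'\<close>-subgroup of \<open>G\<close>, has at most \<open>s\<^sub>p\<close> orbits.

  If \<open>Y\<close> acts as a soluble group, an abelian normal series labels the cosets in \<open>H g Y\<close> by a product
  of chains of prime lengths such that raising a coordinate of the leading label is achieved by an
  element of \<open>Y\<close>. As for monomial ideals, the leading coefficients then form an increasing family of
  subspaces of \<open>V\<close>, and each chain in a symmetric chain decomposition accounts for at most \<open>a\<close>
  generators. The number of chains is the middle coefficient of the product, which is at most
  \<open>omega_tilde\<close>. For a Sylow \<open>p\<close>-subgroup, Wallis' product turns this into the bound with \<open>b_const\<close>.
\<close>

section \<open>Symmetric chains in products of chains\<close>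

text \<open>Generators over a subgroup also generate over \<open>G\<close>, so every choice of
  \<open>Y\<close> gives a bound. Since \<open>M\<close> need not split along double cosets, it is
  filtered by restriction and kernel, and generator counts add. For a nontrivial
  \<open>p\<close>-group in characteristic \<open>p\<close> averaging fails, and leading terms take
  its place: division needs a total order of labels, but growth of leading spaces is known only
  along single steps, so the count becomes the width of a product of chains. Its middle rank is
  compared with a binomial coefficient by trading a uniform variable on \<open>q\<close> points for
  \<open>q - 1\<close> fair coins with the same mean, which is the origin of \<open>K_fun\<close>;
  \<open>b_const\<close> is the constant in the asymptotics \<open>b_const / sqrt K\<close> of the
  central binomial probability. In the soluble case only the image of the action is soluble, not its
  preimage in \<open>G\<close>. All arguments there are relative to the kernel of the action, and
  the Hall subgroup must be realised by a true \<open>p'\<close>-subgroup of \<open>G\<close>,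
  because Maschke's theorem depends on the order of the group itself and not on that of its
  image.\<close>

primrec grid :: "nat list \<Rightarrow> nat list set" where
  "grid [] = {[]}"
| "grid (q # qs) = {j # \<alpha> | j \<alpha>. j < q \<and> \<alpha> \<in> grid qs}"

inductive step :: "nat list \<Rightarrow> nat list \<Rightarrow> bool" where
  step_here: "step (j # \<alpha>) (Suc j # \<alpha>)"
| step_there: "step \<alpha> \<beta> \<Longrightarrow> step (j # \<alpha>) (j # \<beta>)"

definition grid_rank :: "nat list \<Rightarrow> nat" where
  "grid_rank qs = (\<Sum>q\<leftarrow>qs. q - 1)"

lemma sum_list_step: "step \<alpha> \<beta> \<Longrightarrow> sum_list \<beta> = Suc (sum_list \<alpha>)"
  by (induction rule: step.induct) auto

lemma finite_grid: "finite (grid qs)"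
proof (induction qs)
  case (Cons q qs)
  have "grid (q # qs) = (\<lambda>(j, \<alpha>). j # \<alpha>) ` ({..<q} \<times> grid qs)"
    by auto
  then show ?case
    using Cons by simp
qed simp

lemma length_grid: "\<alpha> \<in> grid qs \<Longrightarrow> length \<alpha> = length qs"
  by (induction qs arbitrary: \<alpha>) auto

lemma grid_append: "grid (qs @ rs) = {\<alpha> @ \<beta> | \<alpha> \<beta>. \<alpha> \<in> grid qs \<and> \<beta> \<in> grid rs}"
proof (induction qs)
  case (Cons q qs)
  show ?case
    unfolding append_Cons grid.simps Cons.IH
    apply auto
     apply (metis append_Cons)
    by blast
qed auto

text \<open>An exhausted chain ends the recursion, so that no empty hook is produced.\<close>

primrec hooks :: "nat \<Rightarrow> nat \<Rightarrow> nat list list \<Rightarrow> nat list list list" where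
  "hooks lo 0 C = []"
| "hooks lo (Suc n) C = (if C = [] then [] else
     (map ((#) lo) C @ map (\<lambda>j. j # last C) [Suc lo..<lo + Suc n]) # hooks (Suc lo) n (butlast C))"

lemma set_butlast_distinct:
  assumes "distinct C" "C \<noteq> []"
  shows "set (butlast C) = set C - {last C}"
  using assms by (cases C rule: rev_cases) auto

lemma concat_hooks:
  assumes "distinct C"
  shows "distinct (concat (hooks lo n C)) \<and>
    set (concat (hooks lo n C)) = {j # c | j c. lo \<le> j \<and> j < lo + n \<and> c \<in> set C}"
  using assms
proof (induction n arbitrary: lo C)
  case 0
  have "{j # c | j c. lo \<le> j \<and> j < lo + 0 \<and> c \<in> set C} = {}"
  proof (rule equals0I)
    fix x assume "x \<in> {j # c | j c. lo \<le> j \<and> j < lo + 0 \<and> c \<in> set C}"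
    then obtain j where "lo \<le> j" "j < lo + 0"
      by blast
    then show False
      by simp
  qed
  then show ?case
    unfolding hooks.simps concat.simps by (simp only: distinct.simps(1) list.set(1) simp_thms)
next
  case (Suc n)
  show ?case
  proof (cases "C = []")
    case False
    have IH: "distinct (concat (hooks (Suc lo) n (butlast C)))"
      "set (concat (hooks (Suc lo) n (butlast C))) =
        {j # c | j c. Suc lo \<le> j \<and> j < Suc lo + n \<and> c \<in> set C - {last C}}"
      using Suc.IH[of "butlast C" "Suc lo"] distinct_butlast[OF Suc.prems]
        set_butlast_distinct[OF Suc.prems False] by auto
    have l: "last C \<in> set C"
      using False by simp
    have e: "concat (hooks lo (Suc n) C) = map ((#) lo) C @ map (\<lambda>j. j # last C) [Suc lo..<lo + Suc n]
        @ concat (hooks (Suc lo) n (butlast C))"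
      using False by simp
    define A where "A = (#) lo ` set C"
    define B where "B = (\<lambda>j. j # last C) ` {Suc lo..<lo + Suc n}"
    define D where "D = {j # c | j c. Suc lo \<le> j \<and> j < Suc lo + n \<and> c \<in> set C - {last C}}"
    have set_e: "set (concat (hooks lo (Suc n) C)) = A \<union> (B \<union> D)"
      unfolding e by (simp only: set_append set_map set_upt IH(2) A_def B_def D_def)
    have "A \<union> (B \<union> D) = {j # c | j c. lo \<le> j \<and> j < lo + Suc n \<and> c \<in> set C}"
    proof (rule Set.set_eqI, rule iffI)
      fix x assume "x \<in> A \<union> (B \<union> D)"
      then consider c where "x = lo # c" "c \<in> set C"
        | j where "x = j # last C" "Suc lo \<le> j" "j < lo + Suc n"
        | j c where "x = j # c" "Suc lo \<le> j" "j < Suc lo + n" "c \<in> set C"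
        unfolding A_def B_def D_def by force
      then show "x \<in> {j # c | j c. lo \<le> j \<and> j < lo + Suc n \<and> c \<in> set C}"
        by cases (use l in simp_all)
    next
      fix x assume "x \<in> {j # c | j c. lo \<le> j \<and> j < lo + Suc n \<and> c \<in> set C}"
      then obtain j c where x: "x = j # c" "lo \<le> j" "j < lo + Suc n" "c \<in> set C"
        by blast
      consider "j = lo" | "Suc lo \<le> j" "c = last C" | "Suc lo \<le> j" "c \<noteq> last C"
        using x(2) by linarith
      then show "x \<in> A \<union> (B \<union> D)"
      proof cases
        case 1
        then show ?thesis
          using x by (simp add: A_def)
      next
        case 2
        then have "x \<in> B"
          unfolding B_def x(1) using x(3) by (intro image_eqI[of _ _ j]) simp_all
        then show ?thesis
          by simp
      next
        case 3
        then have "x \<in> D"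
          unfolding D_def x(1) using x(3,4) by simp
        then show ?thesis
          by simp
      qed
    qed
    moreover have "distinct (map (\<lambda>j. j # last C) [Suc lo..<lo + Suc n])" "distinct (map ((#) lo) C)"
      using Suc.prems by (simp_all add: distinct_map inj_on_def del: upt_Suc)
    moreover have "A \<inter> B = {}" "A \<inter> D = {}" "B \<inter> D = {}"
      unfolding A_def B_def D_def by auto
    ultimately have "distinct (concat (hooks lo (Suc n) C)) \<and> set (concat (hooks lo (Suc n) C)) =
        {j # c | j c. lo \<le> j \<and> j < lo + Suc n \<and> c \<in> set C}"
      unfolding set_e unfolding e distinct_append set_append set_map set_upt IH(2)
        A_def[symmetric] B_def[symmetric] D_def[symmetric]
      using IH(1) by (simp add: Int_Un_distrib del: upt_Suc)
    then show ?thesis .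
  next
    case True
    then show ?thesis
      by simp
  qed
qed

lemma successively_step_Cons: "successively step C \<Longrightarrow> successively step (map ((#) j) C)"
  by (auto simp: successively_map intro: successively_mono step_there)

lemma step_here_pred: "m < n \<Longrightarrow> step ((n - Suc 0) # c) (n # c)"
  using step_here[of "n - Suc 0" c] by simp

lemma successively_step_upt: "successively step (map (\<lambda>j. j # c) [m..<n])"
proof -
  have "successively (\<lambda>i j. step (i # c) (j # c)) [m..<n]"
  proof (induction n)
    case (Suc n)
    then show ?case
      by (cases "m < n") (auto simp: successively_append_iff upt_Suc
          last_map step_here_pred)
  qed simp
  then show ?thesis
    by (simp add: successively_map)
qed

text \<open>Each inner hook starts one rank higher, since \<open>lo\<close> has grown, and ends one
  rank lower, since the top of the chain has been cut off; so all hooks have the same centre. The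
  \<open>+ 1\<close> avoids the truncated difference \<open>n - 1\<close>.\<close>

lemma hooks_chain:
  assumes "successively step C" "D \<in> set (hooks lo n C)" "C \<noteq> []"
  shows "D \<noteq> [] \<and> successively step D \<and>
    sum_list (hd D) + sum_list (last D) + 1 = lo + lo + n + sum_list (hd C) + sum_list (last C)"
  using assms
proof (induction n arbitrary: lo C)
  case (Suc n)
  let ?D = "map ((#) lo) C @ map (\<lambda>j. j # last C) [Suc lo..<lo + Suc n]"
  show ?case
  proof (cases "D = ?D")
    case True
    have "successively step ?D"
      using Suc.prems successively_step_Cons successively_step_upt[of "last C" "Suc lo" "lo + Suc n"]
      by (cases "n = 0") (auto simp: successively_append_iff hd_map last_map intro: step_here simp del: upt_Suc)
    moreover have "last ?D = (lo + n) # last C"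
      using Suc.prems(3) by (cases n) (auto simp: last_map)
    moreover have "hd ?D = lo # hd C"
      using Suc.prems(3) by (simp add: hd_map)
    ultimately show ?thesis
      using True Suc.prems(3) by auto
  next
    case False
    then have D: "D \<in> set (hooks (Suc lo) n (butlast C))"
      using Suc.prems by (auto split: if_splits)
    show ?thesis
    proof (cases "butlast C = []")
      case True
      then show ?thesis
        using D by (cases n) auto
    next
      case b: False
      have C: "C = butlast C @ [last C]"
        using Suc.prems by simp
      have "successively step (butlast C @ [last C])"
        using Suc.prems by simp
      then have s: "successively step (butlast C)" "step (last (butlast C)) (last C)"
        using b unfolding successively_append_iff by auto
      have "hd (butlast C) = hd C"
        using b C by (metis hd_append2)
      then show ?thesis
        using Suc.IH[OF s(1) D b] sum_list_step[OF s(2)] by simp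
    qed
  qed
qed simp

lemma distinct_concat_hooks:
  assumes "distinct (concat Cs)"
  shows "distinct (concat (concat (map (hooks lo n) Cs))) \<and>
    set (concat (concat (map (hooks lo n) Cs))) =
      {j # c | j c. lo \<le> j \<and> j < lo + n \<and> c \<in> set (concat Cs)}"
  using assms
proof (induction Cs)
  case Nil
  have "{j # c | j c. lo \<le> j \<and> j < lo + n \<and> c \<in> set (concat [])} = {}"
    unfolding concat.simps list.set(1) by blast
  then show ?case
    by (simp only: list.map(1) concat.simps(1) distinct.simps(1) list.set(1) simp_thms)
next
  case (Cons C Cs)
  have 1: "distinct (concat (concat (map (hooks lo n) Cs)))"
    "set (concat (concat (map (hooks lo n) Cs))) =
      {j # c | j c. lo \<le> j \<and> j < lo + n \<and> c \<in> set (concat Cs)}"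
    using Cons by auto
  have 2: "distinct (concat (hooks lo n C))"
    "set (concat (hooks lo n C)) = {j # c | j c. lo \<le> j \<and> j < lo + n \<and> c \<in> set C}"
    using concat_hooks[of C lo n] Cons.prems by auto
  have e: "concat (concat (map (hooks lo n) (C # Cs))) =
      concat (hooks lo n C) @ concat (concat (map (hooks lo n) Cs))"
    by simp
  have "set C \<inter> set (concat Cs) = {}"
    using Cons.prems by auto
  then have "{j # c | j c. lo \<le> j \<and> j < lo + n \<and> c \<in> set C} \<inter>
      {j # c | j c. lo \<le> j \<and> j < lo + n \<and> c \<in> set (concat Cs)} = {}"
    by blast
  moreover have "{j # c | j c. lo \<le> j \<and> j < lo + n \<and> c \<in> set C} \<union>
      {j # c | j c. lo \<le> j \<and> j < lo + n \<and> c \<in> set (concat Cs)} =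
      {j # c | j c. lo \<le> j \<and> j < lo + n \<and> c \<in> set (concat (C # Cs))}"
    unfolding concat.simps set_append by blast
  ultimately show ?case
    unfolding e distinct_append set_append 1 2 using 1(1) 2(1) by simp
qed

text \<open>The induction step cuts the product of a chain with \<open>{..<q}\<close> into hooks, as de Bruijn,
  Tengbergen and Kruyswijk do.\<close>

lemma symmetric_chain_decomposition:
  assumes "\<forall>q\<in>set qs. q > 0"
  obtains Cs where "distinct (concat Cs)" "set (concat Cs) = grid qs"
    "\<And>C. C \<in> set Cs \<Longrightarrow> C \<noteq> [] \<and> successively step C \<and>
       sum_list (hd C) + sum_list (last C) = grid_rank qs"
proof -
  have "\<exists>Cs. distinct (concat Cs) \<and> set (concat Cs) = grid qs \<and>
    (\<forall>C\<in>set Cs. C \<noteq> [] \<and> successively step C \<and>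
       sum_list (hd C) + sum_list (last C) = grid_rank qs)"
    using assms
  proof (induction qs)
    case Nil
    show ?case
      \<comment> \<open>A single chain, whose only element is the empty label.\<close>
      by (rule exI[of _ "[[[]]]"]) (auto simp: grid_rank_def)
  next
    case (Cons q qs)
    then obtain Cs where Cs: "distinct (concat Cs)" "set (concat Cs) = grid qs"
      "\<And>C. C \<in> set Cs \<Longrightarrow> C \<noteq> [] \<and> successively step C \<and>
         sum_list (hd C) + sum_list (last C) = grid_rank qs"
      by auto
    have "distinct (concat (concat (map (hooks 0 q) Cs)))"
      "set (concat (concat (map (hooks 0 q) Cs))) = grid (q # qs)"
      using distinct_concat_hooks[OF Cs(1), of 0 q] by (auto simp flip: Cs(2))
    moreover have "D \<noteq> [] \<and> successively step D \<and>
        sum_list (hd D) + sum_list (last D) = grid_rank (q # qs)"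
      if D: "D \<in> set (concat (map (hooks 0 q) Cs))" for D
    proof -
      obtain C where C: "C \<in> set Cs" "D \<in> set (hooks 0 q C)"
        using D by auto
      have "q > 0"
        using Cons.prems by simp
      then show ?thesis
        using hooks_chain[of C D 0 q] Cs(3)[OF C(1)] C(2) by (auto simp: grid_rank_def)
    qed
    ultimately show ?case
      by blast
  qed
  then show ?thesis
    using that by blast
qed

text \<open>Ranks rise by exactly one along a chain, so none between the two ends is
  skipped.\<close>

lemma chain_meets_rank:
  assumes "successively step C" "C \<noteq> []" "sum_list (hd C) \<le> r" "r \<le> sum_list (last C)"
  shows "\<exists>c\<in>set C. sum_list c = r"
  using assms
proof (induction C)
  case (Cons c C)
  show ?case
  proof (cases "sum_list c = r")
    case False
    then have C: "C \<noteq> []"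
      using Cons.prems by (cases C) auto
    then have s: "step c (hd C)" "successively step C"
      using Cons.prems by (cases C; auto)+
    have "sum_list (hd C) \<le> r"
      using sum_list_step[OF s(1)] False Cons.prems by simp
    then show ?thesis
      using Cons.IH[OF s(2) C] Cons.prems C by auto
  qed auto
qed simp

text \<open>The ranks of the two ends add up to \<open>grid_rank qs\<close>, so the middle rank lies
  between them and every chain contains a label of that rank; the chains are disjoint.\<close>

lemma length_le_middle:
  assumes "distinct (concat Cs)" "set (concat Cs) = grid qs"
    "\<And>C. C \<in> set Cs \<Longrightarrow> C \<noteq> [] \<and> successively step C \<and>
       sum_list (hd C) + sum_list (last C) = grid_rank qs"
  shows "length Cs \<le> card {\<alpha> \<in> grid qs. sum_list \<alpha> = grid_rank qs div 2}"
proof -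
  let ?P = "\<lambda>\<alpha>. sum_list \<alpha> = grid_rank qs div 2"
  have le: "sum_list (hd C) \<le> sum_list (last C)" if "successively step C" "C \<noteq> []" for C
    using that
  proof (induction C)
    case (Cons c C)
    then show ?case
      by (cases C) (auto dest!: sum_list_step)
  qed simp
  have 1: "1 \<le> length (filter ?P C)" if C: "C \<in> set Cs" for C
  proof -
    have "\<exists>c\<in>set C. ?P c"
      using assms(3)[OF C] le[of C] by (intro chain_meets_rank) auto
    then have "filter ?P C \<noteq> []"
      by (simp add: filter_empty_conv)
    then show ?thesis
      by (cases "filter ?P C") auto
  qed
  have "length Cs = (\<Sum>C\<leftarrow>Cs. 1)"
    by (simp add: sum_list_triv)
  also have "\<dots> \<le> (\<Sum>C\<leftarrow>Cs. length (filter ?P C))"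
    by (rule sum_list_mono) (rule 1)
  also have "\<dots> = length (filter ?P (concat Cs))"
    by (simp add: filter_concat length_concat comp_def)
  also have "\<dots> = card (set (filter ?P (concat Cs)))"
    using assms(1) by (simp add: distinct_card del: set_filter)
  also have "set (filter ?P (concat Cs)) = {\<alpha> \<in> grid qs. ?P \<alpha>}"
    using assms(2) by auto
  finally show ?thesis .
qed

section \<open>The middle layer\<close>

text \<open>Integer ranks allow shifted arguments to become negative instead of being
  truncated.\<close>

definition layer :: "nat list \<Rightarrow> int \<Rightarrow> real" where
  "layer qs n = real (card {\<alpha> \<in> grid qs. int (sum_list \<alpha>) = n})"

definition smear :: "nat \<Rightarrow> (int \<Rightarrow> real) \<Rightarrow> int \<Rightarrow> real" where
  "smear q w n = (\<Sum>j<q. w (n - int j))"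

lemma layer_Cons: "layer (q # qs) = smear q (layer qs)"
proof
  fix n
  have "{\<alpha> \<in> grid (q # qs). int (sum_list \<alpha>) = n} =
      (\<Union>j<q. (#) j ` {\<alpha> \<in> grid qs. int (sum_list \<alpha>) = n - int j})"
    by (auto simp: algebra_simps image_iff)
  moreover have "card (\<Union>j<q. (#) j ` {\<alpha> \<in> grid qs. int (sum_list \<alpha>) = n - int j}) =
      (\<Sum>j<q. card ((#) j ` {\<alpha> \<in> grid qs. int (sum_list \<alpha>) = n - int j}))"
    by (rule card_UN_disjoint) (auto simp: finite_grid)
  moreover have "card ((#) j ` {\<alpha> \<in> grid qs. int (sum_list \<alpha>) = n - int j}) =
      card {\<alpha> \<in> grid qs. int (sum_list \<alpha>) = n - int j}" for j
    by (rule card_image) auto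
  ultimately show "layer (q # qs) n = smear q (layer qs) n"
    by (simp add: layer_def smear_def)
qed

text \<open>Symmetry about \<open>K / 2\<close> and unimodality in one condition: for points at
  equal distance from the centre it applies in both directions and gives equality.\<close>

definition sym_unimodal :: "int \<Rightarrow> (int \<Rightarrow> real) \<Rightarrow> bool" where
  "sym_unimodal K w \<longleftrightarrow> (\<forall>n m. \<bar>2 * m - K\<bar> \<le> \<bar>2 * n - K\<bar> \<longrightarrow> w n \<le> w m)"

lemma smear_diff: "smear q w n - smear q w (n - 1) = w n - w (n - int q)"
  by (induction q) (auto simp: smear_def algebra_simps)

text \<open>By \<open>smear_diff\<close> the increment at \<open>n\<close> compares \<open>w\<close>
  at \<open>n\<close> with \<open>w\<close> at \<open>n - q\<close>; up to the new centre the first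
  argument is at least as close to the old centre as the second. The other half follows by
  reflection.\<close>

lemma sym_unimodal_smear:
  assumes w: "sym_unimodal K w" and q: "q > 0"
  shows "sym_unimodal (K + int q - 1) (smear q w)"
proof -
  define L where "L = K + int q - 1"
  have wD: "w n \<le> w m" if "\<bar>2 * m - K\<bar> \<le> \<bar>2 * n - K\<bar>" for n m
    using w that unfolding sym_unimodal_def by blast
  have refl: "smear q w (L - n) = smear q w n" for n
  proof -
    have "smear q w (L - n) = (\<Sum>j<q. w (L - n - int (q - Suc j)))"
      unfolding smear_def by (rule sum.nat_diff_reindex[symmetric])
    also have "\<dots> = smear q w n"
      unfolding smear_def
    proof (rule sum.cong[OF refl])
      fix j assume "j \<in> {..<q}"
      then have "L - n - int (q - Suc j) = K - (n - int j)"
        by (auto simp: L_def of_nat_diff)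
      then show "w (L - n - int (q - Suc j)) = w (n - int j)"
        by (auto intro!: antisym wD)
    qed
    finally show ?thesis .
  qed
  have up: "smear q w (n - 1) \<le> smear q w n" if "2 * n \<le> L + 1" for n
  proof -
    have "w (n - int q) \<le> w n"
      by (rule wD) (use that in \<open>auto simp: L_def\<close>)
    then show ?thesis
      using smear_diff[of q w n] by simp
  qed
  have mono: "smear q w n \<le> smear q w (n + int k)" if "2 * (n + int k) \<le> L + 1" for n k
    using that
  proof (induction k)
    case (Suc k)
    then show ?case
      using up[of "n + int (Suc k)"] by auto
  qed simp
  have mono': "smear q w n \<le> smear q w m" if "n \<le> m" "2 * m \<le> L + 1" for n m
    using mono[of n "nat (m - n)"] that by simp
  have "smear q w n \<le> smear q w m" if le: "\<bar>2 * m - L\<bar> \<le> \<bar>2 * n - L\<bar>" for n m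
  proof -
    \<comment> \<open>Both points are reflected into the left half, where the function
      increases.\<close>
    define n' where "n' = (if 2 * n \<le> L then n else L - n)"
    define m' where "m' = (if 2 * m \<le> L then m else L - m)"
    have "smear q w n = smear q w n'" "smear q w m = smear q w m'"
      by (auto simp: n'_def m'_def refl)
    moreover have "n' \<le> m'" "2 * m' \<le> L + 1"
      using le by (auto simp: n'_def m'_def split: if_splits)
    ultimately show ?thesis
      using mono' by simp
  qed
  then show ?thesis
    unfolding sym_unimodal_def L_def by blast
qed

section \<open>Comparison of the middle layer with a binomial coefficient\<close>

lemma smear_commute: "smear q (smear r w) = smear r (smear q w)"
proof
  fix n
  have "smear q (smear r w) n = (\<Sum>i<q. \<Sum>j<r. w (n - int i - int j))"
    by (simp add: smear_def)
  also have "\<dots> = (\<Sum>j<r. \<Sum>i<q. w (n - int j - int i))"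
    by (subst sum.swap) (simp add: algebra_simps)
  finally show "smear q (smear r w) n = smear r (smear q w) n"
    by (simp add: smear_def)
qed

lemma smear_funpow_commute: "(smear r ^^ m) (smear q w) = smear q ((smear r ^^ m) w)"
  by (induction m) (auto simp: smear_commute[of r q])

lemma sym_unimodal_funpow:
  assumes "sym_unimodal K w"
  shows "sym_unimodal (K + int m) ((smear 2 ^^ m) w)"
proof (induction m)
  case (Suc m)
  then show ?case
    using sym_unimodal_smear[of "K + int m" "(smear 2 ^^ m) w" 2] by (simp add: algebra_simps)
qed (use assms in simp)

lemma funpow_smear_2: "(smear 2 ^^ m) w n = (\<Sum>j\<le>m. real (m choose j) * w (n - int j))"
proof (induction m arbitrary: n)
  case (Suc m)
  have "(smear 2 ^^ Suc m) w n = (smear 2 ^^ m) w n + (smear 2 ^^ m) w (n - 1)"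
    by (simp add: smear_def numeral_2_eq_2)
  also have "\<dots> = (\<Sum>j\<le>m. real (m choose j) * w (n - int j)) +
      (\<Sum>j\<le>m. real (m choose j) * w (n - int (Suc j)))"
    by (simp add: Suc.IH algebra_simps)
  also have "(\<Sum>j\<le>m. real (m choose j) * w (n - int j)) =
      (\<Sum>j\<le>Suc m. real (m choose j) * w (n - int j))"
    by simp
  also have "\<dots> = w n + (\<Sum>j\<le>m. real (m choose Suc j) * w (n - int (Suc j)))"
    by (subst sum.atMost_Suc_shift) simp
  also have "w n + (\<Sum>j\<le>m. real (m choose Suc j) * w (n - int (Suc j))) +
      (\<Sum>j\<le>m. real (m choose j) * w (n - int (Suc j))) =
      w n + (\<Sum>j\<le>m. real (Suc m choose Suc j) * w (n - int (Suc j)))"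
    by (simp add: sum.distrib[symmetric] algebra_simps)
  also have "\<dots> = (\<Sum>j\<le>Suc m. real (Suc m choose j) * w (n - int j))"
    unfolding sum.atMost_Suc_shift[of "\<lambda>j. real (Suc m choose j) * w (n - int j)"] by simp
  finally show ?case .
qed simp

lemma binomial_le_of_dist:
  assumes "i \<le> m" "j \<le> m" "\<bar>2 * int j - int m\<bar> \<le> \<bar>2 * int i - int m\<bar>"
  shows "m choose i \<le> m choose j"
proof -
  define f where "f k = (if 2 * k \<le> m then k else m - k)" for k
  have "m choose i = m choose f i" "m choose j = m choose f j"
    using assms binomial_symmetric[of i m] binomial_symmetric[of j m] by (auto simp: f_def)
  moreover have "f i \<le> f j" "2 * f j \<le> m"
    using assms by (auto simp: f_def split: if_splits)
  ultimately show ?thesis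
    using binomial_mono[of "f i" "f j" m] by simp
qed

text \<open>The sum of the nonnegative products over all pairs expands to twice the difference of
  the two sides.\<close>

lemma sum_Chebyshev_similarly_ordered:
  fixes f g :: "'a \<Rightarrow> real"
  assumes "\<And>i j. i \<in> A \<Longrightarrow> j \<in> A \<Longrightarrow> 0 \<le> (f i - f j) * (g i - g j)"
  shows "sum f A * sum g A \<le> real (card A) * (\<Sum>i\<in>A. f i * g i)"
proof -
  have "0 \<le> (\<Sum>i\<in>A. \<Sum>j\<in>A. (f i - f j) * (g i - g j))"
    by (intro sum_nonneg assms)
  also have "\<dots> = 2 * (real (card A) * (\<Sum>i\<in>A. f i * g i) - sum f A * sum g A)"
  proof -
    have 1: "(\<Sum>j\<in>A. (f i - f j) * (g i - g j)) = real (card A) * (f i * g i) - f i * sum g A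
        - g i * sum f A + (\<Sum>j\<in>A. f j * g j)" for i
      by (simp add: left_diff_distrib right_diff_distrib sum_subtractf sum.distrib
          sum_distrib_left mult.commute)
    show ?thesis
      unfolding 1 sum.distrib sum_subtractf sum_distrib_left[symmetric] sum_distrib_right[symmetric]
      by simp
  qed
  finally show ?thesis
    by simp
qed

text \<open>The uniform distribution on \<open>q\<close> points is less concentrated than the binomial one; the
  proof is Chebyshev's sum inequality.\<close>

lemma smear_le_binomial:
  assumes w: "sym_unimodal K w" and q: "q > 0"
  defines "n \<equiv> (K + int q - 1) div 2"
  shows "smear q w n \<le> real q / 2 ^ (q - 1) * (smear 2 ^^ (q - 1)) w n"
proof -
  define m where "m = q - 1"
  have qm: "q = Suc m"
    using q by (simp add: m_def)
  define c where "c j = real (m choose j)" for j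
  define g where "g j = w (n - int j)" for j
  have cle: "c i \<le> c j" if "i \<le> m" "j \<le> m" "\<bar>2 * int j - int m\<bar> \<le> \<bar>2 * int i - int m\<bar>" for i j
    using binomial_le_of_dist[OF that] by (simp add: c_def)
  have gle: "g i \<le> g j" if "\<bar>2 * (n - int j) - K\<bar> \<le> \<bar>2 * (n - int i) - K\<bar>" for i j
    using w that unfolding sym_unimodal_def g_def by blast
  have n: "2 * n = K + int m \<or> 2 * n = K + int m - 1"
    unfolding n_def qm by auto
  have pos: "0 \<le> (c i - c j) * (g i - g j)" if ij: "i \<le> m" "j \<le> m" for i j
  proof -
    \<comment> \<open>Both distances have the parity of \<open>m\<close>, so a strict inequality
      leaves a gap of 2. This absorbs the shift by one that rounding may put into
      \<open>2 * n\<close>.\<close>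
    have gap: "\<bar>2 * int b - int m\<bar> + 2 \<le> \<bar>2 * int a - int m\<bar>"
      if "\<bar>2 * int b - int m\<bar> < \<bar>2 * int a - int m\<bar>" for a b
      using that by presburger
    consider "\<bar>2 * int j - int m\<bar> < \<bar>2 * int i - int m\<bar>" | "\<bar>2 * int i - int m\<bar> < \<bar>2 * int j - int m\<bar>"
      | "\<bar>2 * int i - int m\<bar> = \<bar>2 * int j - int m\<bar>"
      by linarith
    then show ?thesis
    proof cases
      case 1
      then have "\<bar>2 * (n - int j) - K\<bar> \<le> \<bar>2 * (n - int i) - K\<bar>"
        using n gap[of j i] by (auto simp: abs_if split: if_splits)
      then show ?thesis
        using gle cle[OF ij] 1 by (intro mult_nonpos_nonpos) auto
    next
      case 2
      then have "\<bar>2 * (n - int i) - K\<bar> \<le> \<bar>2 * (n - int j) - K\<bar>"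
        using n gap[of i j] by (auto simp: abs_if split: if_splits)
      then show ?thesis
        using gle cle[OF ij(2,1)] 2 by (intro mult_nonneg_nonneg) auto
    next
      \<comment> \<open>Rounding may separate the two values of \<open>g\<close> here, but the
        binomial coefficients agree.\<close>
      case 3
      then have "c i = c j"
        using cle[OF ij] cle[OF ij(2,1)] by simp
      then show ?thesis
        by simp
    qed
  qed
  have "sum c {..m} * sum g {..m} \<le> real (card {..m}) * (\<Sum>i\<le>m. c i * g i)"
    by (rule sum_Chebyshev_similarly_ordered) (use pos in auto)
  moreover have "sum c {..m} = 2 ^ m"
    using choose_row_sum[of m] by (simp add: c_def flip: of_nat_sum)
  moreover have "sum g {..m} = smear q w n"
    by (simp add: smear_def g_def qm lessThan_Suc_atMost)
  moreover have "(\<Sum>i\<le>m. c i * g i) = (smear 2 ^^ m) w n"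
    by (simp add: funpow_smear_2 c_def g_def)
  ultimately have "2 ^ m * smear q w n \<le> real q * (smear 2 ^^ m) w n"
    by (simp add: qm)
  then show ?thesis
    by (simp add: m_def field_simps)
qed

lemma grid_rank_Cons: "grid_rank (q # qs) = q - 1 + grid_rank qs"
  by (simp add: grid_rank_def)

lemma sym_unimodal_layer:
  assumes "\<forall>q\<in>set qs. q > 0"
  shows "sym_unimodal (int (grid_rank qs)) (layer qs)"
  using assms
proof (induction qs)
  case Nil
  then show ?case
  proof -
    have "layer [] = (\<lambda>n. if n = 0 then 1 else 0)"
    proof
      fix n :: int
      have "{\<alpha> \<in> grid []. int (sum_list \<alpha>) = n} = (if n = 0 then {[]} else {})"
        by auto
      then show "layer [] n = (if n = 0 then 1 else 0)"
        by (simp add: layer_def)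
    qed
    then show ?thesis
      by (auto simp: sym_unimodal_def grid_rank_def)
  qed
next
  case (Cons q qs)
  then show ?case
    using sym_unimodal_smear[of "int (grid_rank qs)" "layer qs" q]
    by (simp add: layer_Cons grid_rank_Cons algebra_simps)
qed

text \<open>Each factor \<open>q\<close> is traded for \<open>q - 1\<close> factors 2, which
  \<open>smear_le_binomial\<close> allows at the centre; \<open>m\<close> counts the factors 2
  already collected. When no \<open>q\<close> is left, the function is a row of binomial
  coefficients evaluated at its middle.\<close>

lemma smear_layer_le:
  assumes "\<forall>q\<in>set qs. q > 0"
  shows "(smear 2 ^^ m) (layer qs) (int ((grid_rank qs + m) div 2)) \<le>
    real (prod_list qs) / 2 ^ grid_rank qs * real ((grid_rank qs + m) choose ((grid_rank qs + m) div 2))"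
  using assms
proof (induction qs arbitrary: m)
  case Nil
  have "(smear 2 ^^ m) (layer []) (int (m div 2)) = 
      (\<Sum>j\<le>m. if j = m div 2 then real (m choose j) else 0)"
    unfolding funpow_smear_2
  proof (rule sum.cong[OF refl])
    fix j
    have "{\<alpha> \<in> grid []. int (sum_list \<alpha>) = int (m div 2) - int j} =
        (if j = m div 2 then {[]} else {})"
      by auto
    then show "real (m choose j) * layer [] (int (m div 2) - int j) =
        (if j = m div 2 then real (m choose j) else 0)"
      by (simp add: layer_def)
  qed
  then show ?case
    by (simp add: grid_rank_def)
next
  case (Cons q qs)
  have q: "q > 0"
    using Cons.prems by simp
  define K where "K = grid_rank qs"
  let ?w = "(smear 2 ^^ m) (layer qs)"
  have w: "sym_unimodal (int (K + m)) ?w"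
    using sym_unimodal_funpow[OF sym_unimodal_layer, of qs m] Cons.prems by (simp add: K_def)
  define n where "n = (grid_rank (q # qs) + m) div 2"
  have n: "int n = (int (K + m) + int q - 1) div 2" "n = (K + (q - 1 + m)) div 2"
    using q by (simp_all add: n_def grid_rank_Cons K_def zdiv_int of_nat_diff algebra_simps)
  have "(smear 2 ^^ m) (layer (q # qs)) (int n) = smear q ?w (int n)"
    by (simp add: layer_Cons smear_funpow_commute)
  also have "\<dots> \<le> real q / 2 ^ (q - 1) * (smear 2 ^^ (q - 1)) ?w (int n)"
    unfolding n(1) by (rule smear_le_binomial[OF w q])
  also have "(smear 2 ^^ (q - 1)) ?w = (smear 2 ^^ (q - 1 + m)) (layer qs)"
    by (simp add: funpow_add)
  also have "real q / 2 ^ (q - 1) * (smear 2 ^^ (q - 1 + m)) (layer qs) (int n) \<le>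
      real q / 2 ^ (q - 1) * (real (prod_list qs) / 2 ^ K *
        real ((K + (q - 1 + m)) choose n))"
    unfolding n(2) K_def using Cons.prems by (intro mult_left_mono Cons.IH) auto
  also have "\<dots> = real (prod_list (q # qs)) / 2 ^ grid_rank (q # qs) *
      real ((grid_rank (q # qs) + m) choose n)"
    by (simp add: grid_rank_Cons K_def power_add algebra_simps)
  finally show ?case
    by (simp add: n_def)
qed

lemma grid_rank_eq_K_fun:
  assumes "\<forall>q\<in>set qs. prime q"
  shows "grid_rank qs = K_fun (prod_list qs)"
proof -
  have pf: "prime_factorization (prod_list qs) = mset qs"
    using prime_factorization_prod_mset_primes[of "mset qs"] assms
    by (simp add: prod_mset_prod_list)
  have "grid_rank qs = (\<Sum>q\<in>set qs. count (mset qs) q * (q - 1))"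
    by (simp add: grid_rank_def sum_list_map_eq_sum_count count_mset)
  also have "\<dots> = K_fun (prod_list qs)"
    unfolding K_fun_def pf set_mset_mset
    by (rule sum.cong) (use assms in \<open>auto simp: pf[symmetric] count_prime_factorization\<close>)
  finally show ?thesis .
qed

lemma middle_layer_le_omega_tilde:
  assumes "\<forall>q\<in>set qs. prime q"
  shows "real (card {\<alpha> \<in> grid qs. sum_list \<alpha> = grid_rank qs div 2}) \<le> omega_tilde (prod_list qs)"
proof -
  have "\<forall>q\<in>set qs. q > 0"
    using assms by (simp add: prime_gt_0_nat)
  from smear_layer_le[OF this, of 0] show ?thesis
    by (simp add: omega_tilde_def layer_def grid_rank_eq_K_fun[OF assms, symmetric])
qed

section \<open>Central binomial coefficients\<close>

definition wallis_prod :: "nat \<Rightarrow> real" where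
  "wallis_prod n = (\<Prod>k=1..n. (4 * real k ^ 2) / (4 * real k ^ 2 - 1))"

lemma wallis_prod_Suc:
  "wallis_prod (Suc n) = wallis_prod n * (4 * (real n + 1)\<^sup>2 / ((2 * real n + 1) * (2 * real n + 3)))"
proof -
  have "wallis_prod (Suc n) = wallis_prod n * (4 * real (Suc n) ^ 2 / (4 * real (Suc n) ^ 2 - 1))"
    unfolding wallis_prod_def by (subst prod.nat_ivl_Suc', simp, rule mult.commute)
  moreover have "4 * real (Suc n) ^ 2 - 1 = (2 * real n + 1) * (2 * real n + 3)"
    by (simp add: power2_eq_square algebra_simps)
  ultimately show ?thesis
    by (simp add: add.commute)
qed

lemma wallis_prod_pos: "wallis_prod n > 0"
proof (induction n)
  case (Suc n)
  then show ?case
    unfolding wallis_prod_Suc by (intro mult_pos_pos divide_pos_pos zero_less_power) auto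
qed (simp add: wallis_prod_def)

text \<open>Both sides gain the factor 16 when \<open>n\<close> grows by one. The identity turns
  lower bounds for Wallis' product into upper bounds for central binomial coefficients.\<close>

lemma wallis_prod_central_binomial:
  "wallis_prod n * (2 * real n + 1) * real ((2 * n) choose n) ^ 2 = 16 ^ n"
proof (induction n)
  case (Suc n)
  have c: "real ((2 * Suc n) choose Suc n) * (real n + 1) = 2 * (2 * real n + 1) * real ((2 * n) choose n)"
  proof -
    have "Suc n * ((2 * Suc n) choose Suc n) = 2 * (2 * n + 1) * ((2 * n) choose n)"
    proof -
      let ?A = "Suc (2 * n) choose Suc n"
      have "Suc (2 * n) * ((2 * n) choose n) = ?A * Suc n"
        by (rule Suc_times_binomial_eq)
      moreover have "(2 * Suc n) choose Suc n = 2 * ?A"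
        using binomial_symmetric[of n "Suc (2 * n)"] by simp
      ultimately show ?thesis
        by (metis mult.assoc mult.commute Suc_eq_plus1)
    qed
    then have "real (Suc n * ((2 * Suc n) choose Suc n)) = real (2 * (2 * n + 1) * ((2 * n) choose n))"
      by presburger
    then show ?thesis
      by (simp add: algebra_simps)
  qed
  have alg: "P * (4 * c ^ 2 / (x * y)) * y * X ^ 2 = 16 * (P * x * B ^ 2)"
    if "x \<noteq> 0" "y \<noteq> 0" "X * c = 2 * x * B" for P c x y X B :: real
  proof -
    have "P * (4 * c ^ 2 / (x * y)) * y * X ^ 2 = P * 4 / x * (X * c) ^ 2"
      using that(1,2) by (simp add: power_mult_distrib)
    also have "\<dots> = 16 * (P * x * B ^ 2)"
      unfolding that(3) using that(1) by (simp add: field_simps power2_eq_square)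
    finally show ?thesis .
  qed
  have "2 * real n + 1 \<noteq> 0" "2 * real n + 3 \<noteq> 0" "2 * real (Suc n) + 1 = 2 * real n + 3"
    by auto
  then have "wallis_prod (Suc n) * (2 * real (Suc n) + 1) * real ((2 * Suc n) choose Suc n) ^ 2 =
      16 * (wallis_prod n * (2 * real n + 1) * real ((2 * n) choose n) ^ 2)"
    unfolding wallis_prod_Suc using alg[OF _ _ c] by presburger
  then show ?case
    using Suc.IH by simp
qed (simp add: wallis_prod_def)

text \<open>The partial products themselves increase to \<open>pi / 2\<close> and bound it from the
  wrong side; after multiplication by \<open>(2 n + 1) / (2 n)\<close> they decrease to the same
  limit.\<close>

lemma pi_half_le_wallis_prod:
  assumes "n > 0"
  shows "pi / 2 \<le> wallis_prod n * ((2 * real n + 1) / (2 * real n))"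
proof -
  \<comment> \<open>Shifted by one, so that the denominator never vanishes.\<close>
  define u where "u n = wallis_prod (Suc n) * ((2 * real n + 3) / (2 * real n + 2))" for n
  have dec: "decseq u"
  proof (rule decseq_SucI)
    fix n
    have "u (Suc n) = wallis_prod (Suc n) * ((2 * real n + 4) / (2 * real n + 3))"
    proof -
      have "P * (4 * (x + 2)\<^sup>2 / ((2 * x + 3) * (2 * x + 5))) * ((2 * x + 5) / (2 * x + 4)) =
          P * ((2 * x + 4) / (2 * x + 3))" if "x \<ge> 0" for x P :: real
      proof -
        have "4 * (x + 2)\<^sup>2 = (2 * x + 4) * (2 * x + 4)" "2 * x + 4 \<noteq> 0" "2 * x + 5 \<noteq> 0" "2 * x + 3 \<noteq> 0"
          using that by (auto simp: power2_eq_square algebra_simps)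
        then show ?thesis
          by simp
      qed
      from this[of "real n" "wallis_prod (Suc n)"] show ?thesis
        unfolding u_def wallis_prod_Suc[of "Suc n"] by (simp add: algebra_simps)
    qed
    also have "\<dots> \<le> u n"
      unfolding u_def
    proof (rule mult_left_mono)
      show "(2 * real n + 4) / (2 * real n + 3) \<le> (2 * real n + 3) / (2 * real n + 2)"
        by (simp add: divide_simps) (simp add: algebra_simps)
    qed (use wallis_prod_pos[of "Suc n"] in simp)
    finally show "u (Suc n) \<le> u n" .
  qed
  have "(\<lambda>n. (2 * real n + 3) / (2 * real n + 2)) \<longlonglongrightarrow> 1"
    by real_asymp
  from tendsto_mult[OF LIMSEQ_Suc[OF wallis] this] have "u \<longlonglongrightarrow> pi / 2"
    unfolding u_def wallis_prod_def by simp
  from decseq_ge[OF dec this, of "n - 1"] assms show ?thesis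
    by (cases n) (simp_all add: u_def algebra_simps)
qed

text \<open>For odd \<open>K\<close> the normalised middle coefficient equals that of
  \<open>K + 1\<close>, so Wallis' product is needed only for even arguments.\<close>

lemma central_binomial_le:
  assumes "K > 0"
  shows "real (K choose (K div 2)) / 2 ^ K \<le> b_const / sqrt (real K)"
proof -
  have even: "real ((2 * n) choose n) / 4 ^ n \<le> sqrt (1 / (pi * real n))" if n: "n > 0" for n
  proof (rule real_le_rsqrt)
    let ?c = "real ((2 * n) choose n)"
    have c: "?c > 0"
      by simp
    have "pi / 2 * (2 * real n) \<le> wallis_prod n * (2 * real n + 1)"
      using pi_half_le_wallis_prod[OF n] n by (simp add: field_simps)
    then have "16 ^ n \<ge> pi / 2 * (2 * real n) * ?c ^ 2"
      unfolding wallis_prod_central_binomial[of n, symmetric] by (rule mult_right_mono) simp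
    moreover have "(4 ^ n)\<^sup>2 = (16 ^ n :: real)"
      by (simp add: power2_eq_square flip: power_mult_distrib)
    ultimately show "(?c / 4 ^ n)\<^sup>2 \<le> 1 / (pi * real n)"
      using n by (simp add: field_simps power_divide)
  qed
  have b: "b_const / sqrt x = sqrt (1 / (pi * (x / 2)))" if "x > 0" for x
    using that by (simp add: b_const_def real_sqrt_divide[symmetric] field_simps)
  show ?thesis
  proof (cases "even K")
    case True
    then obtain n where K: "K = 2 * n"
      by blast
    then show ?thesis
      using even[of n] assms by (simp add: b power_mult)
  next
    case False
    then obtain n where K: "K = Suc (2 * n)"
      by (metis oddE Suc_eq_plus1)
    have "real (K choose (K div 2)) / 2 ^ K = real ((2 * Suc n) choose Suc n) / 4 ^ Suc n"
    proof -
      have "(2 * Suc n) choose Suc n = 2 * (Suc (2 * n) choose n)"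
        using binomial_symmetric[of n "Suc (2 * n)"] by simp
      then show ?thesis
        by (simp add: K power_mult)
    qed
    also have "\<dots> \<le> sqrt (1 / (pi * real (Suc n)))"
      by (rule even) simp
    also have "\<dots> \<le> sqrt (1 / (pi * (real K / 2)))"
      by (intro real_sqrt_le_mono divide_left_mono mult_left_mono mult_pos_pos) (auto simp: K)
    also have "\<dots> = b_const / sqrt (real K)"
      using b[of "real K"] assms by simp
    finally show ?thesis .
  qed
qed

text \<open>An orbit of a Sylow \<open>p\<close>-subgroup has length \<open>p ^ k\<close> with
  \<open>k\<close> at least the exponent \<open>r\<close> of \<open>p\<close> in the index. Stated
  with \<open>r\<close>, the bound has the same ratio to the length for all orbits.\<close>

lemma omega_tilde_prime_power_le:
  assumes p: "prime p" and r: "0 < r" "r \<le> k"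
  shows "omega_tilde (p ^ k) \<le> b_const * real (p ^ k) / sqrt ((real p - 1) * real r)"
proof -
  have K: "K_fun (p ^ k) = k * (p - 1)"
    using grid_rank_eq_K_fun[of "replicate k p"] p
    by (simp add: grid_rank_def sum_list_replicate)
  have pos: "k * (p - 1) > 0"
    using r prime_gt_1_nat[OF p] by simp
  have b: "b_const \<ge> 0"
    by (simp add: b_const_def)
  have "omega_tilde (p ^ k) = real (p ^ k) * (real (K_fun (p ^ k) choose (K_fun (p ^ k) div 2)) / 2 ^ K_fun (p ^ k))"
    by (simp add: omega_tilde_def)
  also have "\<dots> \<le> real (p ^ k) * (b_const / sqrt (real (k * (p - 1))))"
    unfolding K by (rule mult_left_mono[OF central_binomial_le[OF pos]]) simp
  also have "\<dots> \<le> real (p ^ k) * (b_const / sqrt ((real p - 1) * real r))"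
  proof -
    have "(real p - 1) * real r \<le> real (k * (p - 1))"
      using r prime_gt_1_nat[OF p] by (simp add: of_nat_diff mult.commute mult_right_mono)
    moreover have "(real p - 1) * real r > 0"
      using r prime_gt_1_nat[OF p] by simp
    ultimately show ?thesis
      using b of_nat_0_less_iff[where 'a = real, THEN iffD2, OF pos]
      by (intro mult_left_mono divide_left_mono mult_pos_pos) (auto simp del: of_nat_mult)
  qed
  finally show ?thesis
    by (simp add: mult.commute)
qed

section \<open>Double cosets\<close>

text \<open>For subgroups \<open>H\<close> and \<open>Y\<close> this is the union of the right
  cosets of \<open>H\<close> in the \<open>Y\<close>-orbit of \<open>H g\<close>, so its size is the
  orbit length times the order of \<open>H\<close>.\<close>

definition dcoset :: "('a, 'b) monoid_scheme \<Rightarrow> 'a set \<Rightarrow> 'a \<Rightarrow> 'a set \<Rightarrow> 'a set" where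
  "dcoset G H g Y = {h \<otimes>\<^bsub>G\<^esub> g \<otimes>\<^bsub>G\<^esub> y | h y. h \<in> H \<and> y \<in> Y}"

definition normalizes :: "('a, 'b) monoid_scheme \<Rightarrow> 'a set \<Rightarrow> 'a set \<Rightarrow> bool" where
  "normalizes G Y N \<longleftrightarrow> (\<forall>y\<in>Y. \<forall>n\<in>N. y \<otimes>\<^bsub>G\<^esub> n \<otimes>\<^bsub>G\<^esub> inv\<^bsub>G\<^esub> y \<in> N)"

context group
begin

lemma inv_mult_cancel: "\<lbrakk>x \<in> carrier G; y \<in> carrier G\<rbrakk> \<Longrightarrow> inv x \<otimes> (x \<otimes> y) = y"
  by (simp add: m_assoc[symmetric])

lemma mult_inv_cancel: "\<lbrakk>x \<in> carrier G; y \<in> carrier G\<rbrakk> \<Longrightarrow> x \<otimes> (inv x \<otimes> y) = y"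
  by (simp add: m_assoc[symmetric])

lemmas gsimps = m_assoc inv_mult_group inv_mult_cancel mult_inv_cancel

lemma normalizesD: "\<lbrakk>normalizes G Y N; y \<in> Y; n \<in> N\<rbrakk> \<Longrightarrow> y \<otimes> n \<otimes> inv y \<in> N"
  by (simp add: normalizes_def)

lemma normalizesD':
  assumes "normalizes G Y N" "subgroup Y G" "y \<in> Y" "n \<in> N"
  shows "inv y \<otimes> n \<otimes> y \<in> N"
  using normalizesD[OF assms(1) subgroup.m_inv_closed[OF assms(2,3)] assms(4)]
    subgroup.mem_carrier[OF assms(2,3)] by simp

lemma finite_subset_carrier: "\<lbrakk>finite (carrier G); subgroup A G\<rbrakk> \<Longrightarrow> finite A"
  using finite_subset subgroup.subset by blast

lemma card_subgroup_pos:
  assumes "finite (carrier G)" "subgroup A G"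
  shows "card A > 0"
  using finite_subset_carrier[OF assms] subgroup.one_closed[OF assms(2)] by (auto simp: card_gt_0_iff)

lemma closed_imp_subgroup:
  assumes fin: "finite L" and L: "L \<subseteq> carrier G" "\<one> \<in> L" "\<And>x y. x \<in> L \<Longrightarrow> y \<in> L \<Longrightarrow> x \<otimes> y \<in> L"
  shows "subgroup L G"
proof (rule subgroupI)
  fix x assume x: "x \<in> L"
  have "(\<otimes>) x ` L = L"
  proof (rule endo_inj_surj[OF fin])
    show "(\<otimes>) x ` L \<subseteq> L"
      using L(3)[OF x] by blast
    show "inj_on ((\<otimes>) x) L"
      using L(1) x by (intro inj_onI) (metis inv_mult_cancel subsetD)
  qed
  then obtain y where y: "y \<in> L" "x \<otimes> y = \<one>"
    using L(2) by (metis imageE)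
  then have "inv x = y"
    using inv_equality[of y x] L(1) x by (metis inv_comm subsetD)
  then show "inv x \<in> L"
    using y by simp
qed (use L in auto)

section \<open>Products of subgroups\<close>

lemma normalizes_set_mult:
  assumes A: "subgroup A G" and B: "subgroup B G" and AB: "normalizes G A B" and fin: "finite (carrier G)"
  shows "subgroup (A <#> B) G"
proof (rule closed_imp_subgroup)
  have "A \<subseteq> carrier G" "B \<subseteq> carrier G"
    using A B by (simp_all add: subgroup.subset)
  then show sub: "A <#> B \<subseteq> carrier G"
    by (auto simp: set_mult_def)
  then show "finite (A <#> B)"
    using fin finite_subset by blast
  show "\<one> \<in> A <#> B"
    using subgroup.one_closed[OF A] subgroup.one_closed[OF B] by (force simp: set_mult_def)
  fix x y assume "x \<in> A <#> B" "y \<in> A <#> B"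
  then obtain a b c d where x: "x = a \<otimes> b" "y = c \<otimes> d" and m: "a \<in> A" "b \<in> B" "c \<in> A" "d \<in> B"
    unfolding set_mult_def by blast
  have c: "a \<in> carrier G" "b \<in> carrier G" "c \<in> carrier G" "d \<in> carrier G"
    using m subgroup.mem_carrier[OF A] subgroup.mem_carrier[OF B] by simp_all
  have "x \<otimes> y = (a \<otimes> c) \<otimes> ((inv c \<otimes> b \<otimes> c) \<otimes> d)"
    using c by (simp add: x gsimps)
  moreover have "(inv c \<otimes> b \<otimes> c) \<otimes> d \<in> B"
    by (rule subgroup.m_closed[OF B normalizesD'[OF AB A m(3,2)] m(4)])
  ultimately show "x \<otimes> y \<in> A <#> B"
    using subgroup.m_closed[OF A m(1,3)] by (auto simp: set_mult_def)
qed

lemma set_mult_mono_left: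
  assumes "subgroup A G" "subgroup B G"
  shows "A \<subseteq> A <#> B"
proof
  fix a assume "a \<in> A"
  then have "a = a \<otimes> \<one>" "\<one> \<in> B"
    using assms subgroup.mem_carrier subgroup.one_closed by fastforce+
  then show "a \<in> A <#> B"
    using \<open>a \<in> A\<close> unfolding set_mult_def by blast
qed

lemma set_mult_mono_right:
  assumes "subgroup A G" "subgroup B G"
  shows "B \<subseteq> A <#> B"
proof
  fix b assume "b \<in> B"
  then have "b = \<one> \<otimes> b" "\<one> \<in> A"
    using assms subgroup.mem_carrier subgroup.one_closed by fastforce+
  then show "b \<in> A <#> B"
    using \<open>b \<in> B\<close> unfolding set_mult_def by blast
qed

text \<open>The stabiliser in \<open>Y\<close> of the coset \<open>H g\<close>.\<close>

definition conj_inter :: "'a set \<Rightarrow> 'a \<Rightarrow> 'a set \<Rightarrow> 'a set" where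
  "conj_inter H g Y = {y \<in> Y. g \<otimes> y \<otimes> inv g \<in> H}"

lemma subgroup_conj_inter:
  assumes H: "subgroup H G" and Y: "subgroup Y G" and g: "g \<in> carrier G"
  shows "subgroup (conj_inter H g Y) G"
proof (rule subgroupI)
  have c: "y \<in> carrier G" if "y \<in> conj_inter H g Y" for y
    using that subgroup.mem_carrier[OF Y] by (auto simp: conj_inter_def)
  then show "conj_inter H g Y \<subseteq> carrier G"
    by blast
  have "\<one> \<in> conj_inter H g Y"
    using g subgroup.one_closed[OF H] subgroup.one_closed[OF Y] by (simp add: conj_inter_def)
  then show "conj_inter H g Y \<noteq> {}"
    by blast
  fix y assume y: "y \<in> conj_inter H g Y"
  have "g \<otimes> inv y \<otimes> inv g = inv (g \<otimes> y \<otimes> inv g)"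
    using c[OF y] g by (simp add: gsimps)
  then show "inv y \<in> conj_inter H g Y"
    using y subgroup.m_inv_closed[OF H, of "g \<otimes> y \<otimes> inv g"] subgroup.m_inv_closed[OF Y]
    by (simp add: conj_inter_def)
  fix z assume z: "z \<in> conj_inter H g Y"
  have "g \<otimes> (y \<otimes> z) \<otimes> inv g = (g \<otimes> y \<otimes> inv g) \<otimes> (g \<otimes> z \<otimes> inv g)"
    using c[OF y] c[OF z] g by (simp add: gsimps)
  then show "y \<otimes> z \<in> conj_inter H g Y"
    using y z subgroup.m_closed[OF H, of "g \<otimes> y \<otimes> inv g" "g \<otimes> z \<otimes> inv g"] subgroup.m_closed[OF Y]
    by (simp add: conj_inter_def)
qed

lemma dcosetI: "\<lbrakk>h \<in> H; y \<in> Y\<rbrakk> \<Longrightarrow> h \<otimes> g \<otimes> y \<in> dcoset G H g Y"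
  unfolding dcoset_def by blast

lemma dcosetE:
  assumes "x \<in> dcoset G H g Y"
  obtains h y where "x = h \<otimes> g \<otimes> y" "h \<in> H" "y \<in> Y"
  using assms unfolding dcoset_def by blast

lemma dcoset_subset:
  assumes "subgroup H G" "subgroup Y G" "g \<in> carrier G"
  shows "dcoset G H g Y \<subseteq> carrier G"
  using assms subgroup.mem_carrier by (force simp: dcoset_def)

lemma dcoset_closed:
  assumes H: "subgroup H G" and Y: "subgroup Y G" and g: "g \<in> carrier G"
    and "x \<in> dcoset G H g Y" "h \<in> H" "y \<in> Y"
  shows "h \<otimes> x \<otimes> y \<in> dcoset G H g Y"
proof -
  obtain h' y' where x: "x = h' \<otimes> g \<otimes> y'" "h' \<in> H" "y' \<in> Y"
    using assms(4) by (rule dcosetE)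
  then have "h \<otimes> x \<otimes> y = (h \<otimes> h') \<otimes> g \<otimes> (y' \<otimes> y)"
    using assms by (simp add: gsimps subgroup.mem_carrier)
  moreover have "(h \<otimes> h') \<otimes> g \<otimes> (y' \<otimes> y) \<in> dcoset G H g Y"
    using x assms by (intro dcosetI subgroup.m_closed[OF H] subgroup.m_closed[OF Y])
  ultimately show ?thesis
    by simp
qed

lemma dcoset_self:
  assumes "subgroup H G" "subgroup Y G" "g \<in> carrier G"
  shows "g \<in> dcoset G H g Y"
  using dcosetI[OF subgroup.one_closed[OF assms(1)] subgroup.one_closed[OF assms(2)], of g] assms(3)
  by simp

lemma dcoset_eq:
  assumes H: "subgroup H G" and Y: "subgroup Y G" and g: "g \<in> carrier G"
    and x: "x \<in> dcoset G H g Y"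
  shows "dcoset G H x Y = dcoset G H g Y"
proof
  obtain h y where x': "x = h \<otimes> g \<otimes> y" "h \<in> H" "y \<in> Y"
    using x by (rule dcosetE)
  have c: "h \<in> carrier G" "y \<in> carrier G" "x \<in> carrier G"
    using x' H Y g by (auto simp: subgroup.mem_carrier)
  have "g = inv h \<otimes> x \<otimes> inv y"
    using c g by (simp add: x'(1) gsimps)
  moreover have "inv h \<otimes> x \<otimes> inv y \<in> dcoset G H x Y"
    by (rule dcosetI[OF subgroup.m_inv_closed[OF H x'(2)] subgroup.m_inv_closed[OF Y x'(3)]])
  ultimately have "g \<in> dcoset G H x Y"
    by simp
  then show "dcoset G H g Y \<subseteq> dcoset G H x Y"
    by (auto elim!: dcosetE[of _ _ g] intro: dcoset_closed[OF H Y c(3)])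
  show "dcoset G H x Y \<subseteq> dcoset G H g Y"
    by (auto elim!: dcosetE[of _ _ x] intro: dcoset_closed[OF H Y g x])
qed

lemma dcoset_disjoint:
  assumes H: "subgroup H G" and Y: "subgroup Y G" and g: "g \<in> carrier G" and g': "g' \<in> carrier G"
    and ne: "dcoset G H g Y \<noteq> dcoset G H g' Y"
  shows "dcoset G H g Y \<inter> dcoset G H g' Y = {}"
  using dcoset_eq[OF H Y g] dcoset_eq[OF H Y g'] ne by blast

text \<open>Orbit and stabiliser, by an explicit bijection: once each element of the double coset
  has a chosen factorisation, every other factorisation differs from it by a stabiliser element
  moved across \<open>g\<close>.\<close>

lemma card_dcoset:
  assumes fin: "finite (carrier G)" and H: "subgroup H G" and Y: "subgroup Y G" and g: "g \<in> carrier G"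
  shows "card (dcoset G H g Y) * card (conj_inter H g Y) = card H * card Y"
proof -
  let ?O = "dcoset G H g Y" and ?C = "conj_inter H g Y"
  have "\<forall>z\<in>?O. \<exists>p. fst p \<in> H \<and> snd p \<in> Y \<and> z = fst p \<otimes> g \<otimes> snd p"
    unfolding dcoset_def by force
  then obtain r where r: "\<And>z. z \<in> ?O \<Longrightarrow> fst (r z) \<in> H \<and> snd (r z) \<in> Y \<and> z = fst (r z) \<otimes> g \<otimes> snd (r z)"
    by metis
  note Hc = subgroup.mem_carrier[OF H] and Yc = subgroup.mem_carrier[OF Y]
  have C: "c \<in> Y" "g \<otimes> c \<otimes> inv g \<in> H" "c \<in> carrier G" if "c \<in> ?C" for c
    using that Yc by (auto simp: conj_inter_def)
  let ?f = "\<lambda>(z, c). (fst (r z) \<otimes> (g \<otimes> c \<otimes> inv g), inv c \<otimes> snd (r z))"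
  have "bij_betw ?f (?O \<times> ?C) (H \<times> Y)"
    unfolding bij_betw_def
  proof (intro conjI Set.set_eqI iffI inj_onI)
    fix u v assume u: "u \<in> ?O \<times> ?C" and v: "v \<in> ?O \<times> ?C" and eq: "?f u = ?f v"
    obtain z c z' c' where uv: "u = (z, c)" "v = (z', c')"
      by (cases u, cases v) auto
    have z: "z \<in> ?O" "z' \<in> ?O" "c \<in> ?C" "c' \<in> ?C"
      using u v uv by auto
    have rc: "fst (r z) \<in> carrier G" "snd (r z) \<in> carrier G" "fst (r z') \<in> carrier G" "snd (r z') \<in> carrier G"
      using r[OF z(1)] r[OF z(2)] Hc Yc by auto
    have eq1: "fst (r z) \<otimes> (g \<otimes> c \<otimes> inv g) = fst (r z') \<otimes> (g \<otimes> c' \<otimes> inv g)"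
      and eq2: "inv c \<otimes> snd (r z) = inv c' \<otimes> snd (r z')"
      using eq uv by auto
    have "z = (fst (r z) \<otimes> (g \<otimes> c \<otimes> inv g)) \<otimes> g \<otimes> (inv c \<otimes> snd (r z))"
      using rc C[OF z(3)] g r[OF z(1)] by (simp add: gsimps)
    also have "\<dots> = (fst (r z') \<otimes> (g \<otimes> c' \<otimes> inv g)) \<otimes> g \<otimes> (inv c' \<otimes> snd (r z'))"
      by (simp add: eq1 eq2)
    also have "\<dots> = z'"
      using rc C[OF z(4)] g r[OF z(2)] by (simp add: gsimps)
    finally have zz: "z = z'" .
    then have "inv c = inv c'"
      using eq2 rc C[OF z(3)] C[OF z(4)] by simp
    then have "c = c'"
      using C[OF z(3)] C[OF z(4)] by (metis inv_inv)
    then show "u = v"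
      using zz uv by simp
  next
    fix u assume "u \<in> ?f ` (?O \<times> ?C)"
    then obtain z c where u: "u = ?f (z, c)" and z: "z \<in> ?O" "c \<in> ?C"
      by blast
    then show "u \<in> H \<times> Y"
      using r[OF z(1)] C[OF z(2)] subgroup.m_closed[OF H] subgroup.m_closed[OF Y]
        subgroup.m_inv_closed[OF Y] by auto
  next
    fix u assume "u \<in> H \<times> Y"
    then obtain h y where u: "u = (h, y)" "h \<in> H" "y \<in> Y"
      by blast
    define z where "z = h \<otimes> g \<otimes> y"
    define c where "c = snd (r z) \<otimes> inv y"
    have z: "z \<in> ?O"
      unfolding dcoset_def z_def using u by blast
    have hc: "h \<in> carrier G" "y \<in> carrier G" "fst (r z) \<in> carrier G" "snd (r z) \<in> carrier G"
      using r[OF z] u Hc Yc by auto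
    have eq: "h \<otimes> g \<otimes> y = fst (r z) \<otimes> g \<otimes> snd (r z)"
      using r[OF z] z_def by simp
    have "g \<otimes> c \<otimes> inv g = inv (fst (r z)) \<otimes> (fst (r z) \<otimes> g \<otimes> snd (r z)) \<otimes> inv y \<otimes> inv g"
      using hc g by (simp add: c_def gsimps)
    also have "\<dots> = inv (fst (r z)) \<otimes> h"
      unfolding eq[symmetric] using hc g by (simp add: gsimps)
    finally have gc: "g \<otimes> c \<otimes> inv g = inv (fst (r z)) \<otimes> h" .
    then have "c \<in> ?C"
      unfolding conj_inter_def c_def using r[OF z] u H Y
      by (simp add: subgroup.m_closed subgroup.m_inv_closed)
    moreover have "?f (z, c) = u"
      using hc gc by (simp add: u c_def gsimps)
    ultimately show "u \<in> ?f ` (?O \<times> ?C)"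
      using z by (metis (no_types, lifting) SigmaI imageI)
  qed
  then have "card (?O \<times> ?C) = card (H \<times> Y)"
    by (rule bij_betw_same_card)
  then show ?thesis
    by (simp add: card_cartesian_product)
qed

lemma dcoset_one: "\<lbrakk>subgroup A G; subgroup B G\<rbrakk> \<Longrightarrow> dcoset G A \<one> B = A <#> B"
  by (auto simp: dcoset_def set_mult_def subgroup.mem_carrier intro!: bexI) (metis r_one subgroup.mem_carrier)+

lemma conj_inter_one: "subgroup B G \<Longrightarrow> conj_inter A \<one> B = A \<inter> B"
  by (auto simp: conj_inter_def dest: subgroup.mem_carrier)

lemma card_set_mult:
  assumes "finite (carrier G)" "subgroup A G" "subgroup B G"
  shows "card (A <#> B) * card (A \<inter> B) = card A * card B"
  using card_dcoset[OF assms one_closed] assms by (simp add: dcoset_one conj_inter_one)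

text \<open>The set \<open>U\<close> is a disjoint union of left cosets of \<open>Y\<close>, treated
  as double cosets with the trivial subgroup on the left.\<close>

lemma card_dvd_card_right:
  assumes fin: "finite (carrier G)" and Y: "subgroup Y G" and U: "U \<subseteq> carrier G"
    and cl: "\<And>u y. u \<in> U \<Longrightarrow> y \<in> Y \<Longrightarrow> u \<otimes> y \<in> U"
  shows "card Y dvd card U"
proof -
  let ?C = "(\<lambda>u. dcoset G {\<one>} u Y) ` U"
  have one: "subgroup {\<one>} G"
    by (rule triv_subgroup)
  have Un: "\<Union> ?C = U"
  proof
    show "\<Union> ?C \<subseteq> U"
      using cl U by (auto simp: dcoset_def)
    show "U \<subseteq> \<Union> ?C"
      using dcoset_self[OF one Y] U by blast
  qed
  have "card Y * card ?C = card (\<Union> ?C)"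
  proof (rule card_partition)
    show "finite ?C" "finite (\<Union> ?C)"
      using Un U fin finite_subset by (metis finite_imageI, metis)
    fix c assume "c \<in> ?C"
    then obtain u where u: "u \<in> U" "c = dcoset G {\<one>} u Y"
      by blast
    have "conj_inter {\<one>} u Y = {\<one>}"
    proof -
      have "y = \<one>" if "y \<in> Y" "u \<otimes> y \<otimes> inv u = \<one>" for y
      proof -
        have "y \<in> carrier G" "u \<in> carrier G"
          using that u U subgroup.mem_carrier[OF Y] by auto
        then have "y = inv u \<otimes> (u \<otimes> y \<otimes> inv u) \<otimes> u"
          by (simp add: gsimps)
        then show ?thesis
          using that \<open>u \<in> carrier G\<close> by simp
      qed
      moreover have "u \<otimes> \<one> \<otimes> inv u = \<one>"
        using u U by auto
      ultimately show ?thesis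
        using subgroup.one_closed[OF Y] by (auto simp: conj_inter_def)
    qed
    then show "card c = card Y"
      using card_dcoset[OF fin one Y, of u] u U by auto
  next
    fix c d assume "c \<in> ?C" "d \<in> ?C" "c \<noteq> d"
    then show "c \<inter> d = {}"
      using dcoset_disjoint[OF one Y] U by blast
  qed
  then show ?thesis
    unfolding Un by (metis dvd_triv_left)
qed

lemma card_dvd_card_left:
  assumes fin: "finite (carrier G)" and Y: "subgroup Y G" and U: "U \<subseteq> carrier G"
    and cl: "\<And>u y. u \<in> U \<Longrightarrow> y \<in> Y \<Longrightarrow> y \<otimes> u \<in> U"
  shows "card Y dvd card U"
proof -
  have "card Y dvd card (m_inv G ` U)"
  proof (rule card_dvd_card_right[OF fin Y])
    fix u y assume u: "u \<in> m_inv G ` U" and y: "y \<in> Y"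
    then obtain v where v: "v \<in> U" "u = inv v"
      by blast
    have "u \<otimes> y = inv (inv y \<otimes> v)"
      using v y U subgroup.mem_carrier[OF Y y] by (simp add: subset_iff gsimps)
    then show "u \<otimes> y \<in> m_inv G ` U"
      using cl[OF v(1) subgroup.m_inv_closed[OF Y y]] by blast
  qed (use U in auto)
  also have "card (m_inv G ` U) = card U"
    using U inv_inj by (intro card_image) (metis inj_on_subset)
  finally show ?thesis .
qed

lemma card_subgroup_dvd:
  "\<lbrakk>finite (carrier G); subgroup A G; subgroup B G; A \<subseteq> B\<rbrakk> \<Longrightarrow> card A dvd card B"
  by (rule card_dvd_card_right) (auto simp: subgroup.mem_carrier subgroup.m_closed subset_iff)

section \<open>Sylow subgroups\<close>

lemma sylow_subgroup:
  assumes fin: "finite (carrier G)" and Y: "subgroup Y G" and q: "prime q" and dvd: "q ^ k dvd card Y"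
  obtains Q where "subgroup Q G" "Q \<subseteq> Y" "card Q = q ^ k"
proof -
  obtain m where m: "card Y = q ^ k * m"
    using dvd by blast
  interpret Y: group "G\<lparr>carrier := Y\<rparr>"
    by (rule subgroup.subgroup_is_group[OF Y is_group])
  have "\<exists>Q. subgroup Q (G\<lparr>carrier := Y\<rparr>) \<and> card Q = q ^ k"
    using sylow_thm[OF q Y.is_group, of k m] m finite_subset_carrier[OF fin Y] by (simp add: order_def)
  then obtain Q where Q: "subgroup Q (G\<lparr>carrier := Y\<rparr>)" "card Q = q ^ k"
    by blast
  have "Q \<subseteq> Y"
    using subgroup.subset[OF Q(1)] by simp
  moreover have "subgroup Q G"
    by (rule incl_subgroup[OF Y Q(1)])
  ultimately show ?thesis
    using Q(2) that by blast
qed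

text \<open>Let \<open>R\<close> act on the cosets of \<open>Q\<close> in \<open>N\<close>. If it
  fixed none of them, every orbit length would be a multiple of \<open>q\<close>, and hence so would
  \<open>m\<close>.\<close>

lemma sylow_conjugate:
  assumes fin: "finite (carrier G)" and N: "subgroup N G" and q: "prime q"
    and Q: "subgroup Q G" "Q \<subseteq> N" "card N = card Q * m" "\<not> q dvd m"
    and R: "subgroup R G" "R \<subseteq> N" "card R = q ^ k"
  obtains g where "g \<in> N" "\<And>r. r \<in> R \<Longrightarrow> g \<otimes> r \<otimes> inv g \<in> Q"
proof -
  have Nc: "g \<in> carrier G" if "g \<in> N" for g
    using that subgroup.mem_carrier[OF N] by blast
  have "\<exists>g\<in>N. conj_inter Q g R = R"
  proof (rule ccontr)
    assume no: "\<not> (\<exists>g\<in>N. conj_inter Q g R = R)"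
    have dvd: "card Q * q dvd card (dcoset G Q g R)" if g: "g \<in> N" for g
    proof -
      let ?C = "conj_inter Q g R"
      have C: "subgroup ?C G" "?C \<subseteq> R"
        using subgroup_conj_inter[OF Q(1) R(1) Nc[OF g]] by (auto simp: conj_inter_def)
      have "card ?C dvd q ^ k"
        using card_subgroup_dvd[OF fin C(1) R(1) C(2)] R(3) by simp
      then obtain j where j: "j \<le> k" "card ?C = q ^ j"
        using divides_primepow_nat[OF q] by blast
      have "j \<noteq> k"
        using no g C(2) j R(3) card_subset_eq[OF finite_subset_carrier[OF fin R(1)] C(2)] by metis
      then have "q ^ k = q * q ^ (k - Suc j) * q ^ j"
        using j(1) by (simp flip: power_Suc power_add)
      then have "card (dcoset G Q g R) * q ^ j = card Q * q * q ^ (k - Suc j) * q ^ j"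
        using card_dcoset[OF fin Q(1) R(1) Nc[OF g]] j R(3) by (simp add: mult.assoc)
      then have "card (dcoset G Q g R) = card Q * q * q ^ (k - Suc j)"
        using q prime_gt_0_nat by simp
      then show ?thesis
        by simp
    qed
    let ?C = "(\<lambda>g. dcoset G Q g R) ` N"
    have Un: "\<Union> ?C = N"
    proof
      show "\<Union> ?C \<subseteq> N"
        using Q(2) R(2) subgroup.m_closed[OF N] by (fastforce simp: dcoset_def)
      show "N \<subseteq> \<Union> ?C"
        using dcoset_self[OF Q(1) R(1)] Nc by blast
    qed
    have finN: "finite N"
      by (rule finite_subset_carrier[OF fin N])
    have "card N = sum card ?C"
    proof -
      have "card (\<Union> ?C) = sum card ?C"
      proof (rule card_Union_disjoint)
        show "pairwise disjnt ?C"
          using dcoset_disjoint[OF Q(1) R(1)] Nc by (auto simp: pairwise_def disjnt_def)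
        show "finite A" if "A \<in> ?C" for A
          using that Un finN by (metis Union_upper finite_subset)
      qed
      then show ?thesis
        unfolding Un .
    qed
    also have "card Q * q dvd \<dots>"
      by (rule dvd_sum) (use dvd in auto)
    finally have "card Q * q dvd card Q * m"
      using Q(3) by simp
    then show False
      using Q(4) card_subgroup_pos[OF fin Q(1)] by simp
  qed
  then show ?thesis
    using that unfolding conj_inter_def by blast
qed

section \<open>Commutators, cyclic extensions and solubility of \<open>p\<close>-groups\<close>

lemma derived_commutator:
  "\<lbrakk>a \<in> N; b \<in> N\<rbrakk> \<Longrightarrow> a \<otimes> b \<otimes> inv a \<otimes> inv b \<in> derived G N"
  unfolding derived_def by (rule generate.incl) blast

lemma derived_subset_iff:
  assumes "subgroup U G"
  shows "derived G N \<subseteq> U \<longleftrightarrow> (\<forall>a\<in>N. \<forall>b\<in>N. a \<otimes> b \<otimes> inv a \<otimes> inv b \<in> U)"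
proof
  assume "\<forall>a\<in>N. \<forall>b\<in>N. a \<otimes> b \<otimes> inv a \<otimes> inv b \<in> U"
  then have "derived_set G N \<subseteq> U"
    by auto
  then show "derived G N \<subseteq> U"
    unfolding derived_def by (rule generate_subgroup_incl[OF _ assms])
qed (use derived_commutator in blast)

lemma normalizes_of_derived:
  assumes N: "subgroup N G" and U: "subgroup U G" "U \<subseteq> N" "derived G N \<subseteq> U"
  shows "normalizes G N U"
  unfolding normalizes_def
proof (intro ballI)
  fix y n assume y: "y \<in> N" and n: "n \<in> U"
  have c: "y \<in> carrier G" "n \<in> carrier G"
    using y n U(2) subgroup.mem_carrier[OF N] by auto
  have "y \<otimes> n \<otimes> inv y = (y \<otimes> n \<otimes> inv y \<otimes> inv n) \<otimes> n"
    using c by (simp add: gsimps)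
  moreover have "y \<otimes> n \<otimes> inv y \<otimes> inv n \<in> U"
    using derived_commutator[OF y, of n] n U by blast
  ultimately show "y \<otimes> n \<otimes> inv y \<in> U"
    using subgroup.m_closed[OF U(1) _ n] by metis
qed

text \<open>In a finite group, if \<open>y\<close> normalizes the subgroup \<open>U\<close>, natural
  exponents already give the subgroup generated by both.\<close>

definition adjoin_power :: "'a set \<Rightarrow> 'a \<Rightarrow> 'a set" where
  "adjoin_power U y = {u \<otimes> y [^] i | u i. u \<in> U \<and> i \<in> (UNIV :: nat set)}"

lemma pow_mem: "\<lbrakk>subgroup N G; y \<in> N\<rbrakk> \<Longrightarrow> y [^] (i :: nat) \<in> N"
  by (induction i) (auto simp: subgroup.one_closed subgroup.m_closed)

lemma adjoin_power_mult:
  fixes i j :: nat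
  assumes N: "subgroup N G" and U: "subgroup U G" "normalizes G N U" and y: "y \<in> N"
    and uv: "u \<in> U" "v \<in> U"
  shows "\<exists>w\<in>U. (u \<otimes> y [^] i) \<otimes> (v \<otimes> y [^] j) = w \<otimes> y [^] (i + j)"
proof (rule bexI)
  have c: "u \<in> carrier G" "v \<in> carrier G" "y \<in> carrier G"
    using uv y subgroup.mem_carrier[OF U(1)] subgroup.mem_carrier[OF N] by auto
  show "(u \<otimes> y [^] i) \<otimes> (v \<otimes> y [^] j) = (u \<otimes> (y [^] i \<otimes> v \<otimes> inv (y [^] i))) \<otimes> y [^] (i + j)"
    using c by (simp add: gsimps nat_pow_mult[symmetric])
  show "u \<otimes> (y [^] i \<otimes> v \<otimes> inv (y [^] i)) \<in> U"
    by (rule subgroup.m_closed[OF U(1) uv(1) normalizesD[OF U(2) pow_mem[OF N y] uv(2)]])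
qed

lemma adjoin_power:
  assumes fin: "finite (carrier G)" and N: "subgroup N G"
    and U: "subgroup U G" "normalizes G N U" "U \<subseteq> N" and y: "y \<in> N"
  shows "subgroup (adjoin_power U y) G" "adjoin_power U y \<subseteq> N" "U \<subseteq> adjoin_power U y"
    "y \<in> adjoin_power U y"
proof -
  let ?L = "adjoin_power U y"
  have yc: "y \<in> carrier G"
    by (rule subgroup.mem_carrier[OF N y])
  show LN: "?L \<subseteq> N"
    using U(3) pow_mem[OF N y] subgroup.m_closed[OF N] by (auto simp: adjoin_power_def)
  show UL: "U \<subseteq> ?L"
  proof
    fix u assume u: "u \<in> U"
    then have "u = u \<otimes> y [^] (0::nat)"
      using subgroup.mem_carrier[OF U(1)] by simp
    then show "u \<in> ?L"
      unfolding adjoin_power_def using u by blast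
  qed
  show "y \<in> ?L"
    unfolding adjoin_power_def using subgroup.one_closed[OF U(1)] yc
    by (intro CollectI exI[of _ \<one>] exI[of _ "1::nat"]) (simp add: nat_pow_eone)
  show "subgroup ?L G"
  proof (rule closed_imp_subgroup)
    show "finite ?L" "?L \<subseteq> carrier G"
      using LN subgroup.subset[OF N] fin by (auto intro: finite_subset)
    show "\<one> \<in> ?L"
      using UL subgroup.one_closed[OF U(1)] by blast
    show "b \<otimes> c \<in> ?L" if "b \<in> ?L" "c \<in> ?L" for b c
      using that adjoin_power_mult[OF N U(1,2) y] unfolding adjoin_power_def by blast
  qed
qed

text \<open>Sylow's theorem provides a subgroup \<open>U\<close> of index \<open>p\<close>. It is
  normal, because a double coset \<open>U y U\<close> disjoint from \<open>U\<close> is too small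
  for the stabiliser to be proper in \<open>U\<close>. The quotient is cyclic, so commutators lie in
  \<open>U\<close> and induction applies.\<close>

lemma p_group_derived_series:
  assumes fin: "finite (carrier G)" and p: "prime p" and Y: "subgroup Y G" "card Y = p ^ k"
  shows "\<exists>n. (derived G ^^ n) Y \<subseteq> {\<one>}"
  using Y
proof (induction k arbitrary: Y)
  case 0
  then have "Y = {\<one>}"
    using subgroup.one_closed[of Y G] by (metis card_1_singletonE power_0 singletonD)
  then show ?case
    by (intro exI[of _ 0]) simp
next
  case (Suc k)
  note Y = Suc.prems
  obtain U where U: "subgroup U G" "U \<subseteq> Y" "card U = p ^ k"
    using sylow_subgroup[OF fin Y(1) p, of k] Y(2) by (metis dvd_triv_right power_Suc)
  have Yc: "y \<in> carrier G" if "y \<in> Y" for y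
    using that subgroup.mem_carrier[OF Y(1)] by blast
  have finY: "finite Y"
    by (rule finite_subset_carrier[OF fin Y(1)])
  have p0: "p > 1"
    using p by (rule prime_gt_1_nat)
  have norm: "conj_inter U y U = U" if y: "y \<in> Y" for y
  proof (cases "y \<in> U")
    case True
    then show ?thesis
      using subgroup.m_closed[OF U(1)] subgroup.m_inv_closed[OF U(1)] by (auto simp: conj_inter_def)
  next
    case False
    let ?C = "conj_inter U y U"
    have C: "subgroup ?C G" "?C \<subseteq> U"
      using subgroup_conj_inter[OF U(1) U(1) Yc[OF y]] by (auto simp: conj_inter_def)
    have "card ?C dvd p ^ k"
      using card_subgroup_dvd[OF fin C(1) U(1) C(2)] U(3) by simp
    then obtain j where j: "j \<le> k" "card ?C = p ^ j"
      using divides_primepow_nat[OF p] by blast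
    have disj: "dcoset G U y U \<inter> U = {}"
    proof -
      have "y \<in> U" if "h \<in> U" "h' \<in> U" "h \<otimes> y \<otimes> h' \<in> U" for h h'
      proof -
        have "y = inv h \<otimes> (h \<otimes> y \<otimes> h') \<otimes> inv h'"
          using that Yc[OF y] subgroup.mem_carrier[OF U(1)] by (simp add: gsimps)
        then show ?thesis
          using that subgroup.m_closed[OF U(1)] subgroup.m_inv_closed[OF U(1)] by metis
      qed
      then show ?thesis
        using False by (auto simp: dcoset_def)
    qed
    have sub: "dcoset G U y U \<subseteq> Y"
      using U(2) y subgroup.m_closed[OF Y(1)] by (auto simp: dcoset_def subset_iff)
    have "card (dcoset G U y U) + card U = card (dcoset G U y U \<union> U)"
      using disj sub U(2) finY by (intro card_Un_disjoint[symmetric]) (auto intro: finite_subset)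
    also have "\<dots> \<le> card Y"
      using sub U(2) finY by (intro card_mono) auto
    finally have "card (dcoset G U y U) + p ^ k \<le> p ^ Suc k"
      using Y(2) U(3) by simp
    moreover have "0 < p ^ k"
      using p0 by simp
    ultimately have lt: "card (dcoset G U y U) < p ^ Suc k"
      by linarith
    have "card (dcoset G U y U) * card ?C < p ^ Suc k * p ^ j"
      unfolding j(2) using lt p0 by (intro mult_strict_right_mono) simp_all
    then have "p ^ (Suc k + j) > p ^ (k + k)"
      using card_dcoset[OF fin U(1) U(1) Yc[OF y]] U(3) by (simp add: power_add)
    then have "j = k"
      using j(1) p0 by (simp add: power_strict_increasing_iff del: power_Suc)
    then show ?thesis
      using card_subset_eq[OF finite_subset_carrier[OF fin U(1)] C(2)] j(2) U(3) by simp
  qed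
  then have YU: "normalizes G Y U"
    by (auto simp: normalizes_def conj_inter_def)
  have "card U < card Y"
    using U(3) Y(2) p0 by simp
  then obtain y where y: "y \<in> Y" "y \<notin> U"
    by (metis U(2) less_irrefl subset_antisym subsetI)
  have yc: "y \<in> carrier G"
    using Yc y by blast
  define L where "L = adjoin_power U y"
  note L = adjoin_power[OF fin Y(1) U(1) YU U(2) y(1), folded L_def]
  note prod = adjoin_power_mult[OF Y(1) U(1) YU y(1)]
  have "U \<subset> L"
    using L(3,4) y by blast
  then have "card U < card L"
    using L(2) finY by (intro psubset_card_mono) (auto intro: finite_subset)
  moreover have "card L dvd p ^ Suc k"
    using card_subgroup_dvd[OF fin L(1) Y(1) L(2)] Y(2) by simp
  then obtain l where "l \<le> Suc k" "card L = p ^ l"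
    using divides_primepow_nat[OF p] by blast
  ultimately have "card L = card Y"
    using Y(2) U(3) p0 by (metis le_SucE le_less_trans less_irrefl power_increasing less_imp_le)
  then have LY': "L = Y"
    using card_subset_eq[OF finY L(2)] by simp
  have "derived G Y \<subseteq> U"
    unfolding derived_subset_iff[OF U(1)]
  proof (intro ballI)
    fix a b assume ab: "a \<in> Y" "b \<in> Y"
    then obtain u i v j where a: "a = u \<otimes> y [^] (i::nat)" "u \<in> U" and b: "b = v \<otimes> y [^] (j::nat)" "v \<in> U"
      unfolding LY'[symmetric] L_def adjoin_power_def by blast
    obtain w where w: "w \<in> U" "a \<otimes> b = w \<otimes> y [^] (i + j)"
      using prod[OF a(2) b(2)] a b by blast
    obtain w' where w': "w' \<in> U" "b \<otimes> a = w' \<otimes> y [^] (i + j)"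
      using prod[OF b(2) a(2)] a b by (metis add.commute)
    have c: "a \<in> carrier G" "b \<in> carrier G" "w \<in> carrier G" "w' \<in> carrier G"
      using ab w w' Yc subgroup.mem_carrier[OF U(1)] by auto
    have "a \<otimes> b \<otimes> inv a \<otimes> inv b = (a \<otimes> b) \<otimes> inv (b \<otimes> a)"
      using c by (simp add: gsimps)
    also have "\<dots> = w \<otimes> inv w'"
      unfolding w w' using c yc by (simp add: gsimps)
    finally show "a \<otimes> b \<otimes> inv a \<otimes> inv b \<in> U"
      using w w' subgroup.m_closed[OF U(1)] subgroup.m_inv_closed[OF U(1)] by simp
  qed
  moreover obtain n where "(derived G ^^ n) U \<subseteq> {\<one>}"
    using Suc.IH[OF U(1,3)] by blast
  ultimately have "(derived G ^^ n) (derived G Y) \<subseteq> {\<one>}"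
    using mono_exp_of_derived by blast
  then have "(derived G ^^ Suc n) Y \<subseteq> {\<one>}"
    by (simp add: funpow_swap1)
  then show ?case
    by blast
qed

end

section \<open>Labellings of cosets by boxes\<close>

text \<open>The mixed radix value with the first digit most significant; it turns lexicographic
  comparison into comparison of numbers.\<close>

primrec lex_index :: "nat list \<Rightarrow> nat list \<Rightarrow> nat" where
  "lex_index [] \<alpha> = 0"
| "lex_index (q # qs) \<alpha> = hd \<alpha> * prod_list qs + lex_index qs (tl \<alpha>)"

lemma lex_index_less: "\<alpha> \<in> grid qs \<Longrightarrow> lex_index qs \<alpha> < prod_list qs"
proof (induction qs arbitrary: \<alpha>)
  case (Cons q qs)
  then obtain j \<beta> where \<alpha>: "\<alpha> = j # \<beta>" "j < q" "\<beta> \<in> grid qs"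
    by auto
  have "lex_index (q # qs) \<alpha> < j * prod_list qs + prod_list qs"
    using Cons.IH[OF \<alpha>(3)] \<alpha>(1) by simp
  also have "\<dots> = Suc j * prod_list qs"
    by simp
  also have "\<dots> \<le> q * prod_list qs"
    using \<alpha>(2) by (intro mult_right_mono) auto
  finally show ?case
    by simp
qed simp

lemma mult_add_less_iff:
  fixes a b a' b' P :: nat
  assumes "b < P" "b' < P"
  shows "a * P + b < a' * P + b' \<longleftrightarrow> a < a' \<or> a = a' \<and> b < b'"
proof -
  have *: "x * P + y < x' * P + y'" if "x < x'" "y < P" for x y x' y'
  proof -
    have "x * P + y < Suc x * P"
      using that by simp
    also have "\<dots> \<le> x' * P"
      using that by (intro mult_right_mono) auto
    finally show ?thesis
      by simp
  qed
  show ?thesis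
    using *[of a a' b b'] *[of a' a b' b] assms by (cases a a' rule: linorder_cases) auto
qed

lemma lex_index_inj:
  "\<lbrakk>\<alpha> \<in> grid qs; \<beta> \<in> grid qs; lex_index qs \<alpha> = lex_index qs \<beta>\<rbrakk> \<Longrightarrow> \<alpha> = \<beta>"
proof (induction qs arbitrary: \<alpha> \<beta>)
  case (Cons q qs)
  then obtain j \<alpha>' k \<beta>' where *: "\<alpha> = j # \<alpha>'" "\<alpha>' \<in> grid qs" "\<beta> = k # \<beta>'" "\<beta>' \<in> grid qs"
    by auto
  have "j = k \<and> lex_index qs \<alpha>' = lex_index qs \<beta>'"
    using mult_add_less_iff[OF lex_index_less[OF *(2)] lex_index_less[OF *(4)], of j k]
      mult_add_less_iff[OF lex_index_less[OF *(4)] lex_index_less[OF *(2)], of k j]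
      Cons.prems(3) * by auto
  then show ?case
    using Cons.IH[OF *(2,4)] * by simp
qed simp

lemma lex_index_append:
  "length \<alpha> = length qs \<Longrightarrow>
     lex_index (qs @ rs) (\<alpha> @ \<beta>) = lex_index qs \<alpha> * prod_list rs + lex_index rs \<beta>"
proof (induction qs arbitrary: \<alpha>)
  case (Cons q qs)
  then show ?case
    by (cases \<alpha>) (auto simp: algebra_simps)
qed simp

lemma lex_index_append_less_iff:
  assumes "\<alpha> \<in> grid qs" "\<alpha>' \<in> grid qs" "\<beta> \<in> grid rs" "\<beta>' \<in> grid rs"
  shows "lex_index (qs @ rs) (\<alpha> @ \<beta>) < lex_index (qs @ rs) (\<alpha>' @ \<beta>') \<longleftrightarrow>
    lex_index qs \<alpha> < lex_index qs \<alpha>' \<or> \<alpha> = \<alpha>' \<and> lex_index rs \<beta> < lex_index rs \<beta>'"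
  using mult_add_less_iff[OF lex_index_less[OF assms(3)] lex_index_less[OF assms(4)]]
    lex_index_inj[OF assms(1,2)] length_grid[OF assms(1)] length_grid[OF assms(2)]
  by (auto simp: lex_index_append)

lemma step_append:
  assumes "step (\<alpha> @ \<beta>) \<gamma>"
  shows "(\<exists>\<alpha>'. \<gamma> = \<alpha>' @ \<beta> \<and> step \<alpha> \<alpha>') \<or> (\<exists>\<beta>'. \<gamma> = \<alpha> @ \<beta>' \<and> step \<beta> \<beta>')"
  using assms
proof (induction \<alpha> arbitrary: \<gamma>)
  case (Cons a \<alpha>)
  from Cons.prems have "step (a # (\<alpha> @ \<beta>)) \<gamma>"
    by simp
  then show ?case
  proof cases
    case step_here
    then have "\<gamma> = (Suc a # \<alpha>) @ \<beta>"
      by simp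
    then show ?thesis
      using step.step_here by blast
  next
    case (step_there \<delta>)
    then consider \<alpha>' where "\<delta> = \<alpha>' @ \<beta>" "step \<alpha> \<alpha>'" | \<beta>' where "\<delta> = \<alpha> @ \<beta>'" "step \<beta> \<beta>'"
      using Cons.IH by blast
    then show ?thesis
    proof cases
      case 1
      then have "\<gamma> = (a # \<alpha>') @ \<beta> \<and> step (a # \<alpha>) (a # \<alpha>')"
        using step_there by (simp add: step.step_there)
      then show ?thesis
        by blast
    next
      case 2
      then have "\<gamma> = (a # \<alpha>) @ \<beta>'"
        using step_there by simp
      then show ?thesis
        using 2 by blast
    qed
  qed
qed auto

lemma length_step: "step \<alpha> \<beta> \<Longrightarrow> length \<beta> = length \<alpha>"
  by (induction rule: step.induct) auto

lemma card_grid: "card (grid qs) = prod_list qs"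
proof (induction qs)
  case (Cons q qs)
  have "grid (q # qs) = (\<lambda>(j, \<alpha>). j # \<alpha>) ` ({..<q} \<times> grid qs)"
    by auto
  moreover have "inj_on (\<lambda>(j, \<alpha>). j # \<alpha>) ({..<q} \<times> grid qs)"
    by (auto simp: inj_on_def)
  ultimately show ?case
    using Cons by (simp add: card_image card_cartesian_product)
qed simp

text \<open>The last clause says that \<open>\<tau> \<alpha>\<inverse> \<tau> \<alpha>'\<close>, where \<open>\<alpha>'\<close> raises one coordinate of \<open>\<alpha>\<close>, moves
  the coset labelled \<open>\<alpha>\<close> to the one labelled \<open>\<alpha>'\<close> and all smaller cosets below \<open>\<alpha>'\<close>; it is
  stated for the inverse element and the larger cosets.\<close>

definition labelling ::
  "('a, 'b) monoid_scheme \<Rightarrow> 'a set \<Rightarrow> 'a set \<Rightarrow> nat list \<Rightarrow> (nat list \<Rightarrow> 'a) \<Rightarrow> bool" where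
  "labelling G Y H qs \<tau> \<longleftrightarrow>
     (\<forall>\<alpha>\<in>grid qs. \<tau> \<alpha> \<in> Y) \<and>
     (\<forall>y\<in>Y. \<exists>\<alpha>\<in>grid qs. \<exists>h\<in>H. y = h \<otimes>\<^bsub>G\<^esub> \<tau> \<alpha>) \<and>
     (\<forall>\<alpha>\<in>grid qs. \<forall>\<beta>\<in>grid qs. \<forall>h\<in>H. \<tau> \<alpha> = h \<otimes>\<^bsub>G\<^esub> \<tau> \<beta> \<longrightarrow> \<alpha> = \<beta>) \<and>
     (\<forall>\<alpha>\<in>grid qs. \<forall>\<alpha>'\<in>grid qs. \<forall>\<beta>\<in>grid qs.
        step \<alpha> \<alpha>' \<longrightarrow> lex_index qs \<alpha>' < lex_index qs \<beta> \<longrightarrow>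
        (\<exists>\<delta>\<in>grid qs. \<exists>h\<in>H. lex_index qs \<alpha> < lex_index qs \<delta> \<and>
           \<tau> \<beta> \<otimes>\<^bsub>G\<^esub> inv\<^bsub>G\<^esub> (\<tau> \<alpha>') \<otimes>\<^bsub>G\<^esub> \<tau> \<alpha> = h \<otimes>\<^bsub>G\<^esub> \<tau> \<delta>))"

lemma labellingD:
  assumes "labelling G Y H qs \<tau>"
  shows "\<alpha> \<in> grid qs \<Longrightarrow> \<tau> \<alpha> \<in> Y"
    and "y \<in> Y \<Longrightarrow> \<exists>\<alpha>\<in>grid qs. \<exists>h\<in>H. y = h \<otimes>\<^bsub>G\<^esub> \<tau> \<alpha>"
    and "\<lbrakk>\<alpha> \<in> grid qs; \<beta> \<in> grid qs; h \<in> H; \<tau> \<alpha> = h \<otimes>\<^bsub>G\<^esub> \<tau> \<beta>\<rbrakk> \<Longrightarrow> \<alpha> = \<beta>"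
    and "\<lbrakk>\<alpha> \<in> grid qs; \<alpha>' \<in> grid qs; \<beta> \<in> grid qs; step \<alpha> \<alpha>'; lex_index qs \<alpha>' < lex_index qs \<beta>\<rbrakk> \<Longrightarrow>
      \<exists>\<delta>\<in>grid qs. \<exists>h\<in>H. lex_index qs \<alpha> < lex_index qs \<delta> \<and>
        \<tau> \<beta> \<otimes>\<^bsub>G\<^esub> inv\<^bsub>G\<^esub> (\<tau> \<alpha>') \<otimes>\<^bsub>G\<^esub> \<tau> \<alpha> = h \<otimes>\<^bsub>G\<^esub> \<tau> \<delta>"
  using assms unfolding labelling_def by (blast, blast, blast, blast)

section \<open>Construction of labellings along normal series\<close>

context group
begin

lemma card_labelling:
  assumes fin: "finite (carrier G)" and Y: "subgroup Y G" and H: "subgroup H G" and HY: "H \<subseteq> Y"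
    and lab: "labelling G Y H qs \<tau>"
  shows "card Y = card H * prod_list qs"
proof -
  note l = labellingD[OF lab]
  note Yc = subgroup.mem_carrier[OF Y] and Hc = subgroup.mem_carrier[OF H]
  have "bij_betw (\<lambda>(h, \<alpha>). h \<otimes> \<tau> \<alpha>) (H \<times> grid qs) Y"
    unfolding bij_betw_def
  proof
    show "inj_on (\<lambda>(h, \<alpha>). h \<otimes> \<tau> \<alpha>) (H \<times> grid qs)"
    proof (rule inj_onI, clarsimp)
      fix h \<alpha> h' \<beta> assume m: "h \<in> H" "\<alpha> \<in> grid qs" "h' \<in> H" "\<beta> \<in> grid qs"
        and eq: "h \<otimes> \<tau> \<alpha> = h' \<otimes> \<tau> \<beta>"
      have c: "h \<in> carrier G" "h' \<in> carrier G" "\<tau> \<alpha> \<in> carrier G" "\<tau> \<beta> \<in> carrier G"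
        using m l(1) Yc Hc by auto
      have "\<tau> \<alpha> = inv h \<otimes> (h \<otimes> \<tau> \<alpha>)"
        using c by (simp add: gsimps)
      also have "\<dots> = (inv h \<otimes> h') \<otimes> \<tau> \<beta>"
        unfolding eq using c by (simp add: gsimps)
      finally have "\<alpha> = \<beta>"
        using l(3) m subgroup.m_closed[OF H] subgroup.m_inv_closed[OF H] by metis
      then show "h = h' \<and> \<alpha> = \<beta>"
        using eq c by simp
    qed
    show "(\<lambda>(h, \<alpha>). h \<otimes> \<tau> \<alpha>) ` (H \<times> grid qs) = Y"
    proof (intro equalityI subsetI)
      fix y assume "y \<in> (\<lambda>(h, \<alpha>). h \<otimes> \<tau> \<alpha>) ` (H \<times> grid qs)"
      then obtain h \<alpha> where "y = h \<otimes> \<tau> \<alpha>" "h \<in> H" "\<alpha> \<in> grid qs"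
        by auto
      then show "y \<in> Y"
        using l(1) HY subgroup.m_closed[OF Y] by blast
    next
      fix y assume "y \<in> Y"
      from l(2)[OF this] obtain \<alpha> h where "y = h \<otimes> \<tau> \<alpha>" "h \<in> H" "\<alpha> \<in> grid qs"
        by blast
      then show "y \<in> (\<lambda>(h, \<alpha>). h \<otimes> \<tau> \<alpha>) ` (H \<times> grid qs)"
        by (intro image_eqI[of _ _ "(h, \<alpha>)"]) auto
    qed
  qed
  then have "card (H \<times> grid qs) = card Y"
    by (rule bij_betw_same_card)
  then show ?thesis
    by (simp add: card_cartesian_product card_grid)
qed

text \<open>Since \<open>L = H N\<close>, cosets of \<open>H\<close> in \<open>L\<close> correspond
  to cosets of \<open>H \<inter> N\<close> in \<open>N\<close>; they supply the less significant
  block. Normality of \<open>N\<close> in \<open>Y\<close> ensures that raising the lower block does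
  not disturb the upper one.\<close>

lemma labelling_append:
  assumes Y: "subgroup Y G" and L: "subgroup L G" and H: "subgroup H G" and N: "subgroup N G"
    and LY: "L \<subseteq> Y" and HL: "H \<subseteq> L" and NL: "N \<subseteq> L" and YN: "normalizes G Y N"
    and LHN: "\<And>l. l \<in> L \<Longrightarrow> \<exists>h\<in>H. \<exists>n\<in>N. l = h \<otimes> n"
    and \<tau>: "labelling G Y L qs \<tau>" and \<sigma>: "labelling G N (H \<inter> N) rs \<sigma>"
  shows "\<exists>\<rho>. labelling G Y H (qs @ rs) \<rho>"
proof -
  note t = labellingD[OF \<tau>] and s = labellingD[OF \<sigma>]
  note Yc = subgroup.mem_carrier[OF Y] and Hc = subgroup.mem_carrier[OF H]
    and Nc = subgroup.mem_carrier[OF N] and Lc = subgroup.mem_carrier[OF L]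
  have tY: "\<tau> \<alpha> \<in> Y" if "\<alpha> \<in> grid qs" for \<alpha>
    using t(1) that by blast
  have tc: "\<tau> \<alpha> \<in> carrier G" if "\<alpha> \<in> grid qs" for \<alpha>
    using Yc t(1) that by blast
  have sc: "\<sigma> \<alpha> \<in> carrier G" if "\<alpha> \<in> grid rs" for \<alpha>
    using Nc s(1) that by blast
  have Lsplit: "\<exists>\<gamma>\<in>grid rs. \<exists>h\<in>H. l = h \<otimes> \<sigma> \<gamma>" if l: "l \<in> L" for l
  proof -
    obtain h n where hn: "l = h \<otimes> n" "h \<in> H" "n \<in> N"
      using LHN[OF l] by blast
    obtain \<gamma> k where g: "\<gamma> \<in> grid rs" "k \<in> H" "n = k \<otimes> \<sigma> \<gamma>"
      using s(2)[OF hn(3)] by blast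
    have "l = (h \<otimes> k) \<otimes> \<sigma> \<gamma>"
      using hn g Hc sc by (simp add: gsimps)
    then show ?thesis
      using g subgroup.m_closed[OF H hn(2) g(2)] by blast
  qed
  \<comment> \<open>An element of \<open>Y\<close> is first written as
    \<open>l \<otimes> \<tau> \<alpha>\<close> with \<open>l \<in> L\<close>, and then
    \<open>l\<close> is split by \<open>\<sigma>\<close>; this puts the lower block on the
    left.\<close>
  define \<rho> where "\<rho> x = \<sigma> (drop (length qs) x) \<otimes> \<tau> (take (length qs) x)" for x
  have rho: "\<rho> (\<alpha> @ \<gamma>) = \<sigma> \<gamma> \<otimes> \<tau> \<alpha>" if "\<alpha> \<in> grid qs" for \<alpha> \<gamma>
    using length_grid[OF that] by (simp add: \<rho>_def)
  let ?P = "{\<alpha> @ \<gamma> | \<alpha> \<gamma>. \<alpha> \<in> grid qs \<and> \<gamma> \<in> grid rs}"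
  have "labelling G Y H (qs @ rs) \<rho>"
    unfolding labelling_def grid_append
  proof (intro conjI ballI impI)
    fix x assume "x \<in> ?P"
    then obtain \<alpha> \<gamma> where x: "x = \<alpha> @ \<gamma>" "\<alpha> \<in> grid qs" "\<gamma> \<in> grid rs"
      by blast
    have "\<sigma> \<gamma> \<in> Y"
      using s(1)[OF x(3)] NL LY by blast
    then show "\<rho> x \<in> Y"
      unfolding x(1) rho[OF x(2)] by (rule subgroup.m_closed[OF Y _ t(1)[OF x(2)]])
  next
    fix y assume "y \<in> Y"
    then obtain \<alpha> l where l: "\<alpha> \<in> grid qs" "l \<in> L" "y = l \<otimes> \<tau> \<alpha>"
      using t(2) by blast
    obtain \<gamma> h where g: "\<gamma> \<in> grid rs" "h \<in> H" "l = h \<otimes> \<sigma> \<gamma>"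
      using Lsplit[OF l(2)] by blast
    have "y = h \<otimes> \<rho> (\<alpha> @ \<gamma>)"
      using l g Hc sc tc by (simp add: rho gsimps)
    then show "\<exists>x\<in>?P. \<exists>h\<in>H. y = h \<otimes> \<rho> x"
      using l(1) g(1,2) by blast
  next
    fix x x' h
    assume "x \<in> ?P" "x' \<in> ?P"
      and h: "h \<in> H" and eq: "\<rho> x = h \<otimes> \<rho> x'"
    then obtain \<alpha> \<gamma> \<alpha>' \<gamma>' where x: "x = \<alpha> @ \<gamma>" "\<alpha> \<in> grid qs" "\<gamma> \<in> grid rs"
      and x': "x' = \<alpha>' @ \<gamma>'" "\<alpha>' \<in> grid qs" "\<gamma>' \<in> grid rs"
      by blast
    have c: "\<sigma> \<gamma> \<in> carrier G" "\<sigma> \<gamma>' \<in> carrier G" "\<tau> \<alpha> \<in> carrier G" "\<tau> \<alpha>' \<in> carrier G" "h \<in> carrier G"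
      using x x' sc tc Hc h by auto
    have eq': "\<sigma> \<gamma> \<otimes> \<tau> \<alpha> = h \<otimes> (\<sigma> \<gamma>' \<otimes> \<tau> \<alpha>')"
      using eq x x' rho by simp
    have "\<tau> \<alpha> = inv (\<sigma> \<gamma>) \<otimes> (\<sigma> \<gamma> \<otimes> \<tau> \<alpha>)"
      using c by (simp add: gsimps)
    also have "\<dots> = (inv (\<sigma> \<gamma>) \<otimes> h \<otimes> \<sigma> \<gamma>') \<otimes> \<tau> \<alpha>'"
      unfolding eq' using c by (simp add: gsimps)
    finally have 1: "\<tau> \<alpha> = (inv (\<sigma> \<gamma>) \<otimes> h \<otimes> \<sigma> \<gamma>') \<otimes> \<tau> \<alpha>'" .
    have "\<sigma> \<gamma> \<in> L" "\<sigma> \<gamma>' \<in> L" "h \<in> L"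
      using s(1) x x' h NL HL by auto
    then have "inv (\<sigma> \<gamma>) \<otimes> h \<otimes> \<sigma> \<gamma>' \<in> L"
      by (intro subgroup.m_closed[OF L] subgroup.m_inv_closed[OF L])
    then have aa: "\<alpha> = \<alpha>'"
      using t(3)[OF x(2) x'(2) _ 1] by blast
    then have "(\<sigma> \<gamma> \<otimes> \<tau> \<alpha>) \<otimes> inv (\<tau> \<alpha>) = (h \<otimes> (\<sigma> \<gamma>' \<otimes> \<tau> \<alpha>)) \<otimes> inv (\<tau> \<alpha>)"
      using eq' by simp
    then have sg: "\<sigma> \<gamma> = h \<otimes> \<sigma> \<gamma>'"
      using c by (simp add: gsimps)
    then have "h = \<sigma> \<gamma> \<otimes> inv (\<sigma> \<gamma>')"
      using c by (simp add: gsimps)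
    then have "h \<in> N"
      using s(1) x x' subgroup.m_closed[OF N] subgroup.m_inv_closed[OF N] by metis
    then have "\<gamma> = \<gamma>'"
      using s(3)[OF x(3) x'(3) _ sg] h by blast
    then show "x = x'"
      using aa x x' by simp
  next
    fix x x' z
    assume "x \<in> ?P" "z \<in> ?P"
      and x'_mem: "x' \<in> ?P"
      and st: "step x x'" and less: "lex_index (qs @ rs) x' < lex_index (qs @ rs) z"
    then obtain \<alpha> \<gamma> \<beta> \<delta> where x: "x = \<alpha> @ \<gamma>" "\<alpha> \<in> grid qs" "\<gamma> \<in> grid rs"
      and z: "z = \<beta> @ \<delta>" "\<beta> \<in> grid qs" "\<delta> \<in> grid rs"
      by blast
    obtain \<alpha>' \<gamma>' where x': "x' = \<alpha>' @ \<gamma>'" "\<alpha>' \<in> grid qs" "\<gamma>' \<in> grid rs"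
      using x'_mem by blast
    have c: "\<sigma> \<gamma> \<in> carrier G" "\<sigma> \<gamma>' \<in> carrier G" "\<sigma> \<delta> \<in> carrier G"
      "\<tau> \<alpha> \<in> carrier G" "\<tau> \<alpha>' \<in> carrier G" "\<tau> \<beta> \<in> carrier G"
      using x x' z sc tc by auto
    have less': "lex_index qs \<alpha>' < lex_index qs \<beta> \<or> \<alpha>' = \<beta> \<and> lex_index rs \<gamma>' < lex_index rs \<delta>"
      using less lex_index_append_less_iff[OF x'(2) z(2) x'(3) z(3)] x' z by simp
    let ?w = "\<rho> z \<otimes> inv (\<rho> x') \<otimes> \<rho> x"
    have w: "?w = \<sigma> \<delta> \<otimes> \<tau> \<beta> \<otimes> inv (\<tau> \<alpha>') \<otimes> inv (\<sigma> \<gamma>') \<otimes> \<sigma> \<gamma> \<otimes> \<tau> \<alpha>"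
      using c by (simp add: x x' z rho gsimps)
    have goal: "\<exists>y\<in>?P. \<exists>h\<in>H.
          lex_index (qs @ rs) x < lex_index (qs @ rs) y \<and> ?w = h \<otimes> \<rho> y"
      if "?w = l \<otimes> \<tau> \<epsilon>" "l = h \<otimes> \<sigma> \<eta>" "h \<in> H" "\<epsilon> \<in> grid qs" "\<eta> \<in> grid rs"
        "lex_index qs \<alpha> < lex_index qs \<epsilon> \<or> \<alpha> = \<epsilon> \<and> lex_index rs \<gamma> < lex_index rs \<eta>"
      for l h \<epsilon> \<eta>
    proof (intro bexI conjI)
      show "lex_index (qs @ rs) x < lex_index (qs @ rs) (\<epsilon> @ \<eta>)"
        unfolding x(1) lex_index_append_less_iff[OF x(2) that(4) x(3) that(5)] by (rule that(6))
      show "?w = h \<otimes> \<rho> (\<epsilon> @ \<eta>)"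
        unfolding that(1,2) rho[OF that(4)] using that(3-5) Hc sc tc by (simp add: gsimps)
    qed (use that in auto)
    have "length \<alpha>' = length \<alpha>"
      using length_grid x x' by metis
    then consider (A) "\<gamma>' = \<gamma>" "step \<alpha> \<alpha>'" | (B) "\<alpha>' = \<alpha>" "step \<gamma> \<gamma>'"
      using step_append[OF st[unfolded x(1)]] length_step unfolding x'(1) by (metis append_eq_append_conv)
    then show "\<exists>y\<in>?P. \<exists>h\<in>H.
          lex_index (qs @ rs) x < lex_index (qs @ rs) y \<and> ?w = h \<otimes> \<rho> y"
    proof cases
      case A
      show ?thesis
      proof (cases "lex_index qs \<alpha>' < lex_index qs \<beta>")
        case True
        obtain \<epsilon> l where e: "\<epsilon> \<in> grid qs" "l \<in> L" "lex_index qs \<alpha> < lex_index qs \<epsilon>"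
          "\<tau> \<beta> \<otimes> inv (\<tau> \<alpha>') \<otimes> \<tau> \<alpha> = l \<otimes> \<tau> \<epsilon>"
          using t(4)[OF x(2) x'(2) z(2) A(2) True] by blast
        have "\<sigma> \<delta> \<otimes> l \<in> L"
          using s(1)[OF z(3)] NL e(2) subgroup.m_closed[OF L] by blast
        then obtain \<eta> h where h: "\<eta> \<in> grid rs" "h \<in> H" "\<sigma> \<delta> \<otimes> l = h \<otimes> \<sigma> \<eta>"
          using Lsplit by blast
        have "?w = \<sigma> \<delta> \<otimes> (\<tau> \<beta> \<otimes> inv (\<tau> \<alpha>') \<otimes> \<tau> \<alpha>)"
          unfolding w A(1) using c by (simp add: gsimps)
        also have "\<dots> = (\<sigma> \<delta> \<otimes> l) \<otimes> \<tau> \<epsilon>"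
          unfolding e(4) using c e Lc tc by (simp add: gsimps)
        finally show ?thesis
          using goal[OF _ h(3,2) e(1) h(1)] e(3) by blast
      next
        case False
        then have b: "\<alpha>' = \<beta>" "lex_index rs \<gamma>' < lex_index rs \<delta>"
          using less' by auto
        \<comment> \<open>The upper block falls back to \<open>\<alpha>\<close> exactly, so the
          lower block decides, and there \<open>\<delta>\<close> exceeds
          \<open>\<gamma>\<close>.\<close>
        have "?w = \<sigma> \<delta> \<otimes> \<tau> \<alpha>"
          unfolding w A(1) b(1)[symmetric] using c by (simp add: gsimps)
        moreover have "\<sigma> \<delta> = \<one> \<otimes> \<sigma> \<delta>"
          using c by simp
        ultimately show ?thesis
          using goal[OF _ _ subgroup.one_closed[OF H] x(2) z(3)] b A(1) by blast
      qed
    next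
      case B
      show ?thesis
      proof (cases "lex_index qs \<alpha>' < lex_index qs \<beta>")
        case True
        \<comment> \<open>Conjugation by \<open>?m\<close> carries the change in the lower block to
          another element of \<open>N\<close>. So the coset of \<open>L\<close> labelled
          \<open>\<beta>\<close> is not left, and \<open>\<beta>\<close> already exceeds
          \<open>\<alpha>\<close>.\<close>
        let ?m = "\<tau> \<beta> \<otimes> inv (\<tau> \<alpha>)" and ?n = "inv (\<sigma> \<gamma>') \<otimes> \<sigma> \<gamma>"
        have "?n \<in> N"
          using s(1) x x' subgroup.m_closed[OF N] subgroup.m_inv_closed[OF N] by blast
        moreover have "?m \<in> Y"
          using tY x z subgroup.m_closed[OF Y] subgroup.m_inv_closed[OF Y] by blast
        ultimately have "?m \<otimes> ?n \<otimes> inv ?m \<in> N"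
          using normalizesD[OF YN] by blast
        then have "\<sigma> \<delta> \<otimes> (?m \<otimes> ?n \<otimes> inv ?m) \<in> L"
          using s(1)[OF z(3)] NL subgroup.m_closed[OF L] by blast
        then obtain \<eta> h where h: "\<eta> \<in> grid rs" "h \<in> H" "\<sigma> \<delta> \<otimes> (?m \<otimes> ?n \<otimes> inv ?m) = h \<otimes> \<sigma> \<eta>"
          using Lsplit by blast
        have "?w = (\<sigma> \<delta> \<otimes> (?m \<otimes> ?n \<otimes> inv ?m)) \<otimes> \<tau> \<beta>"
          unfolding w B(1) using c by (simp add: gsimps)
        then show ?thesis
          using goal[OF _ h(3,2) z(2) h(1)] True B(1) by blast
      next
        case False
        then have b: "\<alpha>' = \<beta>" "lex_index rs \<gamma>' < lex_index rs \<delta>"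
          using less' by auto
        obtain \<eta> h where e: "\<eta> \<in> grid rs" "h \<in> H" "lex_index rs \<gamma> < lex_index rs \<eta>"
          "\<sigma> \<delta> \<otimes> inv (\<sigma> \<gamma>') \<otimes> \<sigma> \<gamma> = h \<otimes> \<sigma> \<eta>"
          using s(4)[OF x(3) x'(3) z(3) B(2) b(2)] by blast
        have "?w = (\<sigma> \<delta> \<otimes> inv (\<sigma> \<gamma>') \<otimes> \<sigma> \<gamma>) \<otimes> \<tau> \<alpha>"
          unfolding w b(1)[symmetric] B(1) using c by (simp add: gsimps)
        then show ?thesis
          using goal[OF _ e(4,2) x(2) e(1)] e(3) by blast
      qed
    qed
  qed
  then show ?thesis
    by blast
qed

text \<open>Raising \<open>i\<close> to \<open>Suc i\<close> is multiplication by \<open>y\<close>.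
  The inverse lowers an exponent \<open>j > Suc i\<close> to \<open>j - 1\<close>, which still
  exceeds \<open>i\<close>, so nothing wraps around.\<close>

lemma labelling_prime:
  assumes L: "subgroup L G" and H: "subgroup H G" and y: "y \<in> L" "y [^] q \<in> H"
    and min: "\<And>j. 0 < j \<Longrightarrow> j < q \<Longrightarrow> y [^] j \<notin> H"
    and LH: "\<And>l. l \<in> L \<Longrightarrow> \<exists>h\<in>H. \<exists>j::nat. l = h \<otimes> y [^] j" and q: "q > (0::nat)"
  shows "labelling G L H [q] (\<lambda>\<alpha>. y [^] hd \<alpha>)"
proof -
  have yc: "y \<in> carrier G"
    using y subgroup.mem_carrier[OF L] by blast
  note pow = pow_mem[OF L y(1)]
  have powH: "y [^] (q * i) \<in> H" for i :: nat
  proof (induction i)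
    case (Suc i)
    then show ?case
      using subgroup.m_closed[OF H y(2) Suc] yc by (simp add: nat_pow_mult)
  qed (use subgroup.one_closed[OF H] in simp)
  have grid: "grid [q] = {[j] | j. j < q}"
    by auto
  have cancel: "i = j" if ij: "i < q" "j < q" "h \<in> H" "y [^] i = h \<otimes> y [^] j" for i j h
  proof -
    have hc: "h \<in> carrier G"
      using ij subgroup.mem_carrier[OF H] by blast
    consider "i = j" | "j < i" | "i < j"
      by linarith
    then show ?thesis
    proof cases
      case 2
      then have "y [^] (i - j) \<otimes> y [^] j = h \<otimes> y [^] j"
        using ij(4) yc by (simp add: nat_pow_mult)
      then have "y [^] (i - j) = h"
        using yc hc by simp
      then show ?thesis
        using min[of "i - j"] 2 ij less_imp_diff_less[of i q j] by auto
    next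
      case 3
      then have "y [^] j = y [^] (j - i) \<otimes> y [^] i"
        using yc by (simp add: nat_pow_mult)
      then have "h \<otimes> (y [^] (j - i) \<otimes> y [^] i) = \<one> \<otimes> y [^] i"
        using ij(4) yc by (metis l_one nat_pow_closed)
      then have "h \<otimes> y [^] (j - i) = \<one>"
        using yc hc by (simp add: m_assoc[symmetric] del: l_one)
      then have "y [^] (j - i) = inv h"
        using yc hc by (metis inv_solve_left' nat_pow_closed r_one inv_closed one_closed)
      then show ?thesis
        using min[of "j - i"] 3 ij subgroup.m_inv_closed[OF H ij(3)] less_imp_diff_less[of j q i] by auto
    qed
  qed
  show ?thesis
    unfolding labelling_def grid
  proof (intro conjI ballI impI)
    fix l assume "l \<in> L"
    then obtain h j where l: "h \<in> H" "l = h \<otimes> y [^] (j::nat)"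
      using LH by blast
    have "y [^] j = y [^] (q * (j div q)) \<otimes> y [^] (j mod q)"
      using yc by (simp add: nat_pow_mult)
    then have "l = (h \<otimes> y [^] (q * (j div q))) \<otimes> y [^] hd [j mod q]"
      using l yc subgroup.mem_carrier[OF H] by (simp add: gsimps)
    moreover have "h \<otimes> y [^] (q * (j div q)) \<in> H"
      by (rule subgroup.m_closed[OF H l(1) powH])
    moreover have "[j mod q] \<in> {[j] | j. j < q}"
      using q by simp
    ultimately show "\<exists>\<alpha>\<in>{[j] | j. j < q}. \<exists>h\<in>H. l = h \<otimes> y [^] hd \<alpha>"
      by blast
  next
    fix \<alpha> \<alpha>' \<beta>
    assume "\<alpha> \<in> {[j] | j. j < q}" "\<alpha>' \<in> {[j] | j. j < q}" "\<beta> \<in> {[j] | j. j < q}" and st: "step \<alpha> \<alpha>'"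
      and less: "lex_index [q] \<alpha>' < lex_index [q] \<beta>"
    then obtain i i' j where ij: "\<alpha> = [i]" "\<alpha>' = [i']" "\<beta> = [j]" "j < q"
      by blast
    have i': "i' = Suc i"
      using st unfolding ij by (auto elim: step.cases)
    then have j: "Suc i < j"
      using less ij by simp
    have e: "y [^] j \<otimes> inv (y [^] Suc i) = y [^] (j - Suc i)"
    proof -
      have "y [^] j = y [^] (j - Suc i) \<otimes> y [^] Suc i"
        using nat_pow_mult[OF yc, of "j - Suc i" "Suc i"] j by (metis le_add_diff_inverse2 less_imp_le)
      moreover have "a \<otimes> b \<otimes> inv b = a" if "a \<in> carrier G" "b \<in> carrier G" for a b
        using that by (simp add: gsimps)
      ultimately show ?thesis
        using yc by (metis nat_pow_closed)
    qed
    have "y [^] hd \<beta> \<otimes> inv (y [^] hd \<alpha>') \<otimes> y [^] hd \<alpha> = y [^] (j - 1)"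
    proof -
      have "y [^] (j - Suc i) \<otimes> y [^] i = y [^] (j - 1)"
        using nat_pow_mult[OF yc, of "j - Suc i" i] j by simp
      then show ?thesis
        by (simp only: ij i' e list.sel)
    qed
    then have "y [^] hd \<beta> \<otimes> inv (y [^] hd \<alpha>') \<otimes> y [^] hd \<alpha> = \<one> \<otimes> y [^] hd [j - 1]"
      using yc by simp
    moreover have "lex_index [q] \<alpha> < lex_index [q] [j - 1]"
      using j ij by simp
    moreover have "[j - 1] \<in> {[j] | j. j < q}"
      using ij by auto
    ultimately show "\<exists>\<delta>\<in>{[j] | j. j < q}. \<exists>h\<in>H. lex_index [q] \<alpha> < lex_index [q] \<delta> \<and>
        y [^] hd \<beta> \<otimes> inv (y [^] hd \<alpha>') \<otimes> y [^] hd \<alpha> = h \<otimes> y [^] hd \<delta>"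
      using subgroup.one_closed[OF H] by blast
  qed (use pow cancel in auto)
qed

lemma labelling_self:
  assumes "subgroup H G"
  shows "labelling G H H [] (\<lambda>_. \<one>)"
  using subgroup.one_closed[OF assms] subgroup.mem_carrier[OF assms]
  by (auto simp: labelling_def)

text \<open>Modulo \<open>H\<close> the group is abelian, so every intermediate subgroup is normal
  and chains of prime length can be split off one at a time, from below.\<close>

lemma labelling_abelian:
  assumes fin: "finite (carrier G)" and N: "subgroup N G" and H: "subgroup H G" "H \<subseteq> N" "derived G N \<subseteq> H"
  shows "\<exists>qs \<tau>. (\<forall>q\<in>set qs. prime q) \<and> labelling G N H qs \<tau>"
  using H
proof (induction "card N - card H" arbitrary: H rule: less_induct)
  case less
  note H = less.prems
  note Nc = subgroup.mem_carrier[OF N]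
  have finN: "finite N"
    by (rule finite_subset_carrier[OF fin N])
  show ?case
  proof (cases "H = N")
    case True
    then show ?thesis
      using labelling_self[OF N] by (metis empty_iff empty_set)
  next
    case False
    then obtain x where x: "x \<in> N" "x \<notin> H"
      using H(2) by blast
    have xc: "x \<in> carrier G"
      using x Nc by blast
    define P where "P m \<longleftrightarrow> 0 < m \<and> x [^] m \<in> H" for m :: nat
    have "P (order G)"
      using pow_order_eq_1[OF xc] subgroup.one_closed[OF H(1)] fin order_gt_0_iff_finite by (simp add: P_def)
    define m where "m = (LEAST m. P m)"
    have m: "0 < m" "x [^] m \<in> H"
      using LeastI[of P, OF \<open>P (order G)\<close>] by (auto simp: P_def m_def)
    have m_min: "x [^] k \<notin> H" if "0 < k" "k < m" for k
      using not_less_Least[of k P] that by (auto simp: P_def m_def)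
    have "m \<noteq> 1"
      using x m xc by (auto simp: nat_pow_eone)
    then obtain q where q: "prime q" "q dvd m"
      using prime_factor_nat by blast
    then obtain d where d: "m = d * q"
      by (metis dvd_def mult.commute)
    have q0: "q > 1"
      using q prime_gt_1_nat by blast
    \<comment> \<open>As \<open>m\<close> is the order of \<open>x\<close> modulo \<open>H\<close>,
      this power has prime order \<open>q\<close> modulo \<open>H\<close>.\<close>
    define y where "y = x [^] d"
    have y: "y \<in> N" "y \<in> carrier G"
      using pow_mem[OF N x(1)] xc by (auto simp: y_def)
    have ypow: "y [^] j = x [^] (d * j)" for j :: nat
      using xc by (simp add: y_def nat_pow_pow)
    have yq: "y [^] q \<in> H"
      using m(2) by (simp add: ypow d)
    have ymin: "y [^] j \<notin> H" if "0 < j" "j < q" for j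
      unfolding ypow using m_min[of "d * j"] that m(1) d by simp
    have NH: "normalizes G N H"
      by (rule normalizes_of_derived[OF N H])
    define L where "L = adjoin_power H y"
    note L = adjoin_power[OF fin N H(1) NH H(2) y(1), folded L_def]
    have "H \<subset> L"
      using L(3,4) ymin[of 1] q0 y by (auto simp: nat_pow_eone)
    then have "card H < card L"
      using L(2) finN by (intro psubset_card_mono) (auto intro: finite_subset)
    moreover have "card L \<le> card N"
      using L(2) finN by (rule card_mono[rotated])
    ultimately have lt: "card N - card L < card N - card H"
      by simp
    have dL: "derived G N \<subseteq> L"
      using H(3) L(3) by blast
    obtain qs \<tau> where qs: "\<forall>q\<in>set qs. prime q" "labelling G N L qs \<tau>"
      using less.hyps[OF lt L(1,2) dL] by blast
    have "labelling G L H [q] (\<lambda>\<alpha>. y [^] hd \<alpha>)"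
    proof (rule labelling_prime[OF L(1) H(1) L(4) yq ymin])
      show "\<exists>h\<in>H. \<exists>j::nat. l = h \<otimes> y [^] j" if "l \<in> L" for l
        using that unfolding L_def adjoin_power_def by blast
    qed (use q0 in auto)
    \<comment> \<open>The normal subgroup in \<open>labelling_append\<close> is \<open>L\<close>
      itself, so the intersection with \<open>H\<close> is just \<open>H\<close>.\<close>
    then have lab: "labelling G L (H \<inter> L) [q] (\<lambda>\<alpha>. y [^] hd \<alpha>)"
      using L(3) by (simp add: Int_absorb2)
    have "\<exists>\<rho>. labelling G N H (qs @ [q]) \<rho>"
    proof (rule labelling_append[OF N L(1) H(1) L(1,2,3) order_refl _ _ qs(2) lab])
      show "normalizes G N L"
        by (rule normalizes_of_derived[OF N L(1,2) dL])
      show "\<exists>h\<in>H. \<exists>n\<in>L. l = h \<otimes> n" if "l \<in> L" for l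
        using that subgroup.one_closed[OF H(1)] subgroup.mem_carrier[OF L(1) that]
        by (intro bexI[of _ \<one>] bexI[of _ l]) auto
    qed
    then obtain \<rho> where "labelling G N H (qs @ [q]) \<rho>"
      by blast
    moreover have "\<forall>q\<in>set (qs @ [q]). prime q"
      using qs(1) q(1) by simp
    ultimately show ?thesis
      by blast
  qed
qed

lemma normalizes_derived_series:
  assumes Y: "subgroup Y G"
  shows "subgroup ((derived G ^^ n) Y) G \<and> (derived G ^^ n) Y \<subseteq> Y \<and> normalizes G Y ((derived G ^^ n) Y)"
proof (induction n)
  case 0
  show ?case
    using Y subgroup.m_closed[OF Y] subgroup.m_inv_closed[OF Y] by (auto simp: normalizes_def)
next
  case (Suc n)
  let ?D = "(derived G ^^ n) Y"
  have D: "subgroup ?D G" "?D \<subseteq> Y" "normalizes G Y ?D"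
    using Suc by auto
  note Yc = subgroup.mem_carrier[OF Y]
  have sub: "derived G ?D \<subseteq> ?D"
    by (rule derived_incl[OF order_refl D(1)])
  have S: "subgroup (derived G ?D) G"
    by (rule derived_is_subgroup[OF subgroup.subset[OF D(1)]])
  have "normalizes G Y (derived G ?D)"
    unfolding normalizes_def
  proof (intro ballI)
    fix y n assume y: "y \<in> Y" and n: "n \<in> derived G ?D"
    have yc: "y \<in> carrier G"
      using Yc y by blast
    let ?U = "{n \<in> carrier G. y \<otimes> n \<otimes> inv y \<in> derived G ?D}"
    have U: "?U = conj_inter (derived G ?D) y (carrier G)"
      by (auto simp: conj_inter_def)
    have "derived G ?D \<subseteq> ?U"
      unfolding derived_subset_iff[OF subgroup_conj_inter[OF S subgroup_self yc, folded U]]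
    proof (intro ballI)
      fix a b assume ab: "a \<in> ?D" "b \<in> ?D"
      have c: "a \<in> carrier G" "b \<in> carrier G"
        using ab D(2) Yc by auto
      have "y \<otimes> (a \<otimes> b \<otimes> inv a \<otimes> inv b) \<otimes> inv y = (y \<otimes> a \<otimes> inv y) \<otimes> (y \<otimes> b \<otimes> inv y) \<otimes>
          inv (y \<otimes> a \<otimes> inv y) \<otimes> inv (y \<otimes> b \<otimes> inv y)"
        using c yc by (simp add: gsimps)
      also have "\<dots> \<in> derived G ?D"
        by (intro derived_commutator normalizesD[OF D(3) y] ab)
      finally show "a \<otimes> b \<otimes> inv a \<otimes> inv b \<in> ?U"
        using c by simp
    qed
    then show "y \<otimes> n \<otimes> inv y \<in> derived G ?D"
      using n by blast
  qed
  then show ?case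
    using S sub D(2) by auto
qed

text \<open>With \<open>N\<close> the term before the one contained in \<open>H\<close>, the product
  \<open>L = H N\<close> contains a term one step earlier, so induction labels \<open>Y\<close> over
  \<open>L\<close>. The remaining part reduces to \<open>N\<close> over \<open>H \<inter> N\<close>,
  where the quotient is abelian.\<close>

lemma labelling_solvable:
  assumes fin: "finite (carrier G)" and Y: "subgroup Y G" and H: "subgroup H G" "H \<subseteq> Y" "(derived G ^^ n) Y \<subseteq> H"
  shows "\<exists>qs \<tau>. (\<forall>q\<in>set qs. prime q) \<and> labelling G Y H qs \<tau>"
  using H
proof (induction n arbitrary: H)
  case 0
  then have "H = Y"
    by simp
  then show ?case
    using labelling_self[OF Y] by (metis empty_iff empty_set)
next
  case (Suc n)
  note H = Suc.prems
  let ?N = "(derived G ^^ n) Y"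
  have N: "subgroup ?N G" "?N \<subseteq> Y" "normalizes G Y ?N"
    using normalizes_derived_series[OF Y] by auto
  have HN: "normalizes G H ?N"
    using N(3) H(2) by (auto simp: normalizes_def)
  define L where "L = H <#> ?N"
  have L: "subgroup L G"
    unfolding L_def by (rule normalizes_set_mult[OF H(1) N(1) HN fin])
  have LY: "L \<subseteq> Y"
    using H(2) N(2) subgroup.m_closed[OF Y] by (auto simp: L_def set_mult_def)
  have HL: "H \<subseteq> L" and NL: "?N \<subseteq> L"
    unfolding L_def using set_mult_mono_left[OF H(1) N(1)] set_mult_mono_right[OF H(1) N(1)] by auto
  obtain qs \<tau> where qs: "\<forall>q\<in>set qs. prime q" "labelling G Y L qs \<tau>"
    using Suc.IH[OF L LY NL] by blast
  have I: "subgroup (H \<inter> ?N) G"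
    by (rule subgroups_Inter_pair[OF H(1) N(1)])
  have dN: "derived G ?N \<subseteq> H \<inter> ?N"
    using H(3) derived_incl[OF order_refl N(1)] by simp
  obtain rs \<sigma> where rs: "\<forall>q\<in>set rs. prime q" "labelling G ?N (H \<inter> ?N) rs \<sigma>"
    using labelling_abelian[OF fin N(1) I Int_lower2 dN] by blast
  have "\<exists>\<rho>. labelling G Y H (qs @ rs) \<rho>"
    by (rule labelling_append[OF Y L H(1) N(1) LY HL NL N(3) _ qs(2) rs(2)])
      (auto simp: L_def set_mult_def)
  then show ?case
    using qs(1) rs(1) by (metis Un_iff set_append)
qed

end

section \<open>Hall subgroups of soluble quotients\<close>

lemma prime_power_of_prime_divisors:
  fixes c p :: nat
  assumes "c > 0" "prime p" "\<And>q. prime q \<Longrightarrow> q dvd c \<Longrightarrow> q = p"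
  shows "\<exists>k. c = p ^ k"
proof -
  obtain m where m: "c = p ^ multiplicity p c * m" "\<not> p dvd m"
    using multiplicity_decompose'[of c p] assms(1) not_prime_unit[of p] assms(2) by blast
  have "m = 1"
  proof (rule ccontr)
    assume "m \<noteq> 1"
    then obtain q where "prime q" "q dvd m"
      using prime_factor_nat by blast
    then show False
      using assms(3)[of q] m by (metis dvd_mult)
  qed
  then show ?thesis
    using m by auto
qed

context group
begin

lemma subgroup_conj_image:
  assumes A: "subgroup A G" and y: "y \<in> carrier G"
  shows "subgroup ((\<lambda>x. y \<otimes> x \<otimes> inv y) ` A) G" and "card ((\<lambda>x. y \<otimes> x \<otimes> inv y) ` A) = card A"
proof -
  note Ac = subgroup.mem_carrier[OF A]
  have "(\<lambda>x. y \<otimes> x \<otimes> inv y) ` A = conj_inter A (inv y) (carrier G)"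
  proof (intro equalityI subsetI)
    fix z assume "z \<in> (\<lambda>x. y \<otimes> x \<otimes> inv y) ` A"
    then obtain x where x: "x \<in> A" "z = y \<otimes> x \<otimes> inv y"
      by blast
    then have "inv y \<otimes> z \<otimes> inv (inv y) = x"
      using Ac y by (simp add: gsimps)
    then show "z \<in> conj_inter A (inv y) (carrier G)"
      using x Ac y by (simp add: conj_inter_def)
  next
    fix z assume z: "z \<in> conj_inter A (inv y) (carrier G)"
    then have "z = y \<otimes> (inv y \<otimes> z \<otimes> inv (inv y)) \<otimes> inv y"
      using y by (simp add: conj_inter_def gsimps)
    then show "z \<in> (\<lambda>x. y \<otimes> x \<otimes> inv y) ` A"
      using z unfolding conj_inter_def by blast
  qed
  then show "subgroup ((\<lambda>x. y \<otimes> x \<otimes> inv y) ` A) G"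
    using subgroup_conj_inter[OF A subgroup_self] y by simp
  show "card ((\<lambda>x. y \<otimes> x \<otimes> inv y) ` A) = card A"
  proof (rule card_image, rule inj_onI)
    fix a b assume "a \<in> A" "b \<in> A" "y \<otimes> a \<otimes> inv y = y \<otimes> b \<otimes> inv y"
    then show "a = b"
      using Ac y by (simp add: gsimps)
  qed
qed

lemma sylow_of_intermediate:
  assumes fin: "finite (carrier G)" and Q: "subgroup Q G" "Q \<subseteq> D" "card C = card Q * m" "\<not> q dvd m"
    and D: "subgroup D G" and C: "subgroup C G" "D \<subseteq> C"
  obtains m' where "card D = card Q * m'" "\<not> q dvd m'"
proof -
  obtain m' where m': "card D = card Q * m'"
    using card_subgroup_dvd[OF fin Q(1) D Q(2)] by blast
  have "card Q * m' dvd card Q * m"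
    using card_subgroup_dvd[OF fin D C] m' Q(3) by simp
  then have "m' dvd m"
    using card_subgroup_pos[OF fin Q(1)] by simp
  then show ?thesis
    using that[OF m'] Q(4) dvd_trans by blast
qed

lemma sylow_subgroup_full:
  assumes fin: "finite (carrier G)" and C: "subgroup C G" and q: "prime q"
  obtains Q k m where "subgroup Q G" "Q \<subseteq> C" "card Q = q ^ k" "card C = card Q * m" "\<not> q dvd m"
proof -
  have "card C \<noteq> 0"
    using card_subgroup_pos[OF fin C] by simp
  moreover have "\<not> is_unit q"
    using q by (metis not_prime_unit)
  ultimately obtain m where m: "card C = q ^ multiplicity q (card C) * m" "\<not> q dvd m"
    using multiplicity_decompose'[of "card C" q] by auto
  obtain Q where Q: "subgroup Q G" "Q \<subseteq> C" "card Q = q ^ multiplicity q (card C)"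
    using sylow_subgroup[OF fin C q multiplicity_dvd] by blast
  show ?thesis
    by (rule that[OF Q, of m]) (use m Q in auto)
qed

text \<open>The invariant of an induction along a normal series from \<open>K\<close> to \<open>S\<close>: \<open>R\<close> covers the
  \<open>p'\<close>-part of \<open>N/K\<close> and is normal in a supplement \<open>Y\<close> of \<open>N\<close>. When \<open>N\<close> is enlarged, \<open>Y\<close>
  shrinks to a normaliser by the Frattini argument.\<close>

definition hall_pair :: "'a set \<Rightarrow> 'a set \<Rightarrow> nat \<Rightarrow> 'a set \<Rightarrow> 'a set \<Rightarrow> 'a set \<Rightarrow> bool" where
  "hall_pair S K p N Y R \<longleftrightarrow>
     subgroup N G \<and> K \<subseteq> N \<and> N \<subseteq> S \<and> normalizes G S N \<and>
     subgroup Y G \<and> Y \<subseteq> S \<and> subgroup R G \<and> R \<subseteq> Y \<and> R \<subseteq> N \<and> normalizes G Y R \<and> \<not> p dvd card R \<and>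
     (\<forall>s\<in>S. \<exists>n\<in>N. \<exists>y\<in>Y. s = n \<otimes> y) \<and> (\<exists>e. card N = p ^ e * card (R <#> K))"

lemma normalizes_mono: "\<lbrakk>normalizes G Y N; Z \<subseteq> Y\<rbrakk> \<Longrightarrow> normalizes G Z N"
  by (auto simp: normalizes_def)

lemma set_multI: "\<lbrakk>a \<in> A; b \<in> B\<rbrakk> \<Longrightarrow> a \<otimes> b \<in> A <#> B"
  by (auto simp: set_mult_def)

lemma set_multE:
  assumes "x \<in> A <#> B"
  obtains a b where "x = a \<otimes> b" "a \<in> A" "b \<in> B"
  using assms unfolding set_mult_def by blast

lemma set_mult_subset: "\<lbrakk>subgroup C G; A \<subseteq> C; B \<subseteq> C\<rbrakk> \<Longrightarrow> A <#> B \<subseteq> C"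
  by (auto elim!: set_multE simp: subgroup.m_closed subset_iff)

text \<open>The group \<open>C\<close> is the last term of the derived series of \<open>Y\<close>
  outside \<open>N\<close>, hence normal in \<open>Y\<close> and abelian modulo \<open>N\<close>.
  The series is taken in \<open>Y\<close> rather than in \<open>S\<close> so that subgroups of
  \<open>C\<close> normalize \<open>R\<close>. If \<open>C\<close> contributes only a
  \<open>p\<close>-group above \<open>N\<close>, then \<open>N\<close> absorbs it; otherwise a Sylow
  \<open>q\<close>-subgroup of \<open>C\<close> is joined to both \<open>N\<close> and
  \<open>R\<close>.\<close>

lemma hall_pair_extend:
  assumes fin: "finite (carrier G)" and p: "prime p" and S: "subgroup S G"
    and K: "subgroup K G" "K \<subseteq> S" "normalizes G S K"
    and pair: "hall_pair S K p N Y R" and NS: "N \<noteq> S" and sol: "(derived G ^^ n) S \<subseteq> K"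
  shows "\<exists>N' Y' R'. hall_pair S K p N' Y' R' \<and> card N < card N'"
proof -
  have N: "subgroup N G" "K \<subseteq> N" "N \<subseteq> S" "normalizes G S N"
    and Y: "subgroup Y G" "Y \<subseteq> S" and R: "subgroup R G" "R \<subseteq> Y" "R \<subseteq> N" "normalizes G Y R" "\<not> p dvd card R"
    and SNY: "\<And>s. s \<in> S \<Longrightarrow> \<exists>n\<in>N. \<exists>y\<in>Y. s = n \<otimes> y"
    using pair by (auto simp: hall_pair_def)
  obtain e where e: "card N = p ^ e * card (R <#> K)"
    using pair by (auto simp: hall_pair_def)
  note Nc = subgroup.mem_carrier[OF N(1)]
    and Yc = subgroup.mem_carrier[OF Y(1)]
  have fsub: "finite A" if "A \<subseteq> S" for A
    using that finite_subset_carrier[OF fin S] finite_subset by blast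
  define E where "E i = (derived G ^^ i) Y" for i
  have E: "subgroup (E i) G" "E i \<subseteq> Y" "normalizes G Y (E i)" for i
    using normalizes_derived_series[OF Y(1)] by (auto simp: E_def)
  have "\<not> Y \<subseteq> N"
  proof
    assume "Y \<subseteq> N"
    then have "S \<subseteq> N"
      using SNY subgroup.m_closed[OF N(1)] by blast
    then show False
      using N(3) NS by blast
  qed
  then have E0: "\<not> E 0 \<subseteq> N"
    by (simp add: E_def)
  have En: "E n \<subseteq> N"
    using mono_exp_of_derived[OF Y(2), of n] sol N(2) by (auto simp: E_def)
  have "\<exists>i. \<not> E i \<subseteq> N \<and> E (Suc i) \<subseteq> N"
  proof (rule ccontr)
    assume no: "\<not> (\<exists>i. \<not> E i \<subseteq> N \<and> E (Suc i) \<subseteq> N)"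
    have "\<not> E j \<subseteq> N" for j
      by (induction j) (use E0 no in blast)+
    then show False
      using En by blast
  qed
  then obtain i where i: "\<not> E i \<subseteq> N" "E (Suc i) \<subseteq> N"
    by blast
  define C where "C = E i"
  have C: "subgroup C G" "C \<subseteq> Y" "normalizes G Y C" "\<not> C \<subseteq> N" "derived G C \<subseteq> N"
    using E[of i] i by (auto simp: C_def E_def)
  note Cc = subgroup.mem_carrier[OF C(1)]
  have CS: "C \<subseteq> S"
    using C Y by blast
  have RK: "subgroup (R <#> K) G"
    by (rule normalizes_set_mult[OF R(1) K(1) normalizes_mono[OF K(3)] fin]) (use R Y in blast)
  have RKN: "R <#> K \<subseteq> N"
    by (rule set_mult_subset[OF N(1) R(3) N(2)])
  have adjoin: "subgroup (Q <#> N) G" "Q \<subseteq> Q <#> N" "N \<subseteq> Q <#> N" "Q <#> N \<subseteq> S"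
    "\<not> Q \<subseteq> N \<Longrightarrow> card N < card (Q <#> N)" if Q: "subgroup Q G" "Q \<subseteq> C" for Q
  proof -
    show sub: "subgroup (Q <#> N) G"
      by (rule normalizes_set_mult[OF Q(1) N(1) normalizes_mono[OF N(4)] fin]) (use Q CS in blast)
    show QN: "Q \<subseteq> Q <#> N" and NQ: "N \<subseteq> Q <#> N"
      by (rule set_mult_mono_left[OF Q(1) N(1)], rule set_mult_mono_right[OF Q(1) N(1)])
    show S': "Q <#> N \<subseteq> S"
      by (rule set_mult_subset[OF S _ N(3)]) (use Q CS in blast)
    assume "\<not> Q \<subseteq> N"
    then have "N \<subset> Q <#> N"
      using QN NQ by blast
    then show "card N < card (Q <#> N)"
      by (rule psubset_card_mono[OF fsub[OF S']])
  qed
  have normal: "normalizes G S (Q <#> N)"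
    if Q: "subgroup Q G" "Q \<subseteq> C" and conj: "\<And>y x. y \<in> Y \<Longrightarrow> x \<in> Q \<Longrightarrow> y \<otimes> x \<otimes> inv y \<in> Q <#> N" for Q
    unfolding normalizes_def
  proof (intro ballI)
    note A = adjoin[OF Q]
    fix s z assume s: "s \<in> S" and z: "z \<in> Q <#> N"
    obtain n y where ny: "s = n \<otimes> y" "n \<in> N" "y \<in> Y"
      using SNY[OF s] by blast
    obtain x m where xm: "z = x \<otimes> m" "x \<in> Q" "m \<in> N"
      using z by (rule set_multE)
    have c: "n \<in> carrier G" "y \<in> carrier G" "x \<in> carrier G" "m \<in> carrier G"
      using ny xm Nc Yc subgroup.mem_carrier[OF Q(1)] by auto
    have "s \<otimes> z \<otimes> inv s = n \<otimes> ((y \<otimes> x \<otimes> inv y) \<otimes> (y \<otimes> m \<otimes> inv y)) \<otimes> inv n"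
      using c by (simp add: ny xm gsimps)
    moreover have "y \<otimes> m \<otimes> inv y \<in> N"
      using normalizesD[OF N(4) _ xm(3)] ny Y by blast
    ultimately show "s \<otimes> z \<otimes> inv s \<in> Q <#> N"
      using A(3) conj[OF ny(3) xm(2)] ny(2) subgroup.m_closed[OF A(1)] subgroup.m_inv_closed[OF A(1)]
      by (simp add: subset_iff)
  qed
  show ?thesis
  proof (cases "\<exists>q Q k m. prime q \<and> q \<noteq> p \<and> subgroup Q G \<and> Q \<subseteq> C \<and> card Q = q ^ k \<and>
      card C = card Q * m \<and> \<not> q dvd m \<and> \<not> Q \<subseteq> N")
    case False
    define N' where "N' = C <#> N"
    note A = adjoin[OF C(1) order_refl, folded N'_def]
    have CN: "subgroup (C \<inter> N) G"
      by (rule subgroups_Inter_pair[OF C(1) N(1)])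
    obtain c where c: "card C = card (C \<inter> N) * c"
      using card_subgroup_dvd[OF fin CN C(1)] by blast
    have "c > 0"
      using c card_subgroup_pos[OF fin C(1)] by (cases c) auto
    \<comment> \<open>Another prime dividing the index would force a Sylow subgroup of
      \<open>C\<close> for that prime out of \<open>N\<close>.\<close>
    have "\<exists>k. c = p ^ k"
    proof (rule prime_power_of_prime_divisors[OF \<open>c > 0\<close> p], rule ccontr)
      fix q assume q: "prime q" "q dvd c" "q \<noteq> p"
      obtain Q k m where Q: "subgroup Q G" "Q \<subseteq> C" "card Q = q ^ k" "card C = card Q * m" "\<not> q dvd m"
        using sylow_subgroup_full[OF fin C(1) q(1)] by blast
      then have "Q \<subseteq> C \<inter> N"
        using False q by blast
      from card_subgroup_dvd[OF fin Q(1) CN this] have "card Q * q dvd card (C \<inter> N) * c"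
        using q(2) by (rule mult_dvd_mono)
      then have "card Q * q dvd card Q * m"
        unfolding c[symmetric] Q(4) .
      then have "q dvd m"
        using card_subgroup_pos[OF fin Q(1)] by simp
      then show False
        using Q(5) by blast
    qed
    then obtain k where k: "c = p ^ k"
      by blast
    have "card N' * card (C \<inter> N) = (c * card N) * card (C \<inter> N)"
      using card_set_mult[OF fin C(1) N(1)] c by (auto simp: N'_def)
    then have "card N' = c * card N"
      using card_subgroup_pos[OF fin CN] by simp
    then have "card N' = p ^ (k + e) * card (R <#> K)"
      by (simp add: k e power_add)
    moreover have "normalizes G S N'"
      unfolding N'_def
    proof (rule normal[OF C(1) order_refl])
      fix y x assume "y \<in> Y" "x \<in> C"
      then show "y \<otimes> x \<otimes> inv y \<in> C <#> N"
        using normalizesD[OF C(3)] A(2) unfolding N'_def by blast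
    qed
    moreover have "\<forall>s\<in>S. \<exists>n\<in>N'. \<exists>y\<in>Y. s = n \<otimes> y"
      using SNY A(3) by blast
    ultimately have "hall_pair S K p N' Y R"
      unfolding hall_pair_def using A R Y N(2) by blast
    then show ?thesis
      using A(5) C(4) by blast
  next
    case True
    then obtain q Q k m where q: "prime q" "q \<noteq> p"
      and Q: "subgroup Q G" "Q \<subseteq> C" "card Q = q ^ k" "card C = card Q * m" "\<not> q dvd m" "\<not> Q \<subseteq> N"
      by blast
    note Qc = subgroup.mem_carrier[OF Q(1)]
    define N' where "N' = Q <#> N"
    note A = adjoin[OF Q(1,2), folded N'_def]
    have cj: "subgroup ((\<lambda>x. y \<otimes> x \<otimes> inv y) ` Q) G" "card ((\<lambda>x. y \<otimes> x \<otimes> inv y) ` Q) = q ^ k"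
      "(\<lambda>x. y \<otimes> x \<otimes> inv y) ` Q \<subseteq> C" if y: "y \<in> Y" for y
      using subgroup_conj_image[OF Q(1) Yc[OF y]] Q(2,3) normalizesD[OF C(3) y] by auto
    have N'n: "normalizes G S N'"
      unfolding N'_def
    proof (rule normal[OF Q(1,2)])
      fix y x assume y: "y \<in> Y" and x: "x \<in> Q"
      obtain g where g: "g \<in> C" "\<And>r. r \<in> (\<lambda>x. y \<otimes> x \<otimes> inv y) ` Q \<Longrightarrow> g \<otimes> r \<otimes> inv g \<in> Q"
        using sylow_conjugate[OF fin C(1) q(1) Q(1,2,4,5) cj(1)[OF y] cj(3)[OF y] cj(2)[OF y]] by blast
      define x' where "x' = g \<otimes> (y \<otimes> x \<otimes> inv y) \<otimes> inv g"
      have x': "x' \<in> Q"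
        unfolding x'_def using g(2) x by blast
      have c: "g \<in> carrier G" "y \<in> carrier G" "x \<in> carrier G" "x' \<in> carrier G"
        using g x x' y Yc Cc Qc by auto
      \<comment> \<open>Conjugating by an element of \<open>C\<close> changes \<open>x'\<close> only
        by an element of \<open>N\<close>, because \<open>C\<close> is abelian modulo
        \<open>N\<close>. So it suffices that \<open>Q\<close> and its conjugate by \<open>y\<close>
        are conjugate in \<open>C\<close>.\<close>
      have "inv g \<otimes> x' \<otimes> inv (inv g) \<otimes> inv x' \<in> derived G C"
        using g x' Q(2) subgroup.m_inv_closed[OF C(1)] by (intro derived_commutator) auto
      then have "inv g \<otimes> x' \<otimes> inv (inv g) \<otimes> inv x' \<in> N'"
        using C(5) A(3) by blast
      then have "(inv g \<otimes> x' \<otimes> inv (inv g) \<otimes> inv x') \<otimes> x' \<in> N'"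
        using x' A(2) subgroup.m_closed[OF A(1)] by blast
      moreover have "(inv g \<otimes> x' \<otimes> inv (inv g) \<otimes> inv x') \<otimes> x' = inv g \<otimes> x' \<otimes> g"
        using c by (simp add: gsimps)
      moreover have "inv g \<otimes> x' \<otimes> g = y \<otimes> x \<otimes> inv y"
        using c(1-3) by (simp add: x'_def gsimps)
      ultimately show "y \<otimes> x \<otimes> inv y \<in> Q <#> N"
        by (simp add: N'_def)
    qed
    define D where "D = C \<inter> N'"
    have D: "subgroup D G" "D \<subseteq> C" "Q \<subseteq> D"
      unfolding D_def using subgroups_Inter_pair[OF C(1) A(1)] Q(2) A(2) by auto
    obtain m' where m': "card D = card Q * m'" "\<not> q dvd m'"
      using sylow_of_intermediate[OF fin Q(1) D(3) Q(4,5) D(1) C(1) D(2)] by blast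
    define R' where "R' = Q <#> R"
    have QR: "normalizes G Q R"
      using normalizes_mono[OF R(4)] Q(2) C(2) by blast
    have R': "subgroup R' G"
      unfolding R'_def by (rule normalizes_set_mult[OF Q(1) R(1) QR fin])
    have R'Y: "R' \<subseteq> Y"
      unfolding R'_def by (rule set_mult_subset[OF Y(1) _ R(2)]) (use Q(2) C(2) in blast)
    have R'N: "R' \<subseteq> N'"
      unfolding R'_def by (rule set_mult_subset[OF A(1,2)]) (use R(3) A(3) in blast)
    \<comment> \<open>The normalizer of \<open>R'\<close> in \<open>Y\<close>; one inclusion is
      enough because everything is finite.\<close>
    define Y' where "Y' = {y \<in> Y. \<forall>r\<in>R'. y \<otimes> r \<otimes> inv y \<in> R'}"
    have Y'Y: "Y' \<subseteq> Y"
      by (auto simp: Y'_def)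
    have R'c: "r \<in> carrier G" if "r \<in> R'" for r
      using that subgroup.mem_carrier[OF R'] by blast
    have Y': "subgroup Y' G"
    proof (rule closed_imp_subgroup)
      show "finite Y'" "Y' \<subseteq> carrier G"
        using Y'Y Y(2) fsub Yc by auto
      show "\<one> \<in> Y'"
        using subgroup.one_closed[OF Y(1)] R'c by (auto simp: Y'_def)
      fix y z assume y: "y \<in> Y'" and z: "z \<in> Y'"
      have "(y \<otimes> z) \<otimes> r \<otimes> inv (y \<otimes> z) \<in> R'" if r: "r \<in> R'" for r
      proof -
        have "y \<otimes> (z \<otimes> r \<otimes> inv z) \<otimes> inv y \<in> R'"
          using y z r by (simp add: Y'_def)
        moreover have "y \<in> carrier G" "z \<in> carrier G"
          using y z Y'Y Yc by auto
        ultimately show ?thesis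
          using R'c[OF r] by (simp add: gsimps)
      qed
      then show "y \<otimes> z \<in> Y'"
        using y z subgroup.m_closed[OF Y(1)] by (simp add: Y'_def)
    qed
    have R'Y': "R' \<subseteq> Y'"
      using R'Y subgroup.m_closed[OF R'] subgroup.m_inv_closed[OF R'] by (auto simp: Y'_def)
    have nY': "normalizes G Y' R'"
      by (auto simp: Y'_def normalizes_def)
    have pR': "\<not> p dvd card R'"
    proof
      assume "p dvd card R'"
      then have "p dvd card Q * card R"
        using card_set_mult[OF fin Q(1) R(1)] by (metis R'_def dvd_mult2)
      then have "p dvd q ^ k"
        using R(5) p prime_dvd_mult_iff Q(3) by metis
      then show False
        using p q prime_dvd_power primes_dvd_imp_eq by metis
    qed
    have SN'Y': "\<exists>n\<in>N'. \<exists>y\<in>Y'. s = n \<otimes> y" if s: "s \<in> S" for s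
    proof -
      obtain n y where ny: "s = n \<otimes> y" "n \<in> N" "y \<in> Y"
        using SNY[OF s] by blast
      \<comment> \<open>Frattini argument: the conjugate of \<open>Q\<close> by \<open>y\<close> is
        again a Sylow \<open>q\<close>-subgroup of \<open>D\<close>, so some \<open>g\<close> in
        \<open>D\<close> brings it back, and \<open>g \<otimes> y\<close> normalizes both
        \<open>Q\<close> and \<open>R\<close>. The correction by \<open>g\<close> is absorbed in
        \<open>N'\<close>.\<close>
      have "(\<lambda>x. y \<otimes> x \<otimes> inv y) ` Q \<subseteq> D"
        using cj(3)[OF ny(3)] normalizesD[OF N'n] ny(3) Y(2) A(2)
        by (auto simp: D_def image_subset_iff subset_iff)
      then obtain g where g: "g \<in> D" "\<And>r. r \<in> (\<lambda>x. y \<otimes> x \<otimes> inv y) ` Q \<Longrightarrow> g \<otimes> r \<otimes> inv g \<in> Q"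
        using sylow_conjugate[OF fin D(1) q(1) Q(1) D(3) m' cj(1)[OF ny(3)] _ cj(2)[OF ny(3)]] by blast
      define z where "z = g \<otimes> y"
      have gC: "g \<in> C" "g \<in> N'"
        using g(1) by (auto simp: D_def)
      have c: "g \<in> carrier G" "y \<in> carrier G" "n \<in> carrier G"
        using gC ny Cc Yc Nc by auto
      have zY: "z \<in> Y"
        unfolding z_def using gC C(2) ny subgroup.m_closed[OF Y(1)] by blast
      have "z \<otimes> r \<otimes> inv z \<in> R'" if rR': "r \<in> R'" for r
      proof -
        obtain x u where r: "r = x \<otimes> u" "x \<in> Q" "u \<in> R"
          using rR' unfolding R'_def by (rule set_multE)
        have c': "x \<in> carrier G" "u \<in> carrier G" "z \<in> carrier G"
          using r Qc subgroup.mem_carrier[OF R(1)] zY Yc by auto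
        have "z \<otimes> x \<otimes> inv z = g \<otimes> (y \<otimes> x \<otimes> inv y) \<otimes> inv g"
          using c c' by (simp add: z_def gsimps)
        then have "z \<otimes> x \<otimes> inv z \<in> Q"
          using g(2) r(2) by (metis imageI)
        moreover have "z \<otimes> u \<otimes> inv z \<in> R"
          by (rule normalizesD[OF R(4) zY r(3)])
        moreover have "z \<otimes> r \<otimes> inv z = (z \<otimes> x \<otimes> inv z) \<otimes> (z \<otimes> u \<otimes> inv z)"
          using c' by (simp add: r gsimps)
        ultimately show ?thesis
          unfolding R'_def by (metis set_multI)
      qed
      then have "z \<in> Y'"
        using zY by (simp add: Y'_def)
      moreover have "n \<otimes> inv g \<in> N'"
        using ny(2) gC(2) A(3) subgroup.m_closed[OF A(1)] subgroup.m_inv_closed[OF A(1)] by blast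
      moreover have "s = (n \<otimes> inv g) \<otimes> z"
        using c by (simp add: ny(1) z_def gsimps)
      ultimately show ?thesis
        by blast
    qed
    have "\<exists>e'. card N' = p ^ e' * card (R' <#> K)"
    proof -
      define Z where "Z = R' <#> K"
      have Z: "subgroup Z G"
        unfolding Z_def by (rule normalizes_set_mult[OF R' K(1) normalizes_mono[OF K(3)] fin]) (use R'Y Y in blast)
      have ZN: "Z \<subseteq> N'"
        unfolding Z_def by (rule set_mult_subset[OF A(1) R'N]) (use N(2) A(3) in blast)
      have Z': "Z = Q <#> (R <#> K)"
        unfolding Z_def R'_def
        by (rule set_mult_assoc) (use subgroup.subset Q(1) R(1) K(1) in auto)
      obtain t where t: "card N' = card Z * t"
        using card_subgroup_dvd[OF fin Z A(1) ZN] by blast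
      have I: "subgroup (Q \<inter> (R <#> K)) G" "subgroup (Q \<inter> N) G"
        using subgroups_Inter_pair[OF Q(1) RK] subgroups_Inter_pair[OF Q(1) N(1)] by auto
      obtain u where u: "card (Q \<inter> N) = card (Q \<inter> (R <#> K)) * u"
        using card_subgroup_dvd[OF fin I] RKN by blast
      have 1: "card Z * card (Q \<inter> (R <#> K)) = card Q * card (R <#> K)"
        unfolding Z' by (rule card_set_mult[OF fin Q(1) RK])
      have 2: "card N' * card (Q \<inter> N) = card Q * card N"
        unfolding N'_def by (rule card_set_mult[OF fin Q(1) N(1)])
      \<comment> \<open>Both product formulas contain the order of \<open>Q\<close>. Eliminating it
        leaves two index factors, \<open>t\<close> and \<open>u\<close>, whose product is
        \<open>p ^ e\<close>; so \<open>t\<close> is a power of \<open>p\<close>.\<close>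
      have "(card Z * card (Q \<inter> (R <#> K))) * (t * u) = card N' * card (Q \<inter> N)"
        by (simp add: t u)
      also have "\<dots> = (card Z * card (Q \<inter> (R <#> K))) * p ^ e"
        unfolding 2 1 e by simp
      finally have "t * u = p ^ e"
        using card_subgroup_pos[OF fin Z] card_subgroup_pos[OF fin I(1)] by simp
      then obtain e' where "t = p ^ e'"
        using divides_primepow_nat[OF p] by (metis dvd_triv_left)
      then show ?thesis
        using t by (auto simp: Z_def)
    qed
    then have "hall_pair S K p N' Y' R'"
      unfolding hall_pair_def using A N'n Y' Y'Y Y(2) R' R'Y' R'N nY' pR' SN'Y' N(2) by blast
    then show ?thesis
      using A(5) Q(6) by blast
  qed
qed

text \<open>Hall's theorem for the soluble group \<open>S/K\<close>, with the Hall \<open>p'\<close>-subgroup lifted to a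
  \<open>p'\<close>-subgroup of \<open>S\<close>.\<close>

lemma hall_supplement:
  assumes fin: "finite (carrier G)" and p: "prime p" and S: "subgroup S G"
    and K: "subgroup K G" "K \<subseteq> S" "normalizes G S K" and sol: "(derived G ^^ n) S \<subseteq> K"
  obtains X e where "subgroup X G" "X \<subseteq> S" "\<not> p dvd card X" "card S = p ^ e * card (X <#> K)"
proof -
  have "\<exists>Y R. hall_pair S K p S Y R" if "hall_pair S K p N Y R" for N Y R
    using that
  proof (induction "card S - card N" arbitrary: N Y R rule: less_induct)
    case less
    show ?case
    proof (cases "N = S")
      case False
      obtain N' Y' R' where pair: "hall_pair S K p N' Y' R'" "card N < card N'"
        using hall_pair_extend[OF fin p S K less.prems False sol] by blast
      have "card N' \<le> card S"
        using pair(1) finite_subset_carrier[OF fin S] by (auto simp: hall_pair_def intro: card_mono)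
      then show ?thesis
        using less.hyps[OF _ pair(1)] pair(2) by auto
    qed (use less.prems in blast)
  qed
  moreover have "hall_pair S K p K S {\<one>}"
  proof -
    have "{\<one>} <#> K = K"
      using subgroup.mem_carrier[OF K(1)] by (auto simp: set_mult_def)
    moreover have "normalizes G S {\<one>}"
      using subgroup.mem_carrier[OF S] by (auto simp: normalizes_def)
    moreover have "\<not> p dvd card {\<one>}"
      using p by (simp add: prime_nat_iff)
    moreover have "\<exists>n\<in>K. \<exists>y\<in>S. s = n \<otimes> y" if "s \<in> S" for s
      using that subgroup.one_closed[OF K(1)] subgroup.mem_carrier[OF S that]
      by (intro bexI[of _ \<one>] bexI[of _ s]) auto
    ultimately show ?thesis
      unfolding hall_pair_def
      using K S triv_subgroup subgroup.one_closed[OF S] subgroup.one_closed[OF K(1)]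
      by (auto intro: exI[of _ 0])
  qed
  ultimately obtain Y R where "hall_pair S K p S Y R"
    by blast
  then show ?thesis
    using that unfolding hall_pair_def by blast
qed

end

section \<open>Generators of submodules of induced modules\<close>

locale induced_setup =
  group G + V: group_module "G\<lparr>carrier := H\<rparr>" scale act V
  for G :: "('g, 'm) monoid_scheme" (structure)
    and H :: "'g set"
    and scale :: "'f::field \<Rightarrow> 'v::ab_group_add \<Rightarrow> 'v"
    and act :: "'v \<Rightarrow> 'g \<Rightarrow> 'v"
    and V :: "'v set" +
  fixes a :: nat
  assumes finite_G: "finite (carrier G)"
    and subgroup_H: "subgroup H G"
    and finite_span: "\<exists>B. finite B \<and> V.span B = V"
    and dim_V: "V.dim V = a"
begin

abbreviation ind_scale :: "'f \<Rightarrow> ('g \<Rightarrow> 'v) \<Rightarrow> 'g \<Rightarrow> 'v" where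
  "ind_scale \<equiv> induced_scale scale"

abbreviation ind_act :: "('g \<Rightarrow> 'v) \<Rightarrow> 'g \<Rightarrow> 'g \<Rightarrow> 'v" where
  "ind_act \<equiv> induced_act G"

abbreviation W :: "('g \<Rightarrow> 'v) set" where
  "W \<equiv> induced_module G H act V"

sublocale F: vector_space ind_scale
  by (rule vector_space_induced_scale) unfold_locales

sublocale W: group_module G ind_scale ind_act W
  by (rule group_module_induced[OF is_group subgroup_H V.group_module_axioms])

lemma zero_V: "0 \<in> V"
  by (rule V.subspace_0[OF V.subspace_W])

lemma act_zero: "h \<in> H \<Longrightarrow> act 0 h = 0"
  using V.act_add[of 0 0 h] zero_V by simp

lemma Hc: "h \<in> H \<Longrightarrow> h \<in> carrier G"
  by (rule subgroup.mem_carrier[OF subgroup_H])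

lemma W_eval: "\<lbrakk>f \<in> W; h \<in> H; x \<in> carrier G\<rbrakk> \<Longrightarrow> f (h \<otimes> x) = act (f x) (inv h)"
  by (simp add: induced_module_def)

lemma W_eval_zero: "\<lbrakk>f \<in> W; h \<in> H; x \<in> carrier G; f x = 0\<rbrakk> \<Longrightarrow> f (h \<otimes> x) = 0"
  by (metis W_eval act_zero subgroup.m_inv_closed subgroup_H)

lemma W_outside: "\<lbrakk>f \<in> W; x \<notin> carrier G\<rbrakk> \<Longrightarrow> f x = 0"
  by (simp add: induced_module_def)

lemma W_mem_V: "\<lbrakk>f \<in> W; x \<in> carrier G\<rbrakk> \<Longrightarrow> f x \<in> V"
  by (simp add: induced_module_def)

text \<open>The finite spanning set makes the dimension meaningful: an infinite basis would have
  cardinality 0.\<close>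

lemma independent_bound:
  assumes "V.independent B" "B \<subseteq> V"
  shows "finite B \<and> card B \<le> a"
proof -
  obtain B0 where B0: "finite B0" "V.span B0 = V"
    using finite_span by blast
  obtain B1 where B1: "B1 \<subseteq> V" "V.independent B1" "V \<subseteq> V.span B1" "card B1 = a"
    using V.basis_exists[of V] dim_V by metis
  have "finite B1"
    using V.independent_span_bound[OF B0(1) B1(2)] B1(1) B0(2) by simp
  then show ?thesis
    using V.independent_span_bound[of B1 B] assms B1 by auto
qed

lemma ind_act_add: "ind_act (f + f') y = ind_act f y + ind_act f' y"
  by (auto simp: induced_act_def)

lemma ind_act_scale: "ind_act (ind_scale c f) y = ind_scale c (ind_act f y)"
  by (auto simp: induced_act_def induced_scale_def)

lemma ind_act_mult:
  "\<lbrakk>y \<in> carrier G; z \<in> carrier G\<rbrakk> \<Longrightarrow> ind_act (ind_act f y) z = ind_act f (y \<otimes> z)"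
  by (auto simp: induced_act_def gsimps)

lemma ind_act_apply: "x \<in> carrier G \<Longrightarrow> ind_act f y x = f (x \<otimes> inv y)"
  by (simp add: induced_act_def)

section \<open>Invariant subspaces and numbers of generators\<close>

definition closed_under :: "'g set \<Rightarrow> ('g \<Rightarrow> 'v) set \<Rightarrow> bool" where
  "closed_under Y N \<longleftrightarrow> F.subspace N \<and> (\<forall>f\<in>N. \<forall>y\<in>Y. ind_act f y \<in> N)"

text \<open>Testing against all invariant subspaces of the function space, not only those inside
  \<open>M\<close>, makes the condition easy to transport along maps. Only upper bounds occur, so no
  minimum is formed.\<close>

definition generated_by_le :: "'g set \<Rightarrow> ('g \<Rightarrow> 'v) set \<Rightarrow> nat \<Rightarrow> bool" where
  "generated_by_le Y M n \<longleftrightarrow>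
     (\<exists>X. finite X \<and> X \<subseteq> M \<and> card X \<le> n \<and> (\<forall>N. closed_under Y N \<longrightarrow> X \<subseteq> N \<longrightarrow> M \<subseteq> N))"

lemma generated_by_leE:
  assumes "generated_by_le Y M n"
  obtains X where "finite X" "X \<subseteq> M" "card X \<le> n"
    "\<And>N. closed_under Y N \<Longrightarrow> X \<subseteq> N \<Longrightarrow> M \<subseteq> N"
proof -
  from assms obtain X where "finite X \<and> X \<subseteq> M \<and> card X \<le> n \<and> (\<forall>N. closed_under Y N \<longrightarrow> X \<subseteq> N \<longrightarrow> M \<subseteq> N)"
    unfolding generated_by_le_def by (elim exE)
  then show ?thesis
    by (intro that[of X]) simp_all
qed

lemma closed_underD:
  assumes "closed_under Y N"
  shows "0 \<in> N" "\<lbrakk>f \<in> N; f' \<in> N\<rbrakk> \<Longrightarrow> f + f' \<in> N" "\<lbrakk>f \<in> N; f' \<in> N\<rbrakk> \<Longrightarrow> f - f' \<in> N"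
    "f \<in> N \<Longrightarrow> ind_scale c f \<in> N" "\<lbrakk>f \<in> N; y \<in> Y\<rbrakk> \<Longrightarrow> ind_act f y \<in> N"
  using assms F.subspace_0 F.subspace_add F.subspace_diff F.subspace_scale
  by (auto simp: closed_under_def)

lemma closed_underI:
  assumes "0 \<in> N" "\<And>f f'. \<lbrakk>f \<in> N; f' \<in> N\<rbrakk> \<Longrightarrow> f + f' \<in> N"
    "\<And>c f. f \<in> N \<Longrightarrow> ind_scale c f \<in> N" "\<And>f y. \<lbrakk>f \<in> N; y \<in> Y\<rbrakk> \<Longrightarrow> ind_act f y \<in> N"
  shows "closed_under Y N"
  using assms by (auto simp: closed_under_def F.subspace_def)

lemma closed_under_W:
  assumes "Y \<subseteq> carrier G"
  shows "closed_under Y W"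
  using W.subspace_W W.act_closed assms by (auto simp: closed_under_def)

lemma closed_under_Int: "\<lbrakk>closed_under Y M; closed_under Y N\<rbrakk> \<Longrightarrow> closed_under Y (M \<inter> N)"
  by (auto simp: closed_under_def F.subspace_inter)

text \<open>A subspace stable under \<open>G\<close> is stable under \<open>Y\<close>, so generators
  over \<open>Y\<close> generate over \<open>G\<close>.\<close>

lemma min_generators_le:
  assumes M: "group_submodule G ind_scale ind_act M W" and Y: "Y \<subseteq> carrier G"
    and gen: "generated_by_le Y M n"
  shows "min_generators G ind_scale ind_act M \<le> n"
proof -
  obtain X where X: "finite X" "X \<subseteq> M" "card X \<le> n"
    "\<And>N. closed_under Y N \<Longrightarrow> X \<subseteq> N \<Longrightarrow> M \<subseteq> N"
    by (rule generated_by_leE[OF gen]) blast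
  have "group_submodule G ind_scale ind_act M M"
    using M by (simp add: group_submodule_def)
  moreover have "M \<subseteq> N" if N: "group_submodule G ind_scale ind_act N M" "X \<subseteq> N" for N
    by (rule X(4)[OF _ N(2)]) (use N(1) Y in \<open>auto simp: group_submodule_def closed_under_def\<close>)
  ultimately have "generated_submodule G ind_scale ind_act M X = M"
    unfolding generated_submodule_def using X(2) by blast
  then have "min_generators G ind_scale ind_act M \<le> card X"
    unfolding min_generators_def using X by (intro Least_le) blast
  then show ?thesis
    using X(3) by simp
qed

section \<open>Filtration by supports in double cosets\<close>

definition restrict_to :: "'g set \<Rightarrow> ('g \<Rightarrow> 'v) \<Rightarrow> 'g \<Rightarrow> 'v" where
  "restrict_to A f = (\<lambda>x. if x \<in> A then f x else 0)"

lemma restrict_to_linear: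
  "restrict_to A (f + f') = restrict_to A f + restrict_to A f'"
  "restrict_to A (ind_scale c f) = ind_scale c (restrict_to A f)"
  "restrict_to A 0 = 0"
  by (auto simp: restrict_to_def induced_scale_def)

lemma restrict_to_act:
  assumes Y: "subgroup Y G" and A: "A \<subseteq> carrier G" "\<And>x y. x \<in> A \<Longrightarrow> y \<in> Y \<Longrightarrow> x \<otimes> y \<in> A" and y: "y \<in> Y"
  shows "ind_act (restrict_to A f) y = restrict_to A (ind_act f y)"
proof
  fix x
  have yc: "y \<in> carrier G"
    using y subgroup.mem_carrier[OF Y] by blast
  have "x \<otimes> inv y \<in> A \<longleftrightarrow> x \<in> A" if x: "x \<in> carrier G"
  proof
    assume "x \<otimes> inv y \<in> A"
    from A(2)[OF this y] show "x \<in> A"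
      using x yc by (simp add: gsimps)
  qed (use A(2) subgroup.m_inv_closed[OF Y y] in blast)
  then show "ind_act (restrict_to A f) y x = restrict_to A (ind_act f y) x"
    using A(1) by (auto simp: induced_act_def restrict_to_def)
qed

lemma closed_under_restrict:
  assumes Y: "subgroup Y G" and A: "A \<subseteq> carrier G" "\<And>x y. x \<in> A \<Longrightarrow> y \<in> Y \<Longrightarrow> x \<otimes> y \<in> A"
    and N: "closed_under Y N"
  shows "closed_under Y (restrict_to A ` N)"
proof (rule closed_underI)
  note c = closed_underD[OF N]
  show "0 \<in> restrict_to A ` N"
    using imageI[OF c(1), of "restrict_to A"] by (simp add: restrict_to_linear)
  fix u assume "u \<in> restrict_to A ` N"
  then obtain f where f: "u = restrict_to A f" "f \<in> N"
    by blast
  show "ind_scale r u \<in> restrict_to A ` N" for r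
    unfolding f(1) restrict_to_linear(2)[symmetric] using c(4)[OF f(2)] by blast
  show "ind_act u y \<in> restrict_to A ` N" if "y \<in> Y" for y
    using restrict_to_act[OF Y A that, of f] c(5)[OF f(2) that] f(1) by simp
  fix u' assume "u' \<in> restrict_to A ` N"
  then obtain f' where f': "u' = restrict_to A f'" "f' \<in> N"
    by blast
  show "u + u' \<in> restrict_to A ` N"
    unfolding f(1) f'(1) restrict_to_linear(1)[symmetric] using c(2)[OF f(2) f'(2)] by blast
qed

text \<open>Restriction to \<open>A\<close> commutes with \<open>Y\<close>. Generators of its image
  are lifted to \<open>M\<close>, one for one, and joined with generators of its kernel.\<close>

lemma generated_by_le_restrict:
  assumes Y: "subgroup Y G" and A: "A \<subseteq> carrier G" "\<And>x y. x \<in> A \<Longrightarrow> y \<in> Y \<Longrightarrow> x \<otimes> y \<in> A"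
    and M: "closed_under Y M"
    and n1: "generated_by_le Y (restrict_to A ` M) n1"
    and n2: "generated_by_le Y {f \<in> M. \<forall>x\<in>A. f x = 0} n2"
  shows "generated_by_le Y M (n1 + n2)"
proof -
  obtain X1 where X1: "finite X1" "X1 \<subseteq> restrict_to A ` M" "card X1 \<le> n1"
    "\<And>N. closed_under Y N \<Longrightarrow> X1 \<subseteq> N \<Longrightarrow> restrict_to A ` M \<subseteq> N"
    by (rule generated_by_leE[OF n1]) blast
  obtain X2 where X2: "finite X2" "X2 \<subseteq> {f \<in> M. \<forall>x\<in>A. f x = 0}" "card X2 \<le> n2"
    "\<And>N. closed_under Y N \<Longrightarrow> X2 \<subseteq> N \<Longrightarrow> {f \<in> M. \<forall>x\<in>A. f x = 0} \<subseteq> N"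
    by (rule generated_by_leE[OF n2]) blast
  obtain Z where Z: "Z \<subseteq> M" "finite Z" "restrict_to A ` Z = X1" "card Z = card X1"
  proof -
    obtain Z where "Z \<subseteq> M" "inj_on (restrict_to A) Z" "X1 = restrict_to A ` Z"
      using X1(2) unfolding subset_image_inj by blast
    then show ?thesis
      using that[of Z] X1(1) by (simp add: card_image finite_image_iff)
  qed
  show ?thesis
    unfolding generated_by_le_def
  proof (intro exI[of _ "Z \<union> X2"] conjI allI impI)
    show "card (Z \<union> X2) \<le> n1 + n2"
      using card_Un_le[of Z X2] Z(4) X1(3) X2(3) by simp
    fix N assume N: "closed_under Y N" and sub: "Z \<union> X2 \<subseteq> N"
    have MN: "closed_under Y (M \<inter> N)"
      by (rule closed_under_Int[OF M N])
    have "X1 \<subseteq> restrict_to A ` (M \<inter> N)"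
      using Z sub by blast
    moreover have "closed_under Y (restrict_to A ` (M \<inter> N))"
      by (rule closed_under_restrict[OF Y A(1) _ MN]) (rule A(2))
    ultimately have res: "restrict_to A ` M \<subseteq> restrict_to A ` (M \<inter> N)"
      by (intro X1(4))
    show "M \<subseteq> N"
    proof
      fix f assume f: "f \<in> M"
      then obtain f' where f': "f' \<in> M" "f' \<in> N" "restrict_to A f = restrict_to A f'"
        using res by blast
      have "f x = f' x" if "x \<in> A" for x
        using fun_cong[OF f'(3), of x] that by (simp add: restrict_to_def)
      then have "f - f' \<in> {f \<in> M. \<forall>x\<in>A. f x = 0}"
        using closed_underD(3)[OF M f f'(1)] by simp
      then have "f - f' \<in> N"
        using X2(4)[OF N] sub by blast
      then have "f - f' + f' \<in> N"
        using closed_underD(2)[OF N] f'(2) by blast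
      then show "f \<in> N"
        by simp
    qed
  qed (use Z X1 X2 in auto)
qed

definition supported :: "'g set \<Rightarrow> ('g \<Rightarrow> 'v) set" where
  "supported A = {f \<in> W. \<forall>x. x \<notin> A \<longrightarrow> f x = 0}"

text \<open>A submodule need not be the sum of its parts on the double cosets, so these are peeled
  off in turn: the image under restriction to \<open>U\<close> is supported on \<open>U\<close>, and
  the kernel on the remaining double cosets.\<close>

lemma generated_by_le_sum:
  assumes Y: "subgroup Y G"
    and fin: "finite \<S>" and \<S>: "\<S> \<subseteq> (\<lambda>g. dcoset G H g Y) ` carrier G"
    and M: "closed_under Y M" "M \<subseteq> supported (\<Union> \<S>)"
    and b: "\<And>U N. \<lbrakk>U \<in> \<S>; closed_under Y N; N \<subseteq> supported U\<rbrakk> \<Longrightarrow> generated_by_le Y N (b U)"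
  shows "generated_by_le Y M (\<Sum>U\<in>\<S>. b U)"
  using fin \<S> M b
proof (induction \<S> arbitrary: M rule: finite_induct)
  case empty
  then have "M \<subseteq> {0}"
    by (auto simp: supported_def fun_eq_iff)
  then show ?case
    unfolding generated_by_le_def using closed_underD(1) by (intro exI[of _ "{}"]) auto
next
  case (insert U \<S>)
  obtain g where g: "g \<in> carrier G" "U = dcoset G H g Y"
    using insert.prems(1) by blast
  have U: "U \<subseteq> carrier G" "\<And>x y. x \<in> U \<Longrightarrow> y \<in> Y \<Longrightarrow> x \<otimes> y \<in> U"
  proof -
    show sub: "U \<subseteq> carrier G"
      unfolding g(2) by (rule dcoset_subset[OF subgroup_H Y g(1)])
    fix x y assume x: "x \<in> U" and y: "y \<in> Y"
    then have "\<one> \<otimes> x \<otimes> y \<in> U"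
      unfolding g(2) by (intro dcoset_closed[OF subgroup_H Y g(1)] subgroup.one_closed[OF subgroup_H])
    then show "x \<otimes> y \<in> U"
      using sub x by (simp add: subset_iff)
  qed
  have UH: "h \<otimes> x \<in> U \<longleftrightarrow> x \<in> U" if h: "h \<in> H" and x: "x \<in> carrier G" for h x
  proof
    assume "h \<otimes> x \<in> U"
    then have "inv h \<otimes> (h \<otimes> x) \<otimes> \<one> \<in> U"
      unfolding g(2) using h
      by (intro dcoset_closed[OF subgroup_H Y g(1)] subgroup.one_closed[OF Y]
          subgroup.m_inv_closed[OF subgroup_H])
    then show "x \<in> U"
      using x Hc[OF h] by (simp add: gsimps)
  next
    assume "x \<in> U"
    then have "h \<otimes> x \<otimes> \<one> \<in> U"
      unfolding g(2) using h by (intro dcoset_closed[OF subgroup_H Y g(1)] subgroup.one_closed[OF Y])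
    then show "h \<otimes> x \<in> U"
      using x Hc[OF h] by simp
  qed
  have "restrict_to U f \<in> W" if f: "f \<in> W" for f
  proof -
    have "restrict_to U f (h \<otimes> x) = act (restrict_to U f x) (inv h)" if "h \<in> H" "x \<in> carrier G" for h x
      using UH[OF that] W_eval[OF f that] act_zero[of "inv h"] subgroup.m_inv_closed[OF subgroup_H that(1)]
      by (simp add: restrict_to_def)
    moreover have "restrict_to U f x \<in> V" if "x \<in> carrier G" for x
      using W_mem_V[OF f that] zero_V by (simp add: restrict_to_def)
    ultimately show ?thesis
      using U(1) by (auto simp: induced_module_def restrict_to_def)
  qed
  then have r: "restrict_to U ` M \<subseteq> supported U"
    using insert.prems(3) by (auto simp: supported_def restrict_to_def)
  have 1: "generated_by_le Y (restrict_to U ` M) (b U)"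
    by (rule insert.prems(4)[OF _ closed_under_restrict[OF Y U insert.prems(2)] r]) simp
  let ?M = "{f \<in> M. \<forall>x\<in>U. f x = 0}"
  have 2: "generated_by_le Y ?M (\<Sum>U\<in>\<S>. b U)"
  proof (rule insert.IH)
    show "closed_under Y ?M"
    proof (rule closed_underI)
      note c = closed_underD[OF insert.prems(2)]
      show "0 \<in> ?M" "\<And>f f'. \<lbrakk>f \<in> ?M; f' \<in> ?M\<rbrakk> \<Longrightarrow> f + f' \<in> ?M"
        using c(1,2) by auto
      show "ind_scale r f \<in> ?M" if "f \<in> ?M" for r f
        using that c(4) by (simp add: induced_scale_def)
      show "ind_act f y \<in> ?M" if "f \<in> ?M" "y \<in> Y" for f y
      proof -
        have "ind_act f y x = 0" if "x \<in> U" for x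
          using \<open>f \<in> ?M\<close> U(2)[OF that subgroup.m_inv_closed[OF Y \<open>y \<in> Y\<close>]] that U(1)
          by (simp add: ind_act_apply subset_iff)
        then show ?thesis
          using c(5) that by simp
      qed
    qed
    show "?M \<subseteq> supported (\<Union> \<S>)"
      using insert.prems(3) by (auto simp: supported_def)
    show "generated_by_le Y N (b U)" if "U \<in> \<S>" "closed_under Y N" "N \<subseteq> supported U" for U N
      using insert.prems(4) that by blast
  qed (use insert.prems(1) in blast)
  show ?case
    using generated_by_le_restrict[OF Y U insert.prems(2) 1 2] insert.hyps by simp
qed

text \<open>The functions on one orbit are generated by the copy of \<open>V\<close> at
  \<open>g\<close>: a suitable translate by \<open>y\<close> agrees with \<open>f\<close> on the
  coset \<open>H g y\<close> and vanishes elsewhere, so subtracting it shrinks the support.\<close>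

lemma supported_dcoset_subset:
  assumes Y: "subgroup Y G" and g: "g \<in> carrier G"
    and N: "closed_under Y N" and B: "V.span B = V" "B \<subseteq> V"
    and emb: "\<And>v. v \<in> B \<Longrightarrow> ind_act (induced_embed G H act v) g \<in> N"
  shows "supported (dcoset G H g Y) \<subseteq> N"
proof -
  let ?e = "\<lambda>v. ind_act (induced_embed G H act v) g"
  note ax = is_group subgroup_H V.group_module_axioms
  note Yc = subgroup.mem_carrier[OF Y]
  have e: "?e v \<in> N" if "v \<in> V" for v
  proof -
    have "V.subspace {v \<in> V. ?e v \<in> N}"
      unfolding V.subspace_def
    proof (intro conjI ballI allI)
      have "induced_embed G H act 0 = 0"
        using act_zero subgroup.m_inv_closed[OF subgroup_H] by (auto simp: induced_embed_def)
      moreover have "ind_act 0 g = 0"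
        by (auto simp: induced_act_def)
      ultimately show "0 \<in> {v \<in> V. ?e v \<in> N}"
        using zero_V closed_underD(1)[OF N] by simp
      show "v + w \<in> {v \<in> V. ?e v \<in> N}" if "v \<in> {v \<in> V. ?e v \<in> N}" "w \<in> {v \<in> V. ?e v \<in> N}" for v w
        using that closed_underD(2)[OF N] V.subspace_add[OF V.subspace_W]
        by (simp add: induced_embed_linear(1)[OF ax] ind_act_add)
      show "scale c v \<in> {v \<in> V. ?e v \<in> N}" if "v \<in> {v \<in> V. ?e v \<in> N}" for c v
        using that closed_underD(4)[OF N] V.subspace_scale[OF V.subspace_W]
        by (simp add: induced_embed_linear(2)[OF ax that[THEN CollectD, THEN conjunct1]
              that[THEN CollectD, THEN conjunct1]] ind_act_scale)
    qed
    then have "V.span B \<subseteq> {v \<in> V. ?e v \<in> N}"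
      using emb B(2) by (intro V.span_minimal) auto
    then show ?thesis
      using that B(1) by blast
  qed
  have e_W: "?e v \<in> W" if "v \<in> V" for v
    by (rule W.act_closed[OF induced_embed_mem[OF ax that] g])
  have "f \<in> N" if "f \<in> supported (dcoset G H g Y)" for f
    using that
  proof (induction "card {x. f x \<noteq> 0}" arbitrary: f rule: less_induct)
    case less
    have fW: "f \<in> W" and supp: "\<And>x. f x \<noteq> 0 \<Longrightarrow> x \<in> dcoset G H g Y"
      using less.prems by (auto simp: supported_def)
    have fin: "finite {x. f x \<noteq> 0}"
      using W_outside[OF fW] finite_G by (metis (mono_tags, lifting) mem_Collect_eq rev_finite_subset subsetI)
    show ?case
    proof (cases "f = 0")
      case False
      then obtain x where x: "f x \<noteq> 0"
        by (auto simp: fun_eq_iff)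
      obtain h y where hy: "x = h \<otimes> g \<otimes> y" "h \<in> H" "y \<in> Y"
        using supp[OF x] by (rule dcosetE)
      have c: "h \<in> carrier G" "y \<in> carrier G"
        using hy Hc Yc by auto
      define v where "v = f (g \<otimes> y)"
      define f' where "f' = ind_act (?e v) y"
      have v: "v \<in> V"
        unfolding v_def using W_mem_V[OF fW] g c by simp
      have f'N: "f' \<in> N" and f'W: "f' \<in> W"
        unfolding f'_def using closed_underD(5)[OF N e[OF v] hy(3)] W.act_closed[OF e_W[OF v] c(2)] by auto
      have f'_apply: "f' z = (if z \<otimes> inv y \<otimes> inv g \<in> H then act v (inv (z \<otimes> inv y \<otimes> inv g)) else 0)"
        if "z \<in> carrier G" for z
        using that c g by (simp add: f'_def ind_act_apply induced_embed_def)
      have eq: "f' (k \<otimes> g \<otimes> y) = f (k \<otimes> g \<otimes> y)" if k: "k \<in> H" for k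
      proof -
        have kc: "k \<in> carrier G"
          using Hc k by blast
        have "f' (k \<otimes> g \<otimes> y) = act v (inv k)"
          using kc k c g by (simp add: f'_apply gsimps)
        also have "\<dots> = f (k \<otimes> (g \<otimes> y))"
          unfolding v_def using W_eval[OF fW k] g c by simp
        finally show ?thesis
          using kc g c by (simp add: gsimps)
      qed
      have f'_zero: "f' z = 0 \<or> f' z = f z" for z
      proof (cases "z \<in> carrier G \<and> z \<otimes> inv y \<otimes> inv g \<in> H")
        case True
        then have "z = (z \<otimes> inv y \<otimes> inv g) \<otimes> g \<otimes> y"
          using c g by (simp add: gsimps)
        then show ?thesis
          using eq[of "z \<otimes> inv y \<otimes> inv g"] True by simp
      next
        case False
        then show ?thesis
          using f'_apply[of z] W_outside[OF f'W, of z] by auto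
      qed
      have "f' x = f x"
        using eq[OF hy(2)] hy(1) by simp
      have sub: "{z. (f - f') z \<noteq> 0} \<subset> {z. f z \<noteq> 0}"
      proof (intro psubsetI)
        show "{z. (f - f') z \<noteq> 0} \<subseteq> {z. f z \<noteq> 0}"
        proof
          fix z assume "z \<in> {z. (f - f') z \<noteq> 0}"
          then show "z \<in> {z. f z \<noteq> 0}"
            using f'_zero[of z] by auto
        qed
        have "x \<notin> {z. (f - f') z \<noteq> 0}"
          using \<open>f' x = f x\<close> by simp
        then show "{z. (f - f') z \<noteq> 0} \<noteq> {z. f z \<noteq> 0}"
          using x by blast
      qed
      then have "card {z. (f - f') z \<noteq> 0} < card {z. f z \<noteq> 0}"
        by (rule psubset_card_mono[OF fin])
      moreover have "f - f' \<in> supported (dcoset G H g Y)"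
        using sub supp closed_underD(3)[OF closed_under_W[OF order_refl] fW f'W]
        by (auto simp: supported_def)
      ultimately have "f - f' \<in> N"
        by (rule less.hyps)
      then have "f - f' + f' \<in> N"
        using closed_underD(2)[OF N] f'N by blast
      then show ?thesis
        by simp
    qed (use closed_underD(1)[OF N] in simp)
  qed
  then show ?thesis
    by blast
qed

lemma generated_by_le_semisimple:
  assumes Y: "subgroup Y G" and g: "g \<in> carrier G" and nz: "of_nat (card Y) \<noteq> (0 :: 'f)"
    and N: "closed_under Y N" "N \<subseteq> supported (dcoset G H g Y)"
  shows "generated_by_le Y N a"
proof -
  let ?O = "dcoset G H g Y"
  note Yc = subgroup.mem_carrier[OF Y]
  interpret FF: vector_space_pair ind_scale ind_scale
    by unfold_locales
  have "Vector_Spaces.linear ind_scale ind_scale (\<lambda>f. f :: 'g \<Rightarrow> 'v)"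
    by (rule F.linear_id[unfolded id_def])
  then obtain \<pi> where \<pi>: "range \<pi> \<subseteq> N" "Vector_Spaces.linear ind_scale ind_scale \<pi>" "\<And>f. f \<in> N \<Longrightarrow> \<pi> f = f"
    using FF.linear_exists_left_inverse_on[of "\<lambda>f. f" N] N(1) unfolding closed_under_def
    by (auto simp: inj_on_def)
  interpret \<pi>: Vector_Spaces.linear ind_scale ind_scale \<pi>
    by (rule \<pi>(2))
  define c where "c = inverse (of_nat (card Y) :: 'f)"
  \<comment> \<open>Maschke's average of a linear projection onto \<open>N\<close>. As
    \<open>\<pi>\<close> is defined on all functions, \<open>P\<close> can be applied to generators
    of the full module on the double coset, and their images generate \<open>N\<close>.\<close>
  define P where "P f = ind_scale c (\<Sum>y\<in>Y. ind_act (\<pi> (ind_act f y)) (inv y))" for f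
  note cN = closed_underD[OF N(1)]
  have \<pi>N: "\<pi> f \<in> N" for f
    using \<pi>(1) by blast
  have PN: "P f \<in> N" for f
    unfolding P_def using N(1) \<pi>N subgroup.m_inv_closed[OF Y]
    by (auto simp: closed_under_def intro!: F.subspace_scale F.subspace_sum)
  have P_add: "P (f + f') = P f + P f'" for f f'
    by (simp add: P_def ind_act_add \<pi>.add sum.distrib F.scale_right_distrib)
  have P_scale: "P (ind_scale r f) = ind_scale r (P f)" for r f
    by (simp add: P_def ind_act_scale \<pi>.scale F.scale_sum_right mult.commute)
  have P_id: "P f = f" if f: "f \<in> N" for f
  proof -
    have fW: "f \<in> W"
      using f N(2) by (auto simp: supported_def)
    have "(\<Sum>y\<in>Y. ind_act (\<pi> (ind_act f y)) (inv y)) = (\<Sum>y\<in>Y. f)"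
    proof (rule sum.cong[OF refl])
      fix y assume y: "y \<in> Y"
      have "\<pi> (ind_act f y) = ind_act f y"
        by (rule \<pi>(3)[OF cN(5)[OF f y]])
      then show "ind_act (\<pi> (ind_act f y)) (inv y) = f"
        using Yc[OF y] W.act_one[OF fW] by (simp add: ind_act_mult)
    qed
    also have "\<dots> = ind_scale (of_nat (card Y)) f"
      by (simp add: F.sum_constant_scale)
    finally show ?thesis
      using nz by (simp add: P_def c_def)
  qed
  have P_act: "P (ind_act f z) = ind_act (P f) z" if z: "z \<in> Y" for f z
  proof -
    have lin: "Vector_Spaces.linear ind_scale ind_scale (\<lambda>f. ind_act f z)"
      by (simp add: Vector_Spaces.linear_iff F.vector_space_axioms ind_act_add ind_act_scale)
    interpret lin: Vector_Spaces.linear ind_scale ind_scale "\<lambda>f. ind_act f z"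
      by (rule lin)
    have zc: "z \<in> carrier G"
      by (rule Yc[OF z])
    have "(\<Sum>y\<in>Y. ind_act (\<pi> (ind_act (ind_act f z) y)) (inv y)) =
        (\<Sum>u\<in>Y. ind_act (\<pi> (ind_act f u)) (inv u \<otimes> z))"
    proof (rule sum.reindex_bij_witness[where i = "\<lambda>u. inv z \<otimes> u" and j = "\<lambda>y. z \<otimes> y"])
      fix y assume y: "y \<in> Y"
      show "inv z \<otimes> (z \<otimes> y) = y" "z \<otimes> (inv z \<otimes> y) = y"
        using zc Yc[OF y] by (simp_all add: gsimps)
      show "z \<otimes> y \<in> Y" "inv z \<otimes> y \<in> Y"
        using subgroup.m_closed[OF Y] subgroup.m_inv_closed[OF Y] y z by auto
      have "inv (z \<otimes> y) \<otimes> z = inv y"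
        using zc Yc[OF y] by (simp add: gsimps)
      then show "ind_act (\<pi> (ind_act f (z \<otimes> y))) (inv (z \<otimes> y) \<otimes> z) =
          ind_act (\<pi> (ind_act (ind_act f z) y)) (inv y)"
        using zc Yc[OF y] by (simp add: ind_act_mult)
    qed
    also have "\<dots> = (\<Sum>u\<in>Y. ind_act (ind_act (\<pi> (ind_act f u)) (inv u)) z)"
      using Yc zc by (intro sum.cong) (simp_all add: ind_act_mult)
    finally show ?thesis
      by (simp add: P_def ind_act_scale lin.sum)
  qed
  obtain B where B: "B \<subseteq> V" "V.independent B" "V \<subseteq> V.span B" "card B = a"
    using V.basis_exists[of V] dim_V by metis
  have finB: "finite B"
    using independent_bound[OF B(2,1)] by simp
  have span: "V.span B = V"
    using B V.span_minimal[OF B(1) V.subspace_W] by blast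
  let ?e = "\<lambda>v. ind_act (induced_embed G H act v) g"
  show ?thesis
    unfolding generated_by_le_def
  proof (intro exI[of _ "(\<lambda>v. P (?e v)) ` B"] conjI allI impI)
    show "card ((\<lambda>v. P (?e v)) ` B) \<le> a"
      using card_image_le[OF finB] B(4) by metis
    fix N' assume N': "closed_under Y N'" and sub: "(\<lambda>v. P (?e v)) ` B \<subseteq> N'"
    note cN' = closed_underD[OF N']
    have P0: "P 0 = 0"
      using P_scale[of 0 0] by simp
    have "closed_under Y {f. P f \<in> N'}"
      by (rule closed_underI) (auto simp: P0 P_add P_scale P_act cN')
    then have "supported ?O \<subseteq> {f. P f \<in> N'}"
      by (rule supported_dcoset_subset[OF Y g _ span B(1)]) (use sub in auto)
    then show "N \<subseteq> N'"
      using N(2) P_id by (metis (mono_tags, lifting) mem_Collect_eq subset_iff)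
  qed (use finB PN in auto)
qed

text \<open>Coset labels are compared lexicographically. \<open>leading\<close> collects the leading coefficients of the
  elements of \<open>N\<close> whose largest label is at most \<open>\<alpha>\<close>; it can only grow when a coordinate is raised.\<close>

definition below :: "nat list \<Rightarrow> (nat list \<Rightarrow> 'g) \<Rightarrow> 'g \<Rightarrow> ('g \<Rightarrow> 'v) set \<Rightarrow> nat list \<Rightarrow> ('g \<Rightarrow> 'v) set" where
  "below qs \<tau> g N \<alpha> = {f \<in> N. \<forall>\<beta>\<in>grid qs. lex_index qs \<alpha> < lex_index qs \<beta> \<longrightarrow> f (g \<otimes> \<tau> \<beta>) = 0}"

definition leading :: "nat list \<Rightarrow> (nat list \<Rightarrow> 'g) \<Rightarrow> 'g \<Rightarrow> ('g \<Rightarrow> 'v) set \<Rightarrow> nat list \<Rightarrow> 'v set" where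
  "leading qs \<tau> g N \<alpha> = (\<lambda>f. f (g \<otimes> \<tau> \<alpha>)) ` below qs \<tau> g N \<alpha>"

lemma subspace_below:
  assumes "closed_under Y N"
  shows "F.subspace (below qs \<tau> g N \<alpha>)"
  using closed_underD[OF assms] unfolding F.subspace_def below_def
  by (auto simp: induced_scale_def)

lemma subspace_leading:
  assumes "closed_under Y N"
  shows "V.subspace (leading qs \<tau> g N \<alpha>)"
proof -
  note b = subspace_below[OF assms, of qs \<tau> g \<alpha>]
  show ?thesis
    unfolding V.subspace_def
  proof (intro conjI ballI allI)
    show "0 \<in> leading qs \<tau> g N \<alpha>"
      unfolding leading_def using F.subspace_0[OF b] by (force intro: image_eqI[of _ _ 0])
    fix v assume "v \<in> leading qs \<tau> g N \<alpha>"
    then obtain f where f: "v = f (g \<otimes> \<tau> \<alpha>)" "f \<in> below qs \<tau> g N \<alpha>"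
      unfolding leading_def by blast
    show "scale r v \<in> leading qs \<tau> g N \<alpha>" for r
      unfolding leading_def using F.subspace_scale[OF b f(2), of r] f(1)
      by (intro image_eqI[of _ _ "ind_scale r f"]) (simp_all add: induced_scale_def)
    fix w assume "w \<in> leading qs \<tau> g N \<alpha>"
    then obtain f' where f': "w = f' (g \<otimes> \<tau> \<alpha>)" "f' \<in> below qs \<tau> g N \<alpha>"
      unfolding leading_def by blast
    show "v + w \<in> leading qs \<tau> g N \<alpha>"
      unfolding leading_def using F.subspace_add[OF b f(2) f'(2)] f(1) f'(1)
      by (intro image_eqI[of _ _ "f + f'"]) simp_all
  qed
qed

section \<open>Generators from leading coefficients along chains\<close>

context
  fixes Y g qs \<tau>
  assumes Y: "subgroup Y G" and g: "g \<in> carrier G"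
    and lab: "labelling G Y (conj_inter H g Y) qs \<tau>"
begin

private lemma tau: "\<alpha> \<in> grid qs \<Longrightarrow> \<tau> \<alpha> \<in> Y" "\<alpha> \<in> grid qs \<Longrightarrow> \<tau> \<alpha> \<in> carrier G"
  using labellingD(1)[OF lab] subgroup.mem_carrier[OF Y] by auto

text \<open>A stabiliser element passes to the left of \<open>g\<close> as an element of
  \<open>H\<close>, and zeros of \<open>f\<close> are shared by a whole coset of
  \<open>H\<close>.\<close>

private lemma eval_zero:
  assumes "f \<in> W" "c \<in> conj_inter H g Y" "\<delta> \<in> grid qs" "f (g \<otimes> \<tau> \<delta>) = 0"
  shows "f (g \<otimes> (c \<otimes> \<tau> \<delta>)) = 0"
proof -
  have c: "c \<in> carrier G" "g \<otimes> c \<otimes> inv g \<in> H"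
    using assms(2) subgroup.mem_carrier[OF Y] by (auto simp: conj_inter_def)
  have "g \<otimes> (c \<otimes> \<tau> \<delta>) = (g \<otimes> c \<otimes> inv g) \<otimes> (g \<otimes> \<tau> \<delta>)"
    using c g tau(2)[OF assms(3)] by (simp add: gsimps)
  then show ?thesis
    using W_eval_zero[OF assms(1) c(2) _ assms(4)] g tau(2)[OF assms(3)] by simp
qed

text \<open>Evaluating \<open>ind_act f x\<close> at the label \<open>\<beta>\<close> reads
  \<open>f\<close> at \<open>g \<otimes> (\<tau> \<beta> \<otimes> inv (\<tau> \<alpha>') \<otimes>
  \<tau> \<alpha>)\<close>. For \<open>\<beta>\<close> beyond \<open>\<alpha>'\<close> the last
  clause of \<open>labelling\<close> places this in a coset beyond \<open>\<alpha>\<close>, where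
  \<open>f\<close> vanishes.\<close>

private lemma raise:
  assumes N: "closed_under Y N" "N \<subseteq> W" and m: "\<alpha> \<in> grid qs" "\<alpha>' \<in> grid qs" "step \<alpha> \<alpha>'"
    and f: "f \<in> below qs \<tau> g N \<alpha>"
  defines "x \<equiv> inv (\<tau> \<alpha>) \<otimes> \<tau> \<alpha>'"
  shows "x \<in> Y" "ind_act f x \<in> below qs \<tau> g N \<alpha>'" "ind_act f x (g \<otimes> \<tau> \<alpha>') = f (g \<otimes> \<tau> \<alpha>)"
proof -
  show x: "x \<in> Y"
    unfolding x_def using tau(1) m subgroup.m_closed[OF Y] subgroup.m_inv_closed[OF Y] by blast
  have fN: "f \<in> N" and fb: "\<And>\<beta>. \<lbrakk>\<beta> \<in> grid qs; lex_index qs \<alpha> < lex_index qs \<beta>\<rbrakk> \<Longrightarrow> f (g \<otimes> \<tau> \<beta>) = 0"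
    using f by (auto simp: below_def)
  have fW: "f \<in> W"
    using fN N(2) by blast
  have eval: "ind_act f x (g \<otimes> \<tau> \<beta>) = f (g \<otimes> (\<tau> \<beta> \<otimes> inv (\<tau> \<alpha>') \<otimes> \<tau> \<alpha>))" if "\<beta> \<in> grid qs" for \<beta>
    using tau(2)[OF that] tau(2)[OF m(1)] tau(2)[OF m(2)] g by (simp add: ind_act_apply x_def gsimps)
  show "ind_act f x (g \<otimes> \<tau> \<alpha>') = f (g \<otimes> \<tau> \<alpha>)"
    unfolding eval[OF m(2)] using tau(2)[OF m(1)] tau(2)[OF m(2)] by (simp add: gsimps)
  have "ind_act f x (g \<otimes> \<tau> \<beta>) = 0" if \<beta>: "\<beta> \<in> grid qs" "lex_index qs \<alpha>' < lex_index qs \<beta>" for \<beta>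
  proof -
    obtain \<delta> h where d: "\<delta> \<in> grid qs" "h \<in> conj_inter H g Y" "lex_index qs \<alpha> < lex_index qs \<delta>"
      "\<tau> \<beta> \<otimes> inv (\<tau> \<alpha>') \<otimes> \<tau> \<alpha> = h \<otimes> \<tau> \<delta>"
      using labellingD(4)[OF lab m(1,2) \<beta>(1) m(3) \<beta>(2)] by blast
    show ?thesis
      unfolding eval[OF \<beta>(1)] d(4) by (rule eval_zero[OF fW d(2,1) fb[OF d(1,3)]])
  qed
  then show "ind_act f x \<in> below qs \<tau> g N \<alpha>'"
    using closed_underD(5)[OF N(1) fN x] by (simp add: below_def)
qed

text \<open>A basis of one leading space extends to a basis of the next, and only the added vectors
  require new generators. The inequality between \<open>X\<close> and \<open>B\<close> carries this
  count to the end of the chain, where independence bounds it by the dimension of \<open>V\<close>.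
  Intersecting with \<open>N\<close> makes the elements that realise a leading coefficient usable
  for subtraction inside \<open>N\<close>.\<close>

private lemma chain_generators:
  assumes N: "closed_under Y N" "N \<subseteq> W"
    and C: "successively step C" "set C \<subseteq> grid qs" "C \<noteq> []"
  shows "\<exists>B X. V.independent B \<and> B \<subseteq> leading qs \<tau> g N (last C) \<and> finite X \<and> X \<subseteq> N \<and> card X \<le> card B \<and>
    (\<forall>N'. closed_under Y N' \<longrightarrow> X \<subseteq> N' \<longrightarrow> (\<forall>\<alpha>\<in>set C. leading qs \<tau> g N \<alpha> \<subseteq> leading qs \<tau> g (N \<inter> N') \<alpha>))"
  using C
proof (induction C rule: rev_induct)
  case (snoc \<alpha> C)
  let ?V = "leading qs \<tau> g N"
  have VV: "?V \<alpha> \<subseteq> V" if "\<alpha> \<in> grid qs" for \<alpha>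
    using N(2) W_mem_V g tau(2)[OF that] by (auto simp: leading_def below_def)
  have \<alpha>: "\<alpha> \<in> grid qs"
    using snoc.prems by simp
  \<comment> \<open>The basis inherited from the preceding label, empty at the start of the
    chain.\<close>
  have "\<exists>B X. V.independent B \<and> B \<subseteq> ?V \<alpha> \<and> finite X \<and> X \<subseteq> N \<and> card X \<le> card B \<and>
    (\<forall>N'. closed_under Y N' \<longrightarrow> X \<subseteq> N' \<longrightarrow>
      (\<forall>\<alpha>\<in>set C. ?V \<alpha> \<subseteq> leading qs \<tau> g (N \<inter> N') \<alpha>) \<and> B \<subseteq> leading qs \<tau> g (N \<inter> N') \<alpha>)"
  proof (cases "C = []")
    case True
    then show ?thesis
      by (intro exI[of _ "{}"]) (auto simp: V.independent_empty)
  next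
    case False
    have st: "step (last C) \<alpha>" "successively step C"
      using snoc.prems False by (auto simp: successively_append_iff)
    have l: "last C \<in> grid qs" "set C \<subseteq> grid qs"
      using snoc.prems False by auto
    obtain B X where B: "V.independent B" "B \<subseteq> ?V (last C)" "finite X" "X \<subseteq> N" "card X \<le> card B"
      and gens: "\<forall>N'. closed_under Y N' \<longrightarrow> X \<subseteq> N' \<longrightarrow>
        (\<forall>\<alpha>\<in>set C. ?V \<alpha> \<subseteq> leading qs \<tau> g (N \<inter> N') \<alpha>)"
      using snoc.IH[OF st(2) l(2) False] by (elim exE conjE)
    \<comment> \<open>Used for \<open>N\<close> and for \<open>N \<inter> N'\<close>: translates of
      elements already obtained supply the inherited basis vectors at the new label.\<close>
    have up: "leading qs \<tau> g M (last C) \<subseteq> leading qs \<tau> g M \<alpha>" if M: "closed_under Y M" "M \<subseteq> W" for M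
    proof
      fix v assume "v \<in> leading qs \<tau> g M (last C)"
      then obtain f where f: "v = f (g \<otimes> \<tau> (last C))" "f \<in> below qs \<tau> g M (last C)"
        unfolding leading_def by blast
      show "v \<in> leading qs \<tau> g M \<alpha>"
        unfolding leading_def f(1) raise(3)[OF M l(1) \<alpha> st(1) f(2), symmetric]
        by (rule imageI, rule raise(2)[OF M l(1) \<alpha> st(1) f(2)])
    qed
    have "B \<subseteq> leading qs \<tau> g (N \<inter> N') \<alpha>" if "closed_under Y N'" "X \<subseteq> N'" for N'
    proof -
      have "B \<subseteq> leading qs \<tau> g (N \<inter> N') (last C)"
        using B(2) gens[rule_format, OF that, of "last C"] False by auto
      also have "\<dots> \<subseteq> leading qs \<tau> g (N \<inter> N') \<alpha>"
        by (rule up[OF closed_under_Int[OF N(1) that(1)]]) (use N(2) in blast)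
      finally show ?thesis .
    qed
    then show ?thesis
      using B(1,3-5) gens order_trans[OF B(2) up[OF N]] by (intro exI[of _ B] exI[of _ X]) simp
  qed
  then obtain B X where B: "V.independent B" "B \<subseteq> ?V \<alpha>" "finite X" "X \<subseteq> N" "card X \<le> card B"
      and gens: "\<forall>N'. closed_under Y N' \<longrightarrow> X \<subseteq> N' \<longrightarrow>
        (\<forall>\<alpha>\<in>set C. ?V \<alpha> \<subseteq> leading qs \<tau> g (N \<inter> N') \<alpha>) \<and> B \<subseteq> leading qs \<tau> g (N \<inter> N') \<alpha>"
    by (elim exE conjE)
  obtain B' where B': "B \<subseteq> B'" "B' \<subseteq> ?V \<alpha>" "V.independent B'" "?V \<alpha> \<subseteq> V.span B'"
    using V.maximal_independent_subset_extend[OF B(2,1)] by blast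
  have finB': "finite B'"
    using independent_bound[OF B'(3)] B'(2) VV[OF \<alpha>] by blast
  have "\<forall>v\<in>B'. \<exists>f. f \<in> below qs \<tau> g N \<alpha> \<and> f (g \<otimes> \<tau> \<alpha>) = v"
    using B'(2) unfolding leading_def by blast
  then obtain F where F: "\<And>v. v \<in> B' \<Longrightarrow> F v \<in> below qs \<tau> g N \<alpha> \<and> F v (g \<otimes> \<tau> \<alpha>) = v"
    by metis
  define X' where "X' = X \<union> F ` (B' - B)"
  have "card X' \<le> card X + card (F ` (B' - B))"
    unfolding X'_def by (rule card_Un_le)
  also have "\<dots> \<le> card B + card (B' - B)"
    using B(5) card_image_le[of "B' - B" F] finB' by (intro add_mono) auto
  also have "\<dots> = card B'"
    using card_Diff_subset[of B B'] card_mono[OF finB' B'(1)] finite_subset[OF B'(1) finB'] B'(1) by simp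
  finally have card: "card X' \<le> card B'" .
  have X'N: "X' \<subseteq> N"
    using B(4) F by (auto simp: X'_def below_def)
  have "?V \<beta> \<subseteq> leading qs \<tau> g (N \<inter> N') \<beta>"
    if N': "closed_under Y N'" "X' \<subseteq> N'" and \<beta>: "\<beta> \<in> set (C @ [\<alpha>])" for N' \<beta>
  proof (cases "\<beta> \<in> set C")
    case True
    then show ?thesis
      using gens N' by (simp add: X'_def)
  next
    case False
    then have [simp]: "\<beta> = \<alpha>"
      using \<beta> by simp
    have "v \<in> leading qs \<tau> g (N \<inter> N') \<alpha>" if v: "v \<in> B'" for v
    proof (cases "v \<in> B")
      case True
      then show ?thesis
        using gens N' by (auto simp: X'_def)
    next
      case False
      then have "F v \<in> below qs \<tau> g (N \<inter> N') \<alpha>"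
        using F[OF v] N'(2) v by (auto simp: below_def X'_def)
      then show ?thesis
        unfolding leading_def using F[OF v] by (intro image_eqI[of _ _ "F v"]) simp_all
    qed
    then have "V.span B' \<subseteq> leading qs \<tau> g (N \<inter> N') \<alpha>"
      by (intro V.span_minimal subspace_leading[OF closed_under_Int[OF N(1) N'(1)]]) blast
    then show ?thesis
      using B'(4) by simp
  qed
  moreover have "finite X'"
    using B(3) finB' by (simp add: X'_def)
  ultimately show ?case
    using B'(2,3) card X'N by (intro exI[of _ B'] exI[of _ X']) auto
qed simp

lemma generated_by_le_labelling:
  assumes N: "closed_under Y N" "N \<subseteq> supported (dcoset G H g Y)"
    and Cs: "set (concat Cs) = grid qs" "\<And>C. C \<in> set Cs \<Longrightarrow> C \<noteq> [] \<and> successively step C"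
  shows "generated_by_le Y N (a * length Cs)"
proof -
  have NW: "N \<subseteq> W"
    using N(2) by (auto simp: supported_def)
  have "\<exists>X. finite X \<and> X \<subseteq> N \<and> card X \<le> a \<and> (\<forall>N'. closed_under Y N' \<longrightarrow> X \<subseteq> N' \<longrightarrow>
      (\<forall>\<alpha>\<in>set C. leading qs \<tau> g N \<alpha> \<subseteq> leading qs \<tau> g (N \<inter> N') \<alpha>))" if C: "C \<in> set Cs" for C
  proof -
    have sub: "set C \<subseteq> grid qs" "C \<noteq> []" "successively step C"
      using C Cs by auto
    obtain B X where BX: "V.independent B" "B \<subseteq> leading qs \<tau> g N (last C)" "finite X" "X \<subseteq> N" "card X \<le> card B"
      "\<forall>N'. closed_under Y N' \<longrightarrow> X \<subseteq> N' \<longrightarrow>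
        (\<forall>\<alpha>\<in>set C. leading qs \<tau> g N \<alpha> \<subseteq> leading qs \<tau> g (N \<inter> N') \<alpha>)"
      using chain_generators[OF N(1) NW sub(3,1,2)] by blast
    have "last C \<in> grid qs"
      using sub by auto
    then have "leading qs \<tau> g N (last C) \<subseteq> V"
      using NW W_mem_V g tau(2) by (auto simp: leading_def below_def)
    then have "card B \<le> a"
      using independent_bound[OF BX(1)] BX(2) by blast
    then show ?thesis
      using BX(3-6) by (intro exI[of _ X]) auto
  qed
  then obtain X where X: "\<And>C. C \<in> set Cs \<Longrightarrow> finite (X C) \<and> X C \<subseteq> N \<and> card (X C) \<le> a \<and>
      (\<forall>N'. closed_under Y N' \<longrightarrow> X C \<subseteq> N' \<longrightarrow>
        (\<forall>\<alpha>\<in>set C. leading qs \<tau> g N \<alpha> \<subseteq> leading qs \<tau> g (N \<inter> N') \<alpha>))"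
    by metis
  show ?thesis
    unfolding generated_by_le_def
  proof (intro exI[of _ "\<Union>C\<in>set Cs. X C"] conjI allI impI)
    show "finite (\<Union>C\<in>set Cs. X C)"
      using X by simp
    show "(\<Union>C\<in>set Cs. X C) \<subseteq> N"
      using X by blast
    have "card (\<Union>C\<in>set Cs. X C) \<le> (\<Sum>C\<in>set Cs. card (X C))"
      by (rule card_UN_le) simp
    also have "\<dots> \<le> (\<Sum>C\<in>set Cs. a)"
      by (rule sum_mono) (use X in auto)
    also have "\<dots> \<le> a * length Cs"
      by (simp add: card_length mult.commute)
    finally show "card (\<Union>C\<in>set Cs. X C) \<le> a * length Cs" .
    fix N' assume N': "closed_under Y N'" and sub: "(\<Union>C\<in>set Cs. X C) \<subseteq> N'"
    have lead: "leading qs \<tau> g N \<alpha> \<subseteq> leading qs \<tau> g (N \<inter> N') \<alpha>" if \<alpha>: "\<alpha> \<in> grid qs" for \<alpha>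
    proof -
      obtain C where C: "C \<in> set Cs" "\<alpha> \<in> set C"
        using \<alpha> Cs(1) by auto
      then show ?thesis
        using X[OF C(1)] N' sub by blast
    qed
    \<comment> \<open>Division by leading terms: \<open>n\<close> bounds the labels at which
      \<open>f\<close> may be nonzero, and subtracting an element of \<open>N \<inter> N'\<close>
      with the same leading coefficient lowers it. At \<open>n = 0\<close> the function vanishes on
      the whole double coset, hence everywhere.\<close>
    have "f \<in> N'" if "f \<in> N" "\<forall>\<beta>\<in>grid qs. n \<le> lex_index qs \<beta> \<longrightarrow> f (g \<otimes> \<tau> \<beta>) = 0" for f n
      using that
    proof (induction n arbitrary: f)
      case 0
      have fW: "f \<in> W"
        using 0 NW by blast
      have "f x = 0" for x
      proof (cases "x \<in> dcoset G H g Y")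
        case True
        then obtain h y where x: "x = h \<otimes> g \<otimes> y" "h \<in> H" "y \<in> Y"
          by (rule dcosetE)
        obtain \<alpha> c where \<alpha>: "\<alpha> \<in> grid qs" "c \<in> conj_inter H g Y" "y = c \<otimes> \<tau> \<alpha>"
          using labellingD(2)[OF lab x(3)] by blast
        have "f (g \<otimes> y) = 0"
          unfolding \<alpha>(3) by (rule eval_zero[OF fW \<alpha>(2,1)]) (use 0(2) \<alpha>(1) in simp)
        then show ?thesis
          using W_eval_zero[OF fW x(2), of "g \<otimes> y"] g Hc[OF x(2)] subgroup.mem_carrier[OF Y x(3)]
          by (simp add: x(1) gsimps)
      qed (use 0(1) N(2) in \<open>auto simp: supported_def\<close>)
      then have "f = 0"
        by (simp add: fun_eq_iff)
      then show ?case
        using closed_underD(1)[OF N'] by metis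
    next
      case (Suc n)
      show ?case
      proof (cases "\<exists>\<alpha>\<in>grid qs. lex_index qs \<alpha> = n")
        case True
        then obtain \<alpha> where \<alpha>: "\<alpha> \<in> grid qs" "lex_index qs \<alpha> = n"
          by blast
        have "f \<in> below qs \<tau> g N \<alpha>"
          using Suc.prems \<alpha>(2) by (auto simp: below_def)
        then have "f (g \<otimes> \<tau> \<alpha>) \<in> leading qs \<tau> g (N \<inter> N') \<alpha>"
          using lead[OF \<alpha>(1)] unfolding leading_def by blast
        then obtain f' where f': "f (g \<otimes> \<tau> \<alpha>) = f' (g \<otimes> \<tau> \<alpha>)" "f' \<in> below qs \<tau> g (N \<inter> N') \<alpha>"
          unfolding leading_def by blast
        have f'N: "f' \<in> N" "f' \<in> N'"
          using f'(2) by (auto simp: below_def)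
        have "f - f' \<in> N'"
        proof (rule Suc.IH)
          show "f - f' \<in> N"
            by (rule closed_underD(3)[OF N(1) Suc.prems(1) f'N(1)])
          show "\<forall>\<beta>\<in>grid qs. n \<le> lex_index qs \<beta> \<longrightarrow> (f - f') (g \<otimes> \<tau> \<beta>) = 0"
          proof (intro ballI impI)
            fix \<beta> assume \<beta>: "\<beta> \<in> grid qs" "n \<le> lex_index qs \<beta>"
            show "(f - f') (g \<otimes> \<tau> \<beta>) = 0"
            proof (cases "lex_index qs \<beta> = n")
              case True
              then have "\<beta> = \<alpha>"
                using lex_index_inj[OF \<beta>(1) \<alpha>(1)] \<alpha>(2) by simp
              then show ?thesis
                using f'(1) by simp
            next
              case False
              then have "f (g \<otimes> \<tau> \<beta>) = 0" "f' (g \<otimes> \<tau> \<beta>) = 0"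
                using Suc.prems(2) f'(2) \<beta> \<alpha>(2) by (auto simp: below_def)
              then show ?thesis
                by simp
            qed
          qed
        qed
        then have "f - f' + f' \<in> N'"
          using closed_underD(2)[OF N'] f'N(2) by blast
        then show ?thesis
          by simp
      next
        case False
        then have "\<forall>\<beta>\<in>grid qs. n \<le> lex_index qs \<beta> \<longrightarrow> f (g \<otimes> \<tau> \<beta>) = 0"
          using Suc.prems(2) by (metis Suc_leI le_neq_implies_less)
        then show ?thesis
          using Suc.IH Suc.prems(1) by blast
      qed
    qed
    \<comment> \<open>All indices are below \<open>prod_list qs\<close>, so at this value the
      vanishing condition is empty.\<close>
    from this[of _ "prod_list qs"] show "N \<subseteq> N'"
      using lex_index_less by (meson leD subsetI)
  qed
qed

end

end

section \<open>Soluble transitive subgroups of the coset action\<close>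

context group
begin

definition coset_perm :: "'a set \<Rightarrow> 'a \<Rightarrow> 'a set \<Rightarrow> 'a set" where
  "coset_perm H g = (\<lambda>C\<in>rcosets H. C #> g)"

text \<open>For a subgroup \<open>H\<close> this is its normal core in \<open>G\<close>.\<close>

definition coset_kernel :: "'a set \<Rightarrow> 'a set" where
  "coset_kernel H = {k \<in> carrier G. \<forall>C\<in>rcosets H. C #> k = C}"

lemma coset_perm_facts:
  assumes H: "subgroup H G"
  shows "\<lbrakk>C \<in> rcosets H; g \<in> carrier G\<rbrakk> \<Longrightarrow> C #> g \<in> rcosets H"
    and "\<lbrakk>C \<in> rcosets H; g \<in> carrier G; h \<in> carrier G\<rbrakk> \<Longrightarrow> C #> g #> h = C #> (g \<otimes> h)"
    and "C \<in> rcosets H \<Longrightarrow> C #> \<one> = C"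
    and "g \<in> carrier G \<Longrightarrow> coset_perm H g \<in> carrier (BijGroup (rcosets H))"
    and "\<lbrakk>g \<in> carrier G; h \<in> carrier G\<rbrakk> \<Longrightarrow>
      coset_perm H h \<otimes>\<^bsub>BijGroup (rcosets H)\<^esub> coset_perm H g = coset_perm H (g \<otimes> h)"
    and "coset_perm H \<one> = \<one>\<^bsub>BijGroup (rcosets H)\<^esub>"
proof -
  have sub: "C \<subseteq> carrier G" if "C \<in> rcosets H" for C
    using that subgroup.rcosets_carrier[OF H is_group] by blast
  show closed: "C #> g \<in> rcosets H" if "C \<in> rcosets H" "g \<in> carrier G" for C g
    using that subgroup.subset[OF H] unfolding RCOSETS_def by (auto simp: coset_mult_assoc)
  show comp: "C #> g #> h = C #> (g \<otimes> h)" if "C \<in> rcosets H" "g \<in> carrier G" "h \<in> carrier G" for C g h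
    using coset_mult_assoc[OF sub] that by blast
  show one: "C #> \<one> = C" if "C \<in> rcosets H" for C
    by (rule coset_mult_one[OF sub[OF that]])
  have "coset_perm H g \<in> coset_permutation_group G H" if "g \<in> carrier G" for g
    using that by (auto simp: coset_perm_def coset_permutation_group_def)
  then show carr: "coset_perm H g \<in> carrier (BijGroup (rcosets H))" if "g \<in> carrier G" for g
    using that subgroup.subset[OF subgroup_coset_permutation_group[OF is_group H]] by blast
  show "coset_perm H h \<otimes>\<^bsub>BijGroup (rcosets H)\<^esub> coset_perm H g = coset_perm H (g \<otimes> h)"
    if "g \<in> carrier G" "h \<in> carrier G" for g h
    using that carr[OF that(1)] carr[OF that(2)] closed comp
    by (auto simp: BijGroup_def compose_def fun_eq_iff coset_perm_def)
  show "coset_perm H \<one> = \<one>\<^bsub>BijGroup (rcosets H)\<^esub>"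
    by (auto simp: BijGroup_def fun_eq_iff coset_perm_def one)
qed

lemma coset_kernel_iff:
  assumes "g \<in> carrier G"
  shows "g \<in> coset_kernel H \<longleftrightarrow> coset_perm H g = (\<lambda>C\<in>rcosets H. C)"
  using assms by (auto simp: coset_kernel_def coset_perm_def restrict_def fun_eq_iff)

text \<open>The last clause serves to absorb a kernel factor on the right of a double coset into
  \<open>H\<close> on the left.\<close>

lemma coset_kernel:
  assumes fin: "finite (carrier G)" and H: "subgroup H G"
  shows "subgroup (coset_kernel H) G" "normalizes G (carrier G) (coset_kernel H)" "coset_kernel H \<subseteq> H"
    and "\<lbrakk>k \<in> coset_kernel H; x \<in> carrier G\<rbrakk> \<Longrightarrow> \<exists>h\<in>H. x \<otimes> k = h \<otimes> x"
proof -
  note f = coset_perm_facts[OF H]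
  have c: "k \<in> carrier G" if "k \<in> coset_kernel H" for k
    using that by (simp add: coset_kernel_def)
  show "subgroup (coset_kernel H) G"
  proof (rule closed_imp_subgroup)
    show sub: "coset_kernel H \<subseteq> carrier G"
      using c by blast
    show "finite (coset_kernel H)"
      by (rule finite_subset[OF sub fin])
    show "\<one> \<in> coset_kernel H"
      using f(3) by (simp add: coset_kernel_def)
    fix x y assume x: "x \<in> coset_kernel H" and y: "y \<in> coset_kernel H"
    have "C #> (x \<otimes> y) = C" if "C \<in> rcosets H" for C
      using f(2)[OF that c[OF x] c[OF y]] x y that by (simp add: coset_kernel_def)
    then show "x \<otimes> y \<in> coset_kernel H"
      using c[OF x] c[OF y] by (simp add: coset_kernel_def)
  qed
  show "normalizes G (carrier G) (coset_kernel H)"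
    unfolding normalizes_def
  proof (intro ballI)
    fix y n assume y: "y \<in> carrier G" and n: "n \<in> coset_kernel H"
    have "C #> (y \<otimes> n \<otimes> inv y) = C" if C: "C \<in> rcosets H" for C
    proof -
      have "C #> (y \<otimes> n \<otimes> inv y) = C #> y #> n #> inv y"
        using f(1,2) C y c[OF n] by simp
      also have "\<dots> = C #> y #> inv y"
        using n f(1)[OF C y] by (simp add: coset_kernel_def)
      also have "\<dots> = C"
        using f(2,3) C y by simp
      finally show ?thesis .
    qed
    then show "y \<otimes> n \<otimes> inv y \<in> coset_kernel H"
      using y c[OF n] by (simp add: coset_kernel_def)
  qed
  show ex: "\<exists>h\<in>H. x \<otimes> k = h \<otimes> x" if k: "k \<in> coset_kernel H" and x: "x \<in> carrier G" for k x
  proof -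
    have "H #> x \<in> rcosets H"
      using x subgroup.subset[OF H] by (rule rcosetsI[rotated])
    then have "H #> x #> k = H #> x"
      using k by (simp add: coset_kernel_def)
    moreover have "x \<otimes> k \<in> H #> x #> k"
      using rcos_self[OF x H] unfolding r_coset_def by blast
    ultimately show ?thesis
      unfolding r_coset_def by blast
  qed
  show "coset_kernel H \<subseteq> H"
  proof
    fix k assume k: "k \<in> coset_kernel H"
    obtain h where "h \<in> H" "\<one> \<otimes> k = h \<otimes> \<one>"
      using ex[OF k one_closed] by blast
    then show "k \<in> H"
      using c[OF k] subgroup.mem_carrier[OF H] by simp
  qed
qed

text \<open>The witness is the full preimage of the soluble group, which need not be soluble itself:
  its derived series is only brought into the kernel. The labellings and Hall's theorem ask for no
  more than that.\<close>

lemma soluble_transitive_preimage: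
  assumes fin: "finite (carrier G)" and H: "subgroup H G"
    and sol: "has_soluble_transitive_subgroup (rcosets H) (coset_permutation_group G H)"
  obtains Y n where "subgroup Y G" "\<And>g. g \<in> carrier G \<Longrightarrow> \<exists>h\<in>H. \<exists>y\<in>Y. g = h \<otimes> y"
    "(derived G ^^ n) Y \<subseteq> coset_kernel H"
proof -
  let ?B = "BijGroup (rcosets H)"
  interpret B: group ?B
    by (rule group_BijGroup)
  note f = coset_perm_facts[OF H]
  obtain T where T: "T \<subseteq> coset_permutation_group G H" "subgroup T ?B" "solvable (?B\<lparr>carrier := T\<rparr>)"
    "transitive_action (?B\<lparr>carrier := T\<rparr>) (rcosets H) (\<lambda>t. t)"
    using sol unfolding has_soluble_transitive_subgroup_def by blast
  interpret T: group "?B\<lparr>carrier := T\<rparr>"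
    by (rule subgroup.subgroup_is_group[OF T(2) B.is_group])
  define pre where "pre U = {g \<in> carrier G. coset_perm H g \<in> U}" for U
  have pre: "subgroup (pre U) G" if U: "subgroup U ?B" for U
  proof (rule closed_imp_subgroup)
    show "pre U \<subseteq> carrier G" "finite (pre U)"
      using fin by (auto simp: pre_def)
    show "\<one> \<in> pre U"
      using f(6) subgroup.one_closed[OF U] by (simp add: pre_def)
    show "x \<otimes> y \<in> pre U" if "x \<in> pre U" "y \<in> pre U" for x y
      using that f(5)[of x y] subgroup.m_closed[OF U, of "coset_perm H y" "coset_perm H x"]
      by (simp add: pre_def)
  qed
  have inv: "coset_perm H (inv g) = inv\<^bsub>?B\<^esub> (coset_perm H g)" if g: "g \<in> carrier G" for g
  proof -
    have "coset_perm H (inv g) \<otimes>\<^bsub>?B\<^esub> coset_perm H g = \<one>\<^bsub>?B\<^esub>"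
      using f(5)[OF g inv_closed[OF g]] f(6) g by simp
    then show ?thesis
      using B.inv_equality f(4) g by (metis inv_closed)
  qed
  have ds: "subgroup ((derived ?B ^^ n) T) ?B" for n
    by (rule B.exp_of_derived_is_subgroup[OF T(2)])
  have der: "(derived G ^^ n) (pre T) \<subseteq> pre ((derived ?B ^^ n) T)" for n
  proof (induction n)
    case (Suc n)
    let ?U = "(derived ?B ^^ n) T"
    have "derived G (pre ?U) \<subseteq> pre (derived ?B ?U)"
      unfolding derived_subset_iff[OF pre[OF B.derived_is_subgroup[OF subgroup.subset[OF ds]]]]
    proof (intro ballI)
      fix a b assume ab: "a \<in> pre ?U" "b \<in> pre ?U"
      have c: "a \<in> carrier G" "b \<in> carrier G" "coset_perm H a \<in> ?U" "coset_perm H b \<in> ?U"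
        using ab by (auto simp: pre_def)
      note c' = f(4)[OF c(1)] f(4)[OF c(2)]
      \<comment> \<open>Right multiplications compose in reverse order in \<open>BijGroup\<close>,
        so the commutator of \<open>a\<close> and \<open>b\<close> goes to the commutator of the
        inverses of their images, with the two arguments exchanged.\<close>
      have "coset_perm H (a \<otimes> b \<otimes> inv a \<otimes> inv b) =
          coset_perm H (inv b) \<otimes>\<^bsub>?B\<^esub> (coset_perm H (inv a) \<otimes>\<^bsub>?B\<^esub> (coset_perm H b \<otimes>\<^bsub>?B\<^esub> coset_perm H a))"
        using c(1,2) by (simp add: f(5))
      also have "\<dots> = inv\<^bsub>?B\<^esub> (coset_perm H b) \<otimes>\<^bsub>?B\<^esub> inv\<^bsub>?B\<^esub> (coset_perm H a) \<otimes>\<^bsub>?B\<^esub>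
          inv\<^bsub>?B\<^esub> (inv\<^bsub>?B\<^esub> (coset_perm H b)) \<otimes>\<^bsub>?B\<^esub> inv\<^bsub>?B\<^esub> (inv\<^bsub>?B\<^esub> (coset_perm H a))"
        using c' by (simp add: inv c(1,2) B.m_assoc)
      also have "\<dots> \<in> derived ?B ?U"
        using c subgroup.m_inv_closed[OF ds] by (intro B.derived_commutator) auto
      finally show "a \<otimes> b \<otimes> inv a \<otimes> inv b \<in> pre (derived ?B ?U)"
        using c(1,2) by (simp add: pre_def)
    qed
    then show ?case
      using mono_derived[OF Suc] by auto
  qed simp
  obtain n where n: "(derived (?B\<lparr>carrier := T\<rparr>) ^^ n) T = {\<one>\<^bsub>?B\<^esub>}"
    using T.solvable_iff_trivial_derived_seq T(3) by auto
  have "(derived (?B\<lparr>carrier := T\<rparr>) ^^ k) T = (derived ?B ^^ k) T \<and> (derived ?B ^^ k) T \<subseteq> T" for k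
  proof (induction k)
    case (Suc k)
    then show ?case
      using B.derived_consistent[OF _ T(2), of "(derived ?B ^^ k) T"] B.derived_incl[OF _ T(2), of "(derived ?B ^^ k) T"]
      by simp
  qed simp
  then have n': "(derived ?B ^^ n) T = {\<one>\<^bsub>?B\<^esub>}"
    using n by simp
  show ?thesis
  proof (rule that[of "pre T" n])
    show "subgroup (pre T) G"
      by (rule pre[OF T(2)])
    have "pre {\<one>\<^bsub>?B\<^esub>} \<subseteq> coset_kernel H"
      using coset_kernel_iff by (auto simp: pre_def BijGroup_def)
    then show "(derived G ^^ n) (pre T) \<subseteq> coset_kernel H"
      using der[of n] n' by simp
    fix g assume g: "g \<in> carrier G"
    interpret TA: transitive_action "?B\<lparr>carrier := T\<rparr>" "rcosets H" "\<lambda>t. t"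
      by (rule T(4))
    have HH: "H \<in> rcosets H"
      by (rule subgroup.subgroup_in_rcosets[OF H is_group])
    have Hg: "H #> g \<in> rcosets H"
      using g subgroup.subset[OF H] by (rule rcosetsI[rotated])
    obtain t where t: "t \<in> T" "t H = H #> g"
      using TA.unique_orbit[OF HH Hg] by auto
    then obtain y where y: "y \<in> carrier G" "t = coset_perm H y"
      using T(1) unfolding coset_permutation_group_def coset_perm_def by blast
    have "H #> y = H #> g"
      using t(2) HH by (simp add: y coset_perm_def)
    then have "g \<in> H #> y"
      using rcos_self[OF g H] by simp
    then obtain h where "h \<in> H" "g = h \<otimes> y"
      unfolding r_coset_def by blast
    moreover have "y \<in> pre T"
      using y t by (simp add: pre_def)
    ultimately show "\<exists>h\<in>H. \<exists>y\<in>pre T. g = h \<otimes> y"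
      by blast
  qed
qed

end

section \<open>The bounds\<close>

text \<open>Meant for \<open>c = card H\<close>, the index \<open>s\<close> and an orbit length
  \<open>o'\<close>. A Sylow \<open>q\<close>-subgroup of \<open>G\<close> has the full
  \<open>q\<close>-part of \<open>c * s\<close> as its order; cancelling the \<open>q\<close>-part
  of \<open>c\<close> leaves that of \<open>s\<close>.\<close>

lemma p_part_dvd_quotient:
  fixes c s o' q :: nat
  assumes "prime q" "c > 0" "s > 0" "o' > 0" "q ^ multiplicity q (c * s) dvd c * o'"
  shows "p_part s q dvd o'"
proof -
  have "multiplicity q (c * s) \<le> multiplicity q (c * o')"
    using assms by (intro multiplicity_geI) (auto simp: not_prime_unit)
  then have "multiplicity q s \<le> multiplicity q o'"
    using assms by (simp add: prime_elem_multiplicity_mult_distrib)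
  then show ?thesis
    unfolding p_part_def by (rule multiplicity_dvd')
qed

context induced_setup
begin

section \<open>Orbits on the cosets of \<open>H\<close>\<close>

definition orbs :: "'g set \<Rightarrow> 'g set set" where
  "orbs Y = (\<lambda>g. dcoset G H g Y) ` carrier G"

lemma orbs:
  assumes Y: "subgroup Y G"
  shows "finite (orbs Y)" "\<Union> (orbs Y) = carrier G" "(\<Sum>U\<in>orbs Y. card U) = card (carrier G)"
proof -
  show "finite (orbs Y)"
    using finite_G by (simp add: orbs_def)
  show Un: "\<Union> (orbs Y) = carrier G"
    unfolding orbs_def
    using dcoset_subset[OF subgroup_H Y] dcoset_self[OF subgroup_H Y] by blast
  have "card (\<Union> (orbs Y)) = sum card (orbs Y)"
  proof (rule card_Union_disjoint)
    show "pairwise disjnt (orbs Y)"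
      using dcoset_disjoint[OF subgroup_H Y] by (auto simp: pairwise_def disjnt_def orbs_def)
    show "finite A" if "A \<in> orbs Y" for A
      using that Un finite_G by (metis Union_upper finite_subset)
  qed
  then show "(\<Sum>U\<in>orbs Y. card U) = card (carrier G)"
    by (simp add: Un)
qed

lemma dcoset_closed_right:
  assumes "subgroup Y G" "g \<in> carrier G" "u \<in> dcoset G H g Y" "y \<in> Y"
  shows "u \<otimes> y \<in> dcoset G H g Y"
  using dcoset_closed[OF subgroup_H assms(1-3) subgroup.one_closed[OF subgroup_H] assms(4)]
    dcoset_subset[OF subgroup_H assms(1,2)] assms(3) by (simp add: subset_iff)

lemma dcoset_closed_left:
  assumes "subgroup Y G" "g \<in> carrier G" "u \<in> dcoset G H g Y" "h \<in> H"
  shows "h \<otimes> u \<in> dcoset G H g Y"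
  using dcoset_closed[OF subgroup_H assms(1-4) subgroup.one_closed[OF assms(1)]]
    dcoset_subset[OF subgroup_H assms(1,2)] assms(3) Hc[OF assms(4)] by (simp add: subset_iff)

lemma card_dcoset_multiple:
  assumes Y: "subgroup Y G" and g: "g \<in> carrier G"
  obtains m where "card (dcoset G H g Y) = card H * m" "m > 0"
proof -
  have sub: "dcoset G H g Y \<subseteq> carrier G"
    by (rule dcoset_subset[OF subgroup_H Y g])
  have "card H dvd card (dcoset G H g Y)"
    by (rule card_dvd_card_left[OF finite_G subgroup_H sub]) (rule dcoset_closed_left[OF Y g])
  then obtain m where m: "card (dcoset G H g Y) = card H * m"
    by blast
  have "card (dcoset G H g Y) > 0"
    using dcoset_self[OF subgroup_H Y g] sub finite_G by (metis card_gt_0_iff empty_iff finite_subset)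
  then show ?thesis
    using that m by (metis gr0I mult_0_right less_irrefl)
qed

definition "index = card (rcosets H)"

lemma card_G: "card (carrier G) = card H * index"
  using lagrange[OF subgroup_H] by (simp add: order_def index_def mult.commute)

lemma card_pos: "card H > 0" "card (carrier G) > 0" "index > 0"
  using card_subgroup_pos[OF finite_G subgroup_H] card_subgroup_pos[OF finite_G subgroup_self] card_G
  by (auto intro: gr0I)

lemma supported_carrier: "supported (carrier G) = W"
  using W_outside by (auto simp: supported_def)

context
  fixes M
  assumes M: "group_submodule G ind_scale ind_act M W"
begin

abbreviation (input) dG where "dG \<equiv> min_generators G ind_scale ind_act M"

private lemma M_closed: "Y \<subseteq> carrier G \<Longrightarrow> closed_under Y M"
  using M by (auto simp: group_submodule_def closed_under_def)

private lemma M_sub: "M \<subseteq> W"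
  using M by (simp add: group_submodule_def)

private lemma d_le_sum:
  assumes Y: "subgroup Y G"
    and b: "\<And>g N. \<lbrakk>g \<in> carrier G; closed_under Y N; N \<subseteq> supported (dcoset G H g Y)\<rbrakk> \<Longrightarrow>
      generated_by_le Y N (b (dcoset G H g Y))"
  shows "dG \<le> (\<Sum>U\<in>orbs Y. b U)"
proof (rule min_generators_le[OF M subgroup.subset[OF Y]])
  show "generated_by_le Y M (\<Sum>U\<in>orbs Y. b U)"
  proof (rule generated_by_le_sum[OF Y orbs(1)[OF Y]])
    show "orbs Y \<subseteq> (\<lambda>g. dcoset G H g Y) ` carrier G"
      by (simp add: orbs_def)
    show "M \<subseteq> supported (\<Union> (orbs Y))"
      unfolding orbs(2)[OF Y] supported_carrier by (rule M_sub)
    show "generated_by_le Y N (b U)" if "U \<in> orbs Y" "closed_under Y N" "N \<subseteq> supported U" for U N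
      using that b by (auto simp: orbs_def)
  qed (rule M_closed[OF subgroup.subset[OF Y]])
qed

text \<open>Each orbit costs \<open>a\<close> generators, and orbits of length at least
  \<open>m\<close> number at most \<open>index / m\<close>; the product form stays within the
  natural numbers.\<close>

lemma min_generators_semisimple:
  assumes Y: "subgroup Y G" and nz: "of_nat (card Y) \<noteq> (0 :: 'f)"
    and m: "\<And>g. g \<in> carrier G \<Longrightarrow> card H * m \<le> card (dcoset G H g Y)"
  shows "dG * m \<le> a * index"
proof -
  have "dG \<le> (\<Sum>U\<in>orbs Y. a)"
    using generated_by_le_semisimple[OF Y _ nz] by (intro d_le_sum[OF Y])
  then have "dG * m \<le> a * (card (orbs Y) * m)"
    by (simp add: mult_right_mono ac_simps)
  also have "card (orbs Y) * m \<le> index"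
  proof -
    have "card H * (card (orbs Y) * m) = (\<Sum>U\<in>orbs Y. card H * m)"
      by simp
    also have "\<dots> \<le> (\<Sum>U\<in>orbs Y. card U)"
      by (rule sum_mono) (use m in \<open>auto simp: orbs_def\<close>)
    also have "\<dots> = card H * index"
      by (simp add: orbs(3)[OF Y] card_G)
    finally show ?thesis
      using card_pos by simp
  qed
  finally show ?thesis
    by (simp add: mult_left_mono)
qed

lemma min_generators_trivial: "dG \<le> a * index"
proof -
  have "dG * 1 \<le> a * index"
  proof (rule min_generators_semisimple[OF triv_subgroup])
    fix g assume g: "g \<in> carrier G"
    obtain m where "card (dcoset G H g {\<one>}) = card H * m" "m > 0"
      by (rule card_dcoset_multiple[OF triv_subgroup g])
    then show "card H * 1 \<le> card (dcoset G H g {\<one>})"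
      by simp
  qed simp
  then show ?thesis
    by simp
qed

text \<open>The order of a Sylow \<open>q\<close>-subgroup of the whole group divides the size of
  every double coset, so each of its orbit lengths is a multiple of the \<open>q\<close>-part of the
  index.\<close>

lemma min_generators_sylow:
  assumes q: "prime q" "q \<noteq> CHAR('f)" and p: "prime (CHAR('f))"
  shows "dG * p_part index q \<le> a * index"
proof -
  let ?k = "multiplicity q (card (carrier G))"
  obtain Y where Y: "subgroup Y G" "card Y = q ^ ?k"
    using sylow_subgroup[OF finite_G subgroup_self q(1) multiplicity_dvd] by blast
  show ?thesis
  proof (rule min_generators_semisimple[OF Y(1)])
    show "of_nat (card Y) \<noteq> (0 :: 'f)"
      unfolding of_nat_eq_0_iff_char_dvd Y(2) using q p by (metis prime_dvd_power primes_dvd_imp_eq)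
    fix g assume g: "g \<in> carrier G"
    obtain m where m: "card (dcoset G H g Y) = card H * m" "m > 0"
      by (rule card_dcoset_multiple[OF Y(1) g])
    have "card Y dvd card (dcoset G H g Y)"
      by (rule card_dvd_card_right[OF finite_G Y(1) dcoset_subset[OF subgroup_H Y(1) g]])
        (rule dcoset_closed_right[OF Y(1) g])
    then have "p_part index q dvd m"
      using p_part_dvd_quotient[OF q(1) card_pos(1,3) m(2)] by (simp add: Y(2) card_G m(1))
    then show "card H * p_part index q \<le> card (dcoset G H g Y)"
      using m by (simp add: dvd_imp_le)
  qed
qed

text \<open>The ratio \<open>r\<close> bounds the number of chains per coset in every orbit, and
  orbit lengths add up to the index. The integer \<open>n\<close> is kept separate because
  \<open>E_fun\<close> contains a floor.\<close>

lemma min_generators_labelling: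
  assumes Y: "subgroup Y G"
    and b: "\<And>g. g \<in> carrier G \<Longrightarrow> \<exists>qs \<tau>. (\<forall>q\<in>set qs. prime q) \<and> labelling G Y (conj_inter H g Y) qs \<tau>"
    and \<omega>: "\<And>k. \<lbrakk>k > 0; k dvd card Y; \<exists>U\<in>orbs Y. card U = card H * k\<rbrakk> \<Longrightarrow> omega_tilde k \<le> r * real k"
  shows "\<exists>n. dG \<le> a * n \<and> real n \<le> r * real index"
proof -
  have "\<exists>n. (\<forall>N. closed_under Y N \<longrightarrow> N \<subseteq> supported U \<longrightarrow> generated_by_le Y N (a * n)) \<and>
      real n * real (card H) \<le> r * real (card U)" if U: "U \<in> orbs Y" for U
  proof -
    obtain g where g: "g \<in> carrier G" "U = dcoset G H g Y"
      using U by (auto simp: orbs_def)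
    obtain qs \<tau> where qs: "\<forall>q\<in>set qs. prime q" "labelling G Y (conj_inter H g Y) qs \<tau>"
      using b[OF g(1)] by blast
    have qs0: "\<forall>q\<in>set qs. q > 0"
      using qs(1) prime_gt_0_nat by blast
    obtain Cs where Cs: "distinct (concat Cs)" "set (concat Cs) = grid qs"
      "\<And>C. C \<in> set Cs \<Longrightarrow> C \<noteq> [] \<and> successively step C \<and>
         sum_list (hd C) + sum_list (last C) = grid_rank qs"
      by (rule symmetric_chain_decomposition[OF qs0]) (rule that; blast)
    have C: "subgroup (conj_inter H g Y) G" "conj_inter H g Y \<subseteq> Y"
      using subgroup_conj_inter[OF subgroup_H Y g(1)] by (auto simp: conj_inter_def)
    have cY: "card Y = card (conj_inter H g Y) * prod_list qs"
      by (rule card_labelling[OF finite_G Y C qs(2)])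
    then have "card U * card (conj_inter H g Y) = (card H * prod_list qs) * card (conj_inter H g Y)"
      using card_dcoset[OF finite_G subgroup_H Y g(1)] g(2) by auto
    then have cU: "card U = card H * prod_list qs"
      using card_subgroup_pos[OF finite_G C(1)] by simp
    have "real (length Cs) \<le> omega_tilde (prod_list qs)"
      using length_le_middle[OF Cs] middle_layer_le_omega_tilde[OF qs(1)]
      by (meson of_nat_mono order_trans)
    also have "\<dots> \<le> r * real (prod_list qs)"
      using cY cU U card_subgroup_pos[OF finite_G Y] by (intro \<omega>) (auto intro: gr0I)
    finally have "real (length Cs) * real (card H) \<le> r * real (prod_list qs) * real (card H)"
      by (rule mult_right_mono) simp
    then have "real (length Cs) * real (card H) \<le> r * real (card U)"
      by (simp add: cU ac_simps)
    moreover have "generated_by_le Y N (a * length Cs)"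
      if "closed_under Y N" "N \<subseteq> supported U" for N
      by (rule generated_by_le_labelling[OF Y g(1) qs(2) that(1) _ Cs(2)]) (use that(2) g(2) Cs(3) in auto)
    ultimately show ?thesis
      by blast
  qed
  then obtain n where n: "\<And>U. U \<in> orbs Y \<Longrightarrow>
      (\<forall>N. closed_under Y N \<longrightarrow> N \<subseteq> supported U \<longrightarrow> generated_by_le Y N (a * n U)) \<and>
      real (n U) * real (card H) \<le> r * real (card U)"
    by metis
  have "dG \<le> (\<Sum>U\<in>orbs Y. a * n U)"
    by (rule d_le_sum[OF Y]) (use n in \<open>auto simp: orbs_def\<close>)
  also have "\<dots> = a * (\<Sum>U\<in>orbs Y. n U)"
    by (simp add: sum_distrib_left)
  finally have 1: "dG \<le> a * (\<Sum>U\<in>orbs Y. n U)" .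
  have "real (\<Sum>U\<in>orbs Y. n U) * real (card H) = (\<Sum>U\<in>orbs Y. real (n U) * real (card H))"
    by (simp add: sum_distrib_right)
  also have "\<dots> \<le> (\<Sum>U\<in>orbs Y. r * real (card U))"
    by (rule sum_mono) (use n in blast)
  also have "\<dots> = r * real (\<Sum>U\<in>orbs Y. card U)"
    by (simp add: sum_distrib_left)
  also have "\<dots> = r * real index * real (card H)"
    by (simp add: orbs(3)[OF Y] card_G)
  finally have "real (\<Sum>U\<in>orbs Y. n U) \<le> r * real index"
    using card_pos(1) by simp
  then show ?thesis
    using 1 by blast
qed

lemma min_generators_p_sylow:
  assumes p: "prime p" and r: "multiplicity p index > 0"
  shows "\<exists>n. dG \<le> a * n \<and>
    real n \<le> b_const * real index / sqrt ((real p - 1) * real (multiplicity p index))"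
proof -
  let ?k = "multiplicity p (card (carrier G))" and ?r = "multiplicity p index"
  let ?c = "b_const / sqrt ((real p - 1) * real ?r)"
  obtain Y where Y: "subgroup Y G" "card Y = p ^ ?k"
    using sylow_subgroup[OF finite_G subgroup_self p multiplicity_dvd] by blast
  have "\<exists>n. dG \<le> a * n \<and> real n \<le> ?c * real index"
  proof (rule min_generators_labelling[OF Y(1)])
    fix g assume g: "g \<in> carrier G"
    obtain n where n: "(derived G ^^ n) Y \<subseteq> {\<one>}"
      using p_group_derived_series[OF finite_G p Y] by blast
    have C: "subgroup (conj_inter H g Y) G" "conj_inter H g Y \<subseteq> Y"
      using subgroup_conj_inter[OF subgroup_H Y(1) g] by (auto simp: conj_inter_def)
    have "(derived G ^^ n) Y \<subseteq> conj_inter H g Y"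
      using n subgroup.one_closed[OF C(1)] by blast
    then show "\<exists>qs \<tau>. (\<forall>q\<in>set qs. prime q) \<and> labelling G Y (conj_inter H g Y) qs \<tau>"
      by (rule labelling_solvable[OF finite_G Y(1) C])
  next
    fix k assume k: "k > 0" "k dvd card Y" "\<exists>U\<in>orbs Y. card U = card H * k"
    obtain j where j: "k = p ^ j"
      using k(2) divides_primepow_nat[OF p] Y(2) by auto
    obtain g where g: "g \<in> carrier G" "card (dcoset G H g Y) = card H * k"
      using k(3) by (auto simp: orbs_def)
    have "card Y dvd card (dcoset G H g Y)"
      by (rule card_dvd_card_right[OF finite_G Y(1) dcoset_subset[OF subgroup_H Y(1) g(1)]])
        (rule dcoset_closed_right[OF Y(1) g(1)])
    then have "p_part index p dvd k"
      using p_part_dvd_quotient[OF p card_pos(1,3) k(1)] by (simp add: Y(2) card_G g(2))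
    \<comment> \<open>An orbit may be longer than the \<open>p\<close>-part of the index;
      \<open>omega_tilde_prime_power_le\<close> gives it the same ratio.\<close>
    then have "?r \<le> j"
      unfolding p_part_def j using p by (metis power_dvd_imp_le prime_gt_1_nat)
    from omega_tilde_prime_power_le[OF p r this] show "omega_tilde k \<le> ?c * real k"
      by (simp add: j)
  qed
  then show ?thesis
    by simp
qed

text \<open>Transitivity leaves a single double coset, so \<open>index\<close> is the only orbit
  length and \<open>omega_tilde index / index\<close> can be taken as the ratio. Labellings exist
  because the kernel of the action lies in every conjugate of \<open>H\<close>.\<close>

lemma min_generators_soluble:
  assumes Y: "subgroup Y G" and tr: "\<And>g. g \<in> carrier G \<Longrightarrow> \<exists>h\<in>H. \<exists>y\<in>Y. g = h \<otimes> y"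
    and sol: "(derived G ^^ n) Y \<subseteq> coset_kernel H"
  shows "real (dG) \<le> real a * omega_tilde index"
proof -
  note K = coset_kernel[OF finite_G subgroup_H]
  have one: "dcoset G H g Y = carrier G" if g: "g \<in> carrier G" for g
  proof -
    have "dcoset G H \<one> Y = carrier G"
    proof
      show "dcoset G H \<one> Y \<subseteq> carrier G"
        by (rule dcoset_subset[OF subgroup_H Y one_closed])
      show "carrier G \<subseteq> dcoset G H \<one> Y"
      proof
        fix x assume "x \<in> carrier G"
        then obtain h y where "h \<in> H" "y \<in> Y" "x = h \<otimes> y"
          using tr by blast
        then show "x \<in> dcoset G H \<one> Y"
          using dcosetI[of h H y Y \<one>] Hc by simp
      qed
    qed
    then show ?thesis
      using dcoset_eq[OF subgroup_H Y one_closed] g by simp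
  qed
  have DY: "(derived G ^^ n) Y \<subseteq> Y"
    using normalizes_derived_series[OF Y] by blast
  have "\<exists>m. dG \<le> a * m \<and>
      real m \<le> omega_tilde index / real index * real index"
  proof (rule min_generators_labelling[OF Y])
    fix g assume g: "g \<in> carrier G"
    have C: "subgroup (conj_inter H g Y) G" "conj_inter H g Y \<subseteq> Y"
      using subgroup_conj_inter[OF subgroup_H Y g] by (auto simp: conj_inter_def)
    have "(derived G ^^ n) Y \<subseteq> conj_inter H g Y"
      using sol DY K(3) normalizesD[OF K(2) g] by (force simp: conj_inter_def)
    then show "\<exists>qs \<tau>. (\<forall>q\<in>set qs. prime q) \<and> labelling G Y (conj_inter H g Y) qs \<tau>"
      by (rule labelling_solvable[OF finite_G Y C])
  next
    fix k assume "\<exists>U\<in>orbs Y. card U = card H * k"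
    then have "card (carrier G) = card H * k"
      using one by (auto simp: orbs_def)
    then have "k = index"
      using card_G card_pos by simp
    then show "omega_tilde k \<le> omega_tilde index / real index * real k"
      using card_pos by simp
  qed
  then obtain m where m: "dG \<le> a * m" "real m \<le> omega_tilde index"
    using card_pos by auto
  have "real (dG) \<le> real a * real m"
    using of_nat_mono[OF m(1), where 'a = real] by simp
  also have "\<dots> \<le> real a * omega_tilde index"
    by (rule mult_left_mono[OF m(2)]) simp
  finally show ?thesis .
qed

text \<open>Maschke's theorem applies to the \<open>p'\<close>-group \<open>X\<close>, while orbit
  lengths are controlled for its product \<open>Z\<close> with the kernel; both have the same
  orbits, as the kernel fixes all cosets. Since \<open>Y\<close> is transitive and \<open>Z\<close>
  has index a power of \<open>p\<close> in it, the \<open>p'\<close>-part \<open>t\<close> of the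
  index divides every orbit length.\<close>

lemma min_generators_hall:
  assumes Y: "subgroup Y G" and tr: "\<And>g. g \<in> carrier G \<Longrightarrow> \<exists>h\<in>H. \<exists>y\<in>Y. g = h \<otimes> y"
    and sol: "(derived G ^^ n) Y \<subseteq> coset_kernel H" and p: "prime (CHAR('f))"
  shows "dG \<le> a * p_part index (CHAR('f))"
proof -
  define p where "p = CHAR('f)"
  have pp: "prime p"
    using p by (simp add: p_def)
  note K = coset_kernel[OF finite_G subgroup_H]
  let ?K = "Y \<inter> coset_kernel H"
  have DY: "(derived G ^^ n) Y \<subseteq> Y"
    using normalizes_derived_series[OF Y] by blast
  have K': "subgroup ?K G"
    by (rule subgroups_Inter_pair[OF Y K(1)])
  have YK: "normalizes G Y ?K"
    using normalizesD[OF K(2)] subgroup.mem_carrier[OF Y] subgroup.m_closed[OF Y] subgroup.m_inv_closed[OF Y]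
    by (auto simp: normalizes_def)
  obtain X e where X: "subgroup X G" "X \<subseteq> Y" "\<not> p dvd card X" "card Y = p ^ e * card (X <#> ?K)"
  proof (rule hall_supplement[OF finite_G pp Y K' Int_lower1])
    show "(derived G ^^ n) Y \<subseteq> ?K"
      using sol DY by blast
  qed (use YK that in auto)
  define Z where "Z = X <#> ?K"
  have Z: "subgroup Z G"
    unfolding Z_def
    by (rule normalizes_set_mult[OF X(1) K' normalizes_mono[OF YK X(2)] finite_G])
  have ZY: "Z \<subseteq> Y"
    unfolding Z_def by (rule set_mult_subset[OF Y X(2) Int_lower1])
  have XZ: "X \<subseteq> Z"
    unfolding Z_def by (rule set_mult_mono_left[OF X(1) K'])
  define t where "t = index div p_part index p"
  have t: "index = p_part index p * t" "\<not> p dvd t"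
  proof -
    obtain u where u: "index = p ^ multiplicity p index * u" "\<not> p dvd u"
      using multiplicity_decompose'[of index p] card_pos(3) not_prime_unit[of p] pp by blast
    then have "t = u"
      using pp by (metis nonzero_mult_div_cancel_left p_part_def power_not_zero prime_gt_0_nat t_def not_gr0)
    then show "index = p_part index p * t" "\<not> p dvd t"
      using u by (auto simp: p_part_def)
  qed
  have "dG * t \<le> a * index"
  proof (rule min_generators_semisimple[OF X(1)])
    show "of_nat (card X) \<noteq> (0 :: 'f)"
      using X(3) by (simp add: of_nat_eq_0_iff_char_dvd p_def)
    fix g assume g: "g \<in> carrier G"
    have "dcoset G H g Z \<subseteq> dcoset G H g X"
    proof
      fix x assume "x \<in> dcoset G H g Z"
      then obtain h z where x: "x = h \<otimes> g \<otimes> z" "h \<in> H" "z \<in> Z"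
        by (rule dcosetE)
      obtain y k where yk: "z = y \<otimes> k" "y \<in> X" "k \<in> ?K"
        using x(3) unfolding Z_def by (rule set_multE)
      have c: "h \<in> carrier G" "y \<in> carrier G" "k \<in> carrier G"
        using x yk Hc subgroup.mem_carrier[OF X(1)] subgroup.mem_carrier[OF K'] by auto
      obtain h' where h': "h' \<in> H" "(h \<otimes> g \<otimes> y) \<otimes> k = h' \<otimes> (h \<otimes> g \<otimes> y)"
        using K(4)[of k "h \<otimes> g \<otimes> y"] yk(3) c g by auto
      have "x = h' \<otimes> (h \<otimes> g \<otimes> y)"
        unfolding h'(2)[symmetric] using c g by (simp add: x yk gsimps)
      then show "x \<in> dcoset G H g X"
        using dcoset_closed_left[OF X(1) g dcosetI[OF x(2) yk(2)] h'(1)] by simp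
    qed
    moreover have "dcoset G H g X \<subseteq> dcoset G H g Z"
      using XZ by (auto simp: dcoset_def)
    ultimately have eq: "dcoset G H g X = dcoset G H g Z"
      by blast
    have all: "dcoset G H g Y = carrier G"
    proof -
      have "x \<in> dcoset G H \<one> Y" if "x \<in> carrier G" for x
        using tr[OF that] Hc dcosetI[of _ H _ Y \<one>] by fastforce
      then show ?thesis
        using dcoset_eq[OF subgroup_H Y one_closed, of g] dcoset_subset[OF subgroup_H Y one_closed] g by blast
    qed
    obtain m where m: "card (dcoset G H g Z) = card H * m" "m > 0"
      by (rule card_dcoset_multiple[OF Z g])
    let ?CZ = "conj_inter H g Z" and ?CY = "conj_inter H g Y"
    have CZ: "subgroup ?CZ G" and CY: "subgroup ?CY G"
      using subgroup_conj_inter[OF subgroup_H _ g] Z Y by auto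
    have "?CZ \<subseteq> ?CY"
      using ZY by (auto simp: conj_inter_def)
    then obtain u where u: "card ?CY = card ?CZ * u"
      using card_subgroup_dvd[OF finite_G CZ CY] by blast
    have 1: "m * card ?CZ = card Z"
      using card_dcoset[OF finite_G subgroup_H Z g] card_pos(1) by (simp add: m(1) mult.assoc)
    have 2: "index * card ?CY = card Y"
      using card_dcoset[OF finite_G subgroup_H Y g] card_pos(1) by (simp add: all card_G mult.assoc)
    \<comment> \<open>The order of \<open>Y\<close>, computed by orbit and stabiliser once for
      \<open>Y\<close> and once, up to \<open>p ^ e\<close>, for \<open>Z\<close>.\<close>
    have "(index * u) * card ?CZ = (p ^ e * m) * card ?CZ"
      using 1 2 X(4) u by (simp add: Z_def[symmetric] ac_simps)
    then have "index * u = p ^ e * m"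
      using card_subgroup_pos[OF finite_G CZ] by simp
    then have "t dvd p ^ e * m"
      using t(1) by (metis dvd_triv_left dvd_triv_right dvd_trans)
    moreover have "coprime t (p ^ e)"
      using t(2) pp by (metis coprime_commute coprime_power_right_iff prime_imp_coprime)
    ultimately have "t dvd m"
      by (simp add: coprime_dvd_mult_right_iff)
    then show "card H * t \<le> card (dcoset G H g X)"
      unfolding eq using m by (simp add: dvd_imp_le)
  qed
  also have "a * index = a * p_part index p * t"
    using t(1) by simp
  finally show ?thesis
    using t(1) card_pos(3) by (cases "t = 0") (auto simp: p_def)
qed

end

end

theorem theorem1p6:
  fixes G :: "('g, 'm) monoid_scheme"
    and H :: "'g set"
    and scale :: "'f::field \<Rightarrow> 'v::ab_group_add \<Rightarrow> 'v"
    and act :: "'v \<Rightarrow> 'g \<Rightarrow> 'v"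
    and V :: "'v set"
    and M :: "('g \<Rightarrow> 'v) set"
    and p s a :: nat
  assumes "group G" and "finite (carrier G)"
    and "CHAR('f) = p" and "p > 0"
    and "subgroup H G" and "s = card (rcosets\<^bsub>G\<^esub> H)" and "s \<ge> 2"
    and "group_module (G\<lparr>carrier := H\<rparr>) scale act V"
    and "\<exists>B. finite B \<and> module.span scale B = V" and "vector_space.dim scale V = a"
    and "group_submodule G (induced_scale scale) (induced_act G) M (induced_module G H act V)"
  shows "real (min_generators G (induced_scale scale) (induced_act G) M) \<le>
    real a *
      (if has_soluble_transitive_subgroup (rcosets\<^bsub>G\<^esub> H) (coset_permutation_group G H)
       then E_sol s p else E_fun s p)"
proof -
  interpret I: induced_setup G H scale act V a
    using assms by (simp add: induced_setup_def induced_setup_axioms_def)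
  let ?d = "min_generators G (induced_scale scale) (induced_act G) M"
  have s: "s = I.index"
    using assms by (simp add: I.index_def)
  have s0: "s > 0"
    using assms by simp
  have p: "prime (CHAR('f))" "prime p"
    using assms prime_CHAR_semidom[where 'a = 'f] by auto
  note M = assms(11)
  have quot: "real ?d \<le> real a * (real s / real m)" if "?d * m \<le> a * s" "m > 0" for m
  proof -
    have "real ?d * real m \<le> real a * real s"
      using that(1) by (metis of_nat_le_iff of_nat_mult)
    then show ?thesis
      using that(2) by (simp add: field_simps)
  qed
  show ?thesis
  proof (cases "has_soluble_transitive_subgroup (rcosets\<^bsub>G\<^esub> H) (coset_permutation_group G H)")
    case True
    obtain Y n where Y: "subgroup Y G" "\<And>g. g \<in> carrier G \<Longrightarrow> \<exists>h\<in>H. \<exists>y\<in>Y. g = h \<otimes>\<^bsub>G\<^esub> y"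
      "(derived G ^^ n) Y \<subseteq> I.coset_kernel H"
      using I.soluble_transitive_preimage[OF assms(2,5) True] by blast
    have "real ?d \<le> real a * omega_tilde s"
      unfolding s by (rule I.min_generators_soluble[OF M Y])
    moreover have "real ?d \<le> real a * real (p_part s p)"
      using I.min_generators_hall[OF M Y p(1)] assms(3) s by (metis of_nat_le_iff of_nat_mult)
    ultimately show ?thesis
      using True by (simp add: E_sol_def min_def)
  next
    case False
    let ?s' = "s div p_part s p"
    have "real ?d \<le> real a * (real s / real (lpp ?s'))"
    proof -
      have pp: "p_part s p dvd s" "p_part s p > 0"
        using p s0 by (auto simp: p_part_def multiplicity_dvd prime_gt_0_nat)
      then have "?s' > 0"
        using s0 by (metis dvd_div_eq_0_iff gr0I less_irrefl)
      then have "lpp ?s' \<in> {p_part ?s' q | q. prime q}"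
        unfolding lpp_def using two_is_prime_nat by (intro Max_in finite_p_parts) auto
      then obtain q where q: "prime q" "lpp ?s' = p_part ?s' q"
        by blast
      have mult: "s = p_part s p * ?s'"
        using pp by simp
      show ?thesis
      proof (cases "q = p")
        \<comment> \<open>The \<open>p\<close>-part of \<open>?s'\<close> is 1. If the maximum is
          attained there it equals 1, and the bound from the trivial subgroup suffices.\<close>
        case True
        have "multiplicity p s = multiplicity p s + multiplicity p ?s'"
          using p s0 \<open>?s' > 0\<close> prime_elem_multiplicity_mult_distrib[of p "p_part s p" ?s'] mult pp(2)
          by (simp add: p_part_def multiplicity_prime_power)
        then have "multiplicity p ?s' = 0"
          by simp
        then have "lpp ?s' = 1"
          unfolding q(2) True p_part_def[of ?s' p] by simp
        moreover have "real ?d \<le> real a * (real s / real 1)"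
          by (rule quot) (use I.min_generators_trivial[OF M] s in auto)
        ultimately show ?thesis
          by simp
      next
        case False
        have "multiplicity q (p_part s p) = 0"
          unfolding p_part_def using False p q by (simp add: multiplicity_distinct_prime_power)
        then have "multiplicity q s = multiplicity q ?s'"
          using prime_elem_multiplicity_mult_distrib[of q "p_part s p" ?s'] mult pp(2) \<open>?s' > 0\<close> q(1) by simp
        then have "lpp ?s' = p_part s q"
          unfolding q(2) p_part_def[of ?s' q] p_part_def[of s q] by simp
        moreover have "real ?d \<le> real a * (real s / real (p_part s q))"
        proof (rule quot)
          show "?d * p_part s q \<le> a * s"
            unfolding s using I.min_generators_sylow[OF M q(1) _ p(1)] False assms(3) by simp
          show "p_part s q > 0"
            using q(1) by (simp add: p_part_def prime_gt_0_nat)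
        qed
        ultimately show ?thesis
          by simp
      qed
    qed
    moreover have "real ?d \<le> real a * real_of_int
        \<lfloor>b_const * real s / sqrt ((real p - 1) * log (real p) (real (p_part s p)))\<rfloor>" if "p_part s p \<noteq> 1"
    proof -
      have r: "multiplicity p s > 0"
        using that by (auto simp: p_part_def intro: gr0I)
      have "log (real p) (real (p_part s p)) = real (multiplicity p s)"
        using prime_gt_1_nat[OF p(2)] by (simp add: p_part_def log_nat_power)
      then obtain n where n: "?d \<le> a * n"
        "real n \<le> b_const * real s / sqrt ((real p - 1) * log (real p) (real (p_part s p)))"
        using I.min_generators_p_sylow[OF M p(2)] r s by auto
      \<comment> \<open>The floor is taken before multiplication by \<open>a\<close>, so it has to
        be compared with the integer \<open>n\<close> and not with the bound for
        \<open>?d\<close>.\<close>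
      have "real n \<le> real_of_int \<lfloor>b_const * real s / sqrt ((real p - 1) * log (real p) (real (p_part s p)))\<rfloor>"
        using n(2) by (metis floor_of_nat floor_mono of_int_le_iff of_int_of_nat_eq)
      then have "real a * real n \<le> real a * real_of_int
        \<lfloor>b_const * real s / sqrt ((real p - 1) * log (real p) (real (p_part s p)))\<rfloor>"
        by (rule mult_left_mono) simp
      moreover have "real ?d \<le> real a * real n"
        using n(1) by (metis of_nat_le_iff of_nat_mult)
      ultimately show ?thesis
        by linarith
    qed
    ultimately show ?thesis
      using False by (cases "p_part s p = 1") (simp_all add: E_fun_def min_def Let_def)
  qed
qed

end
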